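(* For a nonnegative integer $s$, let $SH_n^d(s)$ denote the number of $d$-dimensional $n\times\cdots\times n$ semi-magic hypercubes ($n^d$ nonnegative integer entries) with magic sum $s$. Then: (1) As formal power series, $$\sum_{s=0}^{\infty} SH_3^3(s)t^s = \frac{t^8 + 5t^7 + 67t^6 + 130t^5 + 242t^4 + 130t^3 + 67t^2 + 5t + 1}{(1-t)^9(1+t)^2}$$ $$= 1 + 12t + 132t^2 + 847t^3 + 3921t^4 + 14286t^5 + 43687t^6 + 116757t^7 + \cdots.$$ In other words, for every integer $s\ge 0$, $$SH_3^3(s) = \begin{cases} \frac{9}{2240}s^8 + \frac{27}{560}s^7 + \frac{87}{320}s^6 + \frac{297}{320}s^5 + \frac{1341}{640}s^4 + \frac{513}{160}s^3 + \frac{3653}{1120}s^2 + \frac{627}{280}s + 1 & \text{if } 2\mid s, \\[4pt] \frac{9}{2240}s^8 + \frac{27}{560}s^7 + \frac{87}{320}s^6 + \frac{297}{320}s^5 + \frac{1341}{640}s^4 + \frac{513}{160}s^3 + \frac{3653}{1120}s^2 + \frac{4071}{2240}s + \frac{47}{128} & \text{otherwise.} \end{cases}$$ (2) For every positive integer $n$, the number of vertices of the polytope of stochastic semi-magic $n\times n\times n$ cubes is at least $(n!)^{2n}/n^{n^2}$. Moreover, the polytope of stochastic semi-magic $3\times 3\times 3$ cubes and the polytope of stochastic semi-magic $3\times 3\times 3\times 3$ hypercubes are not integral.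
   Context: A semi-magic hypercube is a $d$-dimensional $n \times n \times \cdots \times n$ array $(x_{i_1,\ldots,i_d})_{1\le i_1,\ldots,i_d\le n}$ of $n^d$ nonnegative integers such that the sum of the entries along every line parallel to a coordinate axis (i.e. fixing all but one index and summing over the remaining one) is the same number $s$, called the magic sum. A semi-magic $n\times n\times n$ cube is the case $d=3$. The polytope of stochastic semi-magic $d$-dimensional hypercubes (of size $n$) is the set of all real nonnegative $n\times\cdots\times n$ arrays in $\mathbb{R}^{n^d}$ all of whose axis-parallel line sums equal $1$. A polytope is integral if all its vertices have integer coordinates. *)

theory Defs
  imports "HOL-Analysis.Analysis" "HOL-Computational_Algebra.Formal_Power_Series"
begin

text \<open>
  A \<open>d\<close>-dimensional \<open>n \<times> \<dots> \<times> n\<close> array is indexed by the functions \<open>'d \<Rightarrow> 'n\<close> between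
  finite types with \<open>CARD('d) = d\<close> and \<open>CARD('n) = n\<close>, so a real array is a vector in
  \<open>real ^ ('d \<Rightarrow> 'n)\<close>, that is, in \<open>\<real>\<^bsup>n^d\<^esup>\<close>. The line through the cell \<open>i\<close> parallel to
  the axis \<open>k\<close> consists of the cells \<open>i(k := j)\<close> for \<open>j :: 'n\<close>.
\<close>

definition line_sums_eq :: "(('d::finite \<Rightarrow> 'n::finite) \<Rightarrow> 'a::comm_monoid_add) \<Rightarrow> 'a \<Rightarrow> bool"
  where "line_sums_eq x s \<longleftrightarrow> (\<forall>k i. (\<Sum>j\<in>UNIV. x (i(k := j))) = s)"

definition semi_magic_hypercubes :: "nat \<Rightarrow> (('d::finite \<Rightarrow> 'n::finite) \<Rightarrow> nat) set"
  where "semi_magic_hypercubes s = {x. line_sums_eq x s}"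

definition SH :: "'n::finite itself \<Rightarrow> 'd::finite itself \<Rightarrow> nat \<Rightarrow> nat"
  where "SH _ _ s = card (semi_magic_hypercubes s :: (('d \<Rightarrow> 'n) \<Rightarrow> nat) set)"

definition stochastic_hypercubes :: "(real ^ ('d::finite \<Rightarrow> 'n::finite)) set"
  where "stochastic_hypercubes = {x. (\<forall>i. 0 \<le> x $ i) \<and> line_sums_eq (\<lambda>i. x $ i) 1}"

definition polytope_vertices :: "'a::real_vector set \<Rightarrow> 'a set"
  where "polytope_vertices P = {v. v extreme_point_of P}"

definition integral_polytope :: "(real ^ 'm::finite) set \<Rightarrow> bool"
  where "integral_polytope P \<longleftrightarrow> (\<forall>v \<in> polytope_vertices P. \<forall>i. v $ i \<in> \<int>)"

end

theory Submission
  imports Defs "HOL-Computational_Algebra.Fundamental_Theorem_Algebra"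
begin

text \<open>
  \<^bold>\<open>Generating function.\<close> Write the cells of a layer in the coordinates \<open>u = r - c\<close>, \<open>v = r + c\<close>
  modulo 3. Layer \<open>k\<close> of a semi-magic cube then has the form \<open>h k + a k u + b k v\<close> with
  \<open>a k\<close>, \<open>b k\<close> nonnegative and vanishing somewhere. Hall's condition for these supports shows that the
  support of every nonzero cube contains that of a Latin square, unless the cubes with this support span
  a space of dimension at most 2, and then it contains that of a cube of magic sum 2. Peeling off such
  cubes one after the other yields the denominator \<open>(1 - t)\<^sup>7 (1 - t\<^sup>2)\<^sup>2\<close> with a numerator of degree at
  most 11. The same bound holds for cubes with positive entries, whose generating function is \<open>t\<^sup>3\<close> times
  the original one; so the numerator has degree at most 8, and the values for \<open>s \<le> 8\<close> determine it. The
  normal form reduces these to counting pairs of \<open>3 \<times> 3\<close> matrices with equal column sums and a zero in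
  every row.

  \<^bold>\<open>Vertices.\<close> Latin squares are vertices. Building them layer by layer requires
  van der Waerden's inequality for regular 0/1 matrices, which is proved by Gurvits' capacity argument.
  A half-integral cube that is determined by its support is a vertex, and shearing it along a fourth axis
  gives a vertex in dimension 4.
\<close>

section \<open>Lattice points in cones\<close>

text \<open>The induction behind the denominator runs over the faces of the cone of nonnegative
  cubes. Counts on a face are reduced to counts on smaller faces, and the denominators of all of
  these must divide one another. So the magic sum of the cube that is peeled off may depend only on
  the dimension of the face: it is 2 in dimensions 1 and 2, where a Latin square in the support is
  doubled, and 1 from dimension 3 on. Since the cubes span dimension at most 9, this gives two
  factors 1 - t^2 and seven factors 1 - t. The largest multiple that can be peeled off is a real
  number and leaves the integer lattice, so the induction has to treat all translates of the lattice
  and real magic sums. For Latin squares, \<open>m\<close> finished layers leave an (n - m)-regular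
  0/1 matrix, which contains at least n! ((n - m)/n)^n permutations. The product over all m < n is
  (n!)^n (n!/n^n)^n, which is the stated bound.\<close>

definition stepdiff :: "real \<Rightarrow> (real \<Rightarrow> real) \<Rightarrow> real \<Rightarrow> real"
  where "stepdiff c g s = g s - g (s - c)"

text \<open>\<open>stepdiff c\<close> multiplies a generating function by 1 - t^c, so
  \<open>steps\<close> clears the denominator. The argument is real because real multiples of cubes
  are peeled off.\<close>

primrec steps :: "(nat \<Rightarrow> real) \<Rightarrow> nat \<Rightarrow> (real \<Rightarrow> real) \<Rightarrow> real \<Rightarrow> real"
  where
    "steps \<delta> 0 g = g"
  | "steps \<delta> (Suc k) g = steps \<delta> k (stepdiff (\<delta> k) g)"

text \<open>In terms of generating functions: \<open>g\<close> is a quotient with denominator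
  \<open>\<Prod>i<k. (1 - t\<^bsup>\<delta> i\<^esup>)\<close> whose numerator has at most the degree of the denominator.\<close>
definition stepbound :: "(nat \<Rightarrow> real) \<Rightarrow> nat \<Rightarrow> (real \<Rightarrow> real) \<Rightarrow> bool"
  where "stepbound \<delta> k g \<longleftrightarrow> (\<forall>s. s < 0 \<or> (\<Sum>i<k. \<delta> i) < s \<longrightarrow> steps \<delta> k g s = 0)"

lemma stepdiff_sum: "stepdiff c (\<lambda>s. \<Sum>i\<in>I. g i s) = (\<lambda>s. \<Sum>i\<in>I. stepdiff c (g i) s)"
  by (auto simp: stepdiff_def fun_eq_iff sum_subtractf)

lemma steps_sum: "steps \<delta> k (\<lambda>s. \<Sum>i\<in>I. g i s) = (\<lambda>s. \<Sum>i\<in>I. steps \<delta> k (g i) s)"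
  by (induction k arbitrary: g) (auto simp: stepdiff_sum)

lemma stepdiff_shift: "stepdiff c (\<lambda>s. g (s - a)) = (\<lambda>s. stepdiff c g (s - a))"
  by (auto simp: stepdiff_def fun_eq_iff algebra_simps)

lemma steps_shift: "steps \<delta> k (\<lambda>s. g (s - a)) = (\<lambda>s. steps \<delta> k g (s - a))"
  by (induction k arbitrary: g) (auto simp: stepdiff_shift)

lemma stepdiff_commute: "stepdiff c (stepdiff e g) = stepdiff e (stepdiff c g)"
  by (auto simp: stepdiff_def fun_eq_iff algebra_simps)

lemma steps_stepdiff: "steps \<delta> k (stepdiff c g) = stepdiff c (steps \<delta> k g)"
  by (induction k arbitrary: g) (simp_all add: stepdiff_commute[of "\<delta> k" c for k])

lemma steps_zero: "steps \<delta> k (\<lambda>s. 0) = (\<lambda>s. 0)"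
proof (induction k)
  case (Suc k)
  moreover have "stepdiff c (\<lambda>s. 0) = (\<lambda>s. 0)" for c by (simp add: stepdiff_def fun_eq_iff)
  ultimately show ?case by simp
qed simp

lemma stepbound_zero: "stepbound \<delta> k (\<lambda>s. 0)"
  by (simp add: stepbound_def steps_zero)

lemma stepbound_Suc: "stepbound \<delta> k g \<Longrightarrow> 0 < \<delta> k \<Longrightarrow> stepbound \<delta> (Suc k) g"
  by (auto simp: stepbound_def steps_stepdiff stepdiff_def)

lemma stepbound_mono:
  "stepbound \<delta> k g \<Longrightarrow> k \<le> l \<Longrightarrow> (\<And>i. 0 < \<delta> i) \<Longrightarrow> stepbound \<delta> l g"
  by (rule inc_induct[where P = "\<lambda>n. stepbound \<delta> n g \<longrightarrow> stepbound \<delta> l g", rule_format])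
    (auto intro: stepbound_Suc)

text \<open>A new denominator factor of degree \<open>\<delta> k\<close> pays for the shifts: each
  shift \<open>\<delta> k * a i\<close> is positive and at most \<open>\<delta> k\<close>, so the
  numerator stays between 0 and the enlarged bound.\<close>

lemma stepbound_SucI:
  assumes "finite I" and d: "0 < \<delta> k"
    and "\<And>i. i \<in> I \<Longrightarrow> stepbound \<delta> k (g i)"
    and "\<And>i. i \<in> I \<Longrightarrow> 0 < a i \<and> a i \<le> 1"
    and "\<And>s. f s - f (s - \<delta> k) = (\<Sum>i\<in>I. g i (s - \<delta> k * a i))"
  shows "stepbound \<delta> (Suc k) f"
proof -
  have "stepdiff (\<delta> k) f = (\<lambda>s. \<Sum>i\<in>I. g i (s - \<delta> k * a i))"
    using assms(5) by (simp add: stepdiff_def fun_eq_iff)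
  then have eq: "steps \<delta> (Suc k) f = (\<lambda>s. \<Sum>i\<in>I. steps \<delta> k (g i) (s - \<delta> k * a i))"
    by (simp add: steps_sum steps_shift)
  show ?thesis
    unfolding stepbound_def eq
  proof (intro allI impI sum.neutral ballI)
    fix s i assume s: "s < 0 \<or> (\<Sum>i<Suc k. \<delta> i) < s" and i: "i \<in> I"
    have "0 < \<delta> k * a i" "\<delta> k * a i \<le> \<delta> k"
      using d assms(4)[OF i] by (auto intro: mult_pos_pos simp: mult_left_le)
    with s have "s - \<delta> k * a i < 0 \<or> (\<Sum>i<k. \<delta> i) < s - \<delta> k * a i" by auto
    with assms(3)[OF i] show "steps \<delta> k (g i) (s - \<delta> k * a i) = 0"
      by (auto simp: stepbound_def)
  qed
qed

section \<open>Graded cones and the count of lattice points of given support\<close>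

definition supported_in :: "(real ^ 'c::finite) set \<Rightarrow> 'c set \<Rightarrow> (real ^ 'c) set"
  where "supported_in L U = {x \<in> L. \<forall>c. x $ c \<noteq> 0 \<longrightarrow> c \<in> U}"

text \<open>\<open>entry_le\<close> makes the set of lattice points of a given grade finite.
  \<open>generator\<close> supplies the point to peel off; its grade is prescribed by the dimension
  of the face, so that the denominators along a chain of faces are nested.\<close>

locale graded_cone =
  fixes L :: "(real ^ 'c::finite) set" and d :: "real ^ 'c \<Rightarrow> real" and \<delta> :: "nat \<Rightarrow> real"
  assumes subspace_L: "subspace L"
    and linear_d: "linear d"
    and \<delta>_pos: "0 < \<delta> k"
    and entry_le: "\<lbrakk>x \<in> L; \<And>c. 0 \<le> x $ c\<rbrakk> \<Longrightarrow> x $ c \<le> d x"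
    and generator: "\<lbrakk>x \<in> L; \<And>c. 0 \<le> x $ c; x \<noteq> 0\<rbrakk> \<Longrightarrow>
      \<exists>e\<in>L. (\<forall>c. 0 \<le> e $ c \<and> e $ c \<in> \<int>) \<and>
      d e = \<delta> (dim (supported_in L {c. x $ c \<noteq> 0}) - 1) \<and> (\<forall>c. e $ c \<noteq> 0 \<longrightarrow> x $ c \<noteq> 0)"
begin

text \<open>The points of the translated lattice \<theta> + Z^c with exact support \<open>U\<close>
  and grade \<open>s\<close>. Peeling off a real multiple of an integral point changes the
  translate.\<close>

definition slice :: "'c set \<Rightarrow> real ^ 'c \<Rightarrow> real \<Rightarrow> (real ^ 'c) set"
  where "slice U \<theta> s =
    {x \<in> L. (\<forall>c. 0 \<le> x $ c) \<and> {c. x $ c \<noteq> 0} = U \<and> (\<forall>c. x $ c - \<theta> $ c \<in> \<int>) \<and> d x = s}"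

lemma finite_slice: "finite (slice U \<theta> s)"
proof -
  let ?f = "\<lambda>x :: real ^ 'c. \<lambda>c. \<lfloor>x $ c - \<theta> $ c\<rfloor>"
  have "inj_on ?f (slice U \<theta> s)"
  proof (rule inj_onI)
    fix x y assume x: "x \<in> slice U \<theta> s" and y: "y \<in> slice U \<theta> s" and e: "?f x = ?f y"
    have "x $ c = y $ c" for c
    proof -
      have "of_int \<lfloor>x $ c - \<theta> $ c\<rfloor> = x $ c - \<theta> $ c" "of_int \<lfloor>y $ c - \<theta> $ c\<rfloor> = y $ c - \<theta> $ c"
        using x y by (auto simp: slice_def)
      with fun_cong[OF e, of c] show ?thesis by (metis diff_add_cancel)
    qed
    then show "x = y" by (simp add: vec_eq_iff)
  qed
  moreover have "?f ` slice U \<theta> s \<subseteq> (PiE UNIV (\<lambda>c. {\<lfloor>- \<theta> $ c\<rfloor>..\<lfloor>s - \<theta> $ c\<rfloor>}))"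
  proof
    fix h assume "h \<in> ?f ` slice U \<theta> s"
    then obtain x where x: "x \<in> slice U \<theta> s" and h: "h = ?f x" by auto
    have "0 \<le> x $ c" "x $ c \<le> s" for c
      using x entry_le[of x c] by (auto simp: slice_def)
    then show "h \<in> (PiE UNIV (\<lambda>c. {\<lfloor>- \<theta> $ c\<rfloor>..\<lfloor>s - \<theta> $ c\<rfloor>}))"
      by (auto simp: h intro!: floor_mono)
  qed
  moreover have "finite (PiE (UNIV :: 'c set) (\<lambda>c. {\<lfloor>- \<theta> $ c\<rfloor>..\<lfloor>s - \<theta> $ c\<rfloor>}))"
    by (intro finite_PiE) auto
  ultimately show ?thesis by (meson finite_imageD finite_subset)
qed

text \<open>If \<open>U\<close> is the support of a nonnegative point of \<open>L\<close>, this is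
  the linear span of the face of the cone that has this point in its relative interior.\<close>

abbreviation "face U \<equiv> supported_in L U"

lemma subspace_face: "subspace (face U)"
  using subspace_L by (auto simp: supported_in_def subspace_def) (metis add.right_neutral)

lemma dim_face_less:
  assumes "U' \<subseteq> U" "e \<in> face U" "e \<notin> face U'"
  shows "dim (face U') < dim (face U)"
proof -
  have "face U' \<subset> face U" using assms by (auto simp: supported_in_def)
  then show ?thesis
    by (intro dim_psubset) (metis span_eq_iff subspace_face)
qed

text \<open>The candidates for a peeled multiple of at most 1: the remainder vanishes at some cell
  of the support of \<open>e\<close>, and there \<open>l * e\<close> must agree with \<theta> modulo
  the integers.\<close>

definition fracs :: "real ^ 'c \<Rightarrow> real ^ 'c \<Rightarrow> real set"
  where "fracs e \<theta> = {l. 0 < l \<and> l \<le> 1 \<and> (\<exists>c. e $ c \<noteq> 0 \<and> \<theta> $ c - l * e $ c \<in> \<int>)}"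

lemma finite_fracs:
  assumes "\<And>c. 0 \<le> e $ c"
  shows "finite (fracs e \<theta>)"
proof -
  have "fracs e \<theta> \<subseteq> (\<Union>c. (\<lambda>z. (\<theta> $ c - of_int z) / e $ c) ` {\<lfloor>\<theta> $ c - e $ c\<rfloor>..\<lceil>\<theta> $ c\<rceil>})"
  proof
    fix l assume "l \<in> fracs e \<theta>"
    then obtain c where l: "0 < l" "l \<le> 1" and c: "e $ c \<noteq> 0" "\<theta> $ c - l * e $ c \<in> \<int>"
      by (auto simp: fracs_def)
    from c(2) obtain z where z: "\<theta> $ c - l * e $ c = of_int z" by (auto elim: Ints_cases)
    have "l * e $ c \<le> e $ c" "0 \<le> l * e $ c"
      using l assms[of c] by (auto simp: mult_left_le_one_le)
    then have "of_int z \<le> \<theta> $ c" "\<theta> $ c - e $ c \<le> of_int z" using z by auto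
    then have "z \<in> {\<lfloor>\<theta> $ c - e $ c\<rfloor>..\<lceil>\<theta> $ c\<rceil>}"
      by simp linarith
    moreover have "l = (\<theta> $ c - of_int z) / e $ c" using z c by (simp add: field_simps)
    ultimately show "l \<in> (\<Union>c. (\<lambda>z. (\<theta> $ c - of_int z) / e $ c) ` {\<lfloor>\<theta> $ c - e $ c\<rfloor>..\<lceil>\<theta> $ c\<rceil>})"
      by blast
  qed
  then show ?thesis by (rule finite_subset) auto
qed

definition cofaces :: "'c set \<Rightarrow> real ^ 'c \<Rightarrow> 'c set set"
  where "cofaces U e = {U'. U' \<subset> U \<and> U' \<union> {c. e $ c \<noteq> 0} = U}"

text \<open>Peeling off the largest multiple \<open>l\<close> of \<open>e\<close> that leaves a nonnegative remainder:
  either \<open>l > 1\<close>, and \<open>e\<close> itself can be subtracted without changing the support, or the remainder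
  lies in a proper face.\<close>
lemma slice_split:
  assumes e: "e \<in> L" "\<And>c. 0 \<le> e $ c \<and> e $ c \<in> \<int>" "d e = r" "0 < r" "{c. e $ c \<noteq> 0} \<subseteq> U" "e \<noteq> 0"
  shows "slice U \<theta> s = (\<lambda>x. x + e) ` slice U \<theta> (s - r) \<union>
    (\<Union>(U', l)\<in>cofaces U e \<times> fracs e \<theta>. (\<lambda>y. y + l *\<^sub>R e) ` slice U' (\<theta> - l *\<^sub>R e) (s - r * l))"
    (is "_ = ?A \<union> ?B")
proof (intro equalityI subsetI)
  fix x assume x: "x \<in> slice U \<theta> s"
  define E where "E = {c. e $ c \<noteq> 0}"
  define l where "l = Min ((\<lambda>c. x $ c / e $ c) ` E)"
  have E: "finite E" "E \<noteq> {}" using e(6) by (auto simp: E_def vec_eq_iff)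
  have epos: "0 < e $ c" if "c \<in> E" for c
    using that e(2)[of c] by (auto simp: E_def)
  have xpos: "0 < x $ c" if "c \<in> U" for c
    using x that by (auto simp: slice_def order.order_iff_strict)
  have EU: "E \<subseteq> U" using e(5) by (simp add: E_def)
  have l0: "0 < l" unfolding l_def using E epos xpos EU by (subst Min_gr_iff) auto
  have "l \<in> (\<lambda>c. x $ c / e $ c) ` E" unfolding l_def using E by (intro Min_in) auto
  then obtain c0 where c0: "c0 \<in> E" "l = x $ c0 / e $ c0" by auto
  have lle: "l * e $ c \<le> x $ c" for c
  proof (cases "c \<in> E")
    case True
    then have "l \<le> x $ c / e $ c" unfolding l_def using E by (intro Min_le) auto
    then show ?thesis using epos[OF True] by (simp add: field_simps)
  next
    case False
    then show ?thesis using x by (simp add: E_def slice_def)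
  qed
  show "x \<in> ?A \<union> ?B"
  proof (cases "l > 1")
    case True
    have lt: "e $ c < x $ c" if "c \<in> E" for c
    proof -
      have "1 * e $ c < l * e $ c" using True epos[OF that] by (intro mult_strict_right_mono) auto
      with lle[of c] show ?thesis by simp
    qed
    have "x - e \<in> slice U \<theta> (s - r)"
      unfolding slice_def
    proof (safe)
      show "x - e \<in> L" using x e(1) subspace_L by (auto simp: slice_def subspace_diff)
      show "0 \<le> (x - e) $ c" for c
        using lt[of c] x by (cases "c \<in> E") (auto simp: E_def slice_def)
      show "c \<in> U" if "(x - e) $ c \<noteq> 0" for c
        using that x EU by (auto simp: slice_def E_def)
      show "(x - e) $ c - \<theta> $ c \<in> \<int>" for c
      proof -
        have "(x $ c - \<theta> $ c) - e $ c \<in> \<int>" using x e(2)[of c] by (auto simp: slice_def)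
        then show ?thesis by (simp add: algebra_simps)
      qed
      show "d (x - e) = s - r" using x e(3) by (simp add: linear_diff[OF linear_d] slice_def)
      show False if "c \<in> U" "(x - e) $ c = 0" for c
        using that lt[of c] xpos[of c] by (cases "c \<in> E") (auto simp: E_def)
    qed
    then have "x - e + e \<in> ?A" by (intro imageI)
    then show ?thesis by simp
  next
    case False
    define y where "y = x - l *\<^sub>R e"
    define U' where "U' = {c. y $ c \<noteq> 0}"
    have y0: "y $ c0 = 0" using c0(2) epos[OF c0(1)] by (simp add: y_def)
    have "y \<in> slice U' (\<theta> - l *\<^sub>R e) (s - r * l)"
      unfolding slice_def
    proof (safe)
      show "y \<in> L" using x e(1) subspace_L by (auto simp: y_def slice_def subspace_diff subspace_scale)
      show "0 \<le> y $ c" for c using lle[of c] by (simp add: y_def)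
      show "c \<in> U'" if "y $ c \<noteq> 0" for c using that by (simp add: U'_def)
      show False if "c \<in> U'" "y $ c = 0" for c using that by (simp add: U'_def)
      show "y $ c - (\<theta> - l *\<^sub>R e) $ c \<in> \<int>" for c using x by (simp add: y_def slice_def)
      show "d y = s - r * l"
        using x e(3) by (simp add: y_def slice_def linear_diff[OF linear_d] linear_cmul[OF linear_d])
    qed
    moreover have "l \<in> fracs e \<theta>"
    proof -
      have "- (x $ c0 - \<theta> $ c0) \<in> \<int>" using x by (subst minus_in_Ints_iff) (auto simp: slice_def)
      moreover have "x $ c0 = l * e $ c0" using y0 by (simp add: y_def)
      ultimately have "\<theta> $ c0 - l * e $ c0 \<in> \<int>" by simp
      then show ?thesis using False l0 c0 by (auto simp: fracs_def E_def)
    qed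
    moreover have "U' \<in> cofaces U e"
    proof -
      have "U' \<subseteq> U" using x EU by (auto simp: U'_def y_def slice_def E_def)
      moreover have "c0 \<in> U" "c0 \<notin> U'" using c0 EU y0 by (auto simp: U'_def)
      moreover have "U \<subseteq> U' \<union> E" using x by (auto simp: U'_def y_def slice_def E_def)
      ultimately show ?thesis using EU by (auto simp: cofaces_def E_def)
    qed
    moreover have "x = y + l *\<^sub>R e" by (simp add: y_def)
    ultimately have "x \<in> ?B" by blast
    then show ?thesis by blast
  qed
next
  fix x assume "x \<in> ?A \<union> ?B"
  then show "x \<in> slice U \<theta> s"
  proof
    assume "x \<in> ?A"
    then obtain y where y: "y \<in> slice U \<theta> (s - r)" and x: "x = y + e" by auto
    show ?thesis
      unfolding slice_def
    proof safe
      show "x \<in> L" using x y e(1) subspace_L by (auto simp: slice_def subspace_add)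
      show "0 \<le> x $ c" for c using x y e(2)[of c] by (auto simp: slice_def)
      show "c \<in> U" if "x $ c \<noteq> 0" for c using that x y e(5) by (auto simp: slice_def)
      show False if "c \<in> U" "x $ c = 0" for c
        using that x y e(2)[of c] by (auto simp: slice_def add_nonneg_eq_0_iff)
      show "x $ c - \<theta> $ c \<in> \<int>" for c
      proof -
        have "(y $ c - \<theta> $ c) + e $ c \<in> \<int>" using y e(2)[of c] by (auto simp: slice_def)
        then show ?thesis by (simp add: x algebra_simps)
      qed
      show "d x = s" using x y e(3) by (simp add: linear_add[OF linear_d] slice_def)
    qed
  next
    assume "x \<in> ?B"
    then obtain U' l y where U': "U' \<in> cofaces U e" and l: "l \<in> fracs e \<theta>"
      and y: "y \<in> slice U' (\<theta> - l *\<^sub>R e) (s - r * l)" and x: "x = y + l *\<^sub>R e" by auto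
    have l0: "0 < l" using l by (simp add: fracs_def)
    have nz: "x $ c = 0 \<longleftrightarrow> y $ c = 0 \<and> e $ c = 0" for c
      using y l0 e(2)[of c] by (auto simp: slice_def x add_nonneg_eq_0_iff)
    show ?thesis
      unfolding slice_def
    proof safe
      show "x \<in> L" using x y e(1) subspace_L by (auto simp: slice_def subspace_add subspace_scale)
      show "0 \<le> x $ c" for c using x y e(2)[of c] l0 by (auto simp: slice_def)
      show "c \<in> U" if "x $ c \<noteq> 0" for c using that nz[of c] U' y by (auto simp: slice_def cofaces_def)
      show False if "c \<in> U" "x $ c = 0" for c
        using that nz[of c] U' y by (auto simp: slice_def cofaces_def)
      show "x $ c - \<theta> $ c \<in> \<int>" for c
        using y by (auto simp: x slice_def algebra_simps)
      show "d x = s" using x y e(3) by (simp add: linear_add[OF linear_d] linear_cmul[OF linear_d] slice_def)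
    qed
  qed
qed

lemma card_slice_split:
  assumes e: "e \<in> L" "\<And>c. 0 \<le> e $ c \<and> e $ c \<in> \<int>" "d e = r" "0 < r" "{c. e $ c \<noteq> 0} \<subseteq> U" "e \<noteq> 0"
  shows "real (card (slice U \<theta> s)) - real (card (slice U \<theta> (s - r))) =
    (\<Sum>(U', l)\<in>cofaces U e \<times> fracs e \<theta>. real (card (slice U' (\<theta> - l *\<^sub>R e) (s - r * l))))"
proof -
  let ?I = "cofaces U e \<times> fracs e \<theta>"
  let ?P = "\<lambda>(U', l). (\<lambda>y. y + l *\<^sub>R e) ` slice U' (\<theta> - l *\<^sub>R e) (s - r * l)"
  let ?A = "(\<lambda>x. x + e) ` slice U \<theta> (s - r)"
  have finI: "finite ?I" using finite_fracs e(2) by (simp add: cofaces_def)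
  have rem: "\<exists>c. e $ c > 0 \<and> y $ c = 0" if "U' \<in> cofaces U e" "y \<in> slice U' t q" for U' y t q
  proof -
    from that(1) obtain c where "c \<in> U" "c \<notin> U'" "e $ c \<noteq> 0" by (auto simp: cofaces_def)
    with that(2) e(2)[of c] show ?thesis by (intro exI[of _ c]) (auto simp: slice_def)
  qed
  text \<open>The peeled multiple is determined by the sum, because the remainder vanishes somewhere on the support of \<open>e\<close>.\<close>
  have le: "l \<le> l'" if "y + l *\<^sub>R e = y' + l' *\<^sub>R e" "U' \<in> cofaces U e" "y' \<in> slice U' t' r'" "\<And>c. 0 \<le> y $ c"
    for y y' l l' U' t' r'
  proof -
    from rem[OF that(2,3)] obtain c where c: "e $ c > 0" "y' $ c = 0" by auto
    have "y $ c + l * e $ c = y' $ c + l' * e $ c"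
      using arg_cong[OF that(1), of "\<lambda>v. v $ c"] by simp
    then have "l * e $ c \<le> l' * e $ c" using c that(4)[of c] by linarith
    then show ?thesis using c by (simp only: mult_le_cancel_right_pos)
  qed
  have nn: "0 \<le> y $ c" if "y \<in> slice V t q" for y V t q c using that by (simp add: slice_def)
  have disj: "?P p \<inter> ?P q = {}" if pq: "p \<in> ?I" "q \<in> ?I" "p \<noteq> q" for p q
  proof (rule ccontr)
    obtain U1 l1 U2 l2 where p: "p = (U1, l1)" and q: "q = (U2, l2)" by fastforce
    assume "?P p \<inter> ?P q \<noteq> {}"
    then obtain v where v: "v \<in> ?P p" "v \<in> ?P q" by blast
    from v(1) obtain y1 where y1: "v = y1 + l1 *\<^sub>R e" "y1 \<in> slice U1 (\<theta> - l1 *\<^sub>R e) (s - r * l1)"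
      unfolding p prod.case by (rule imageE)
    from v(2) obtain y2 where y2: "v = y2 + l2 *\<^sub>R e" "y2 \<in> slice U2 (\<theta> - l2 *\<^sub>R e) (s - r * l2)"
      unfolding q prod.case by (rule imageE)
    note y = y1(2) y2(2)
    have eq: "y1 + l1 *\<^sub>R e = y2 + l2 *\<^sub>R e" using y1(1) y2(1) by simp
    have "l1 = l2"
      using le[OF eq _ y(2)] le[OF eq[symmetric] _ y(1)] nn[OF y(1)] nn[OF y(2)] pq by (force simp: p q)
    with eq have "y1 = y2" by simp
    with y have "U1 = U2" by (auto simp: slice_def)
    with \<open>l1 = l2\<close> pq p q show False by simp
  qed
  \<comment> \<open>Elements of \<open>?A\<close> exceed \<open>e\<close> on its whole support,
    whereas those of \<open>?P\<close> equal \<open>l * e\<close>, hence are at most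
    \<open>e\<close>, at a cell where the remainder vanishes.\<close>
  have disjA: "?A \<inter> (\<Union>p\<in>?I. ?P p) = {}"
  proof (rule ccontr)
    assume "?A \<inter> (\<Union>p\<in>?I. ?P p) \<noteq> {}"
    then obtain v p where v: "v \<in> ?A" "v \<in> ?P p" and p: "p \<in> ?I" by blast
    obtain U' l where pe: "p = (U', l)" by fastforce
    from v(1) obtain x where x: "v = x + e" "x \<in> slice U \<theta> (s - r)" by (rule imageE)
    from v(2) obtain y where y': "v = y + l *\<^sub>R e" and y: "y \<in> slice U' (\<theta> - l *\<^sub>R e) (s - r * l)"
      unfolding pe prod.case by (rule imageE)
    have U': "U' \<in> cofaces U e" and l: "l \<in> fracs e \<theta>" using p pe by auto
    have eq: "x + e = y + l *\<^sub>R e" using x(1) y' by simp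
    from rem[OF U' y] obtain c where c: "e $ c > 0" "y $ c = 0" by auto
    have "x $ c + e $ c = l * e $ c" using arg_cong[OF eq, of "\<lambda>v. v $ c"] c by simp
    moreover have "l * e $ c \<le> e $ c" using l c by (auto simp: fracs_def)
    moreover have "0 < x $ c"
    proof -
      have "c \<in> U" using c e(5) by auto
      then have "x $ c \<noteq> 0" "0 \<le> x $ c" using x by (auto simp: slice_def)
      then show ?thesis by simp
    qed
    ultimately show False by simp
  qed
  have "card (slice U \<theta> s) = card (?A \<union> (\<Union>p\<in>?I. ?P p))"
    by (rule arg_cong[OF slice_split[OF e]])
  also have "\<dots> = card ?A + card (\<Union>p\<in>?I. ?P p)"
    using disjA finI finite_slice by (intro card_Un_disjoint) auto
  also have "card ?A = card (slice U \<theta> (s - r))" by (intro card_image) (auto simp: inj_on_def)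
  also have "card (\<Union>p\<in>?I. ?P p) = (\<Sum>p\<in>?I. card (?P p))"
    using disj finI finite_slice by (intro card_UN_disjoint) auto
  also have "\<dots> = (\<Sum>(U', l)\<in>?I. card (slice U' (\<theta> - l *\<^sub>R e) (s - r * l)))"
    by (intro sum.cong) (auto intro!: card_image simp: inj_on_def)
  finally show ?thesis by (simp add: case_prod_unfold)
qed

text \<open>Subtracting the count shifted by the grade of the generator contributes one new factor
  of the denominator and leaves counts on smaller faces in other translates; hence the claim for all
  \<theta>.\<close>

theorem stepbound_slice: "stepbound \<delta> (dim (face U)) (\<lambda>s. real (card (slice U \<theta> s)))"
proof (induction "card U" arbitrary: U \<theta> rule: less_induct)
  case less
  show ?case
  proof (cases "\<exists>x\<in>L. (\<forall>c. 0 \<le> x $ c) \<and> {c. x $ c \<noteq> 0} = U")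
    case False
    then have "slice U \<theta> s = {}" for s by (auto simp: slice_def)
    then show ?thesis by (simp add: stepbound_zero)
  next
    case True
    then obtain x where x: "x \<in> L" "\<And>c. 0 \<le> x $ c" "{c. x $ c \<noteq> 0} = U" by auto
    show ?thesis
    proof (cases "U = {}")
      case True
      have "face U = {0}" using subspace_0[OF subspace_L] by (auto simp: supported_in_def True vec_eq_iff)
      moreover have "slice U \<theta> s = {}" if "s \<noteq> 0" for s
      proof -
        have "y = 0" if "y \<in> slice U \<theta> s" for y using that by (auto simp: slice_def True vec_eq_iff)
        then show ?thesis using that linear_0[OF linear_d] by (fastforce simp: slice_def)
      qed
      ultimately show ?thesis by (auto simp: stepbound_def)
    next
      case False
      with x have "x \<noteq> 0" by auto
      from generator[OF x(1,2) this] obtain e where e0: "e \<in> L" "\<And>c. 0 \<le> e $ c \<and> e $ c \<in> \<int>"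
          "d e = \<delta> (dim (face U) - 1)"
        and eU: "{c. e $ c \<noteq> 0} \<subseteq> U" unfolding x(3) using x(3) by blast
      have "0 < d e" using e0(3) \<delta>_pos by simp
      then have "e \<noteq> 0" using linear_0[OF linear_d] by auto
      note e = e0 \<open>0 < d e\<close>[unfolded e0(3)] eU
      let ?I = "cofaces U e \<times> fracs e \<theta>"
      have finI: "finite ?I" using finite_fracs e(2) by (simp add: cofaces_def)
      have dimless: "dim (face V) < dim (face U)" if "V \<in> cofaces U e" for V
        using that e by (intro dim_face_less[of V U e]) (auto simp: cofaces_def supported_in_def)
      have "dim (face U) \<noteq> 0"
      proof -
        have "e \<in> face U" using e by (auto simp: supported_in_def)
        with \<open>e \<noteq> 0\<close> show ?thesis by (auto simp: dim_eq_0)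
      qed
      then obtain k where k: "dim (face U) = Suc k" by (cases "dim (face U)") auto
      show ?thesis
        unfolding k
      proof (rule stepbound_SucI[where I = ?I and a = snd
            and g = "\<lambda>(U', l) s. real (card (slice U' (\<theta> - l *\<^sub>R e) s))"])
        show "finite ?I" by (rule finI)
        show "0 < \<delta> k" by (rule \<delta>_pos)
        fix p assume "p \<in> ?I"
        then obtain V l where p: "p = (V, l)" "V \<in> cofaces U e" "l \<in> fracs e \<theta>" by auto
        then have "card V < card U" by (auto simp: cofaces_def intro: psubset_card_mono)
        then have "stepbound \<delta> (dim (face V)) (\<lambda>s. real (card (slice V (\<theta> - l *\<^sub>R e) s)))"
          by (rule less)
        \<comment> \<open>The dimension may drop by more than one; \<open>stepbound_mono\<close>
          then multiplies the missing factors in.\<close>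
        moreover have "dim (face V) \<le> k" using dimless[OF p(2)] k by simp
        ultimately show "stepbound \<delta> k ((\<lambda>(U', l) s. real (card (slice U' (\<theta> - l *\<^sub>R e) s))) p)"
          using \<delta>_pos by (simp add: p stepbound_mono)
        show "0 < snd p \<and> snd p \<le> 1" using p by (auto simp: fracs_def)
      next
        fix s
        show "real (card (slice U \<theta> s)) - real (card (slice U \<theta> (s - \<delta> k))) =
          (\<Sum>i\<in>?I. (\<lambda>(U', l) s. real (card (slice U' (\<theta> - l *\<^sub>R e) s))) i (s - \<delta> k * snd i))"
          using card_slice_split[OF e \<open>e \<noteq> 0\<close>, of \<theta> s] k by (simp add: case_prod_unfold)
      qed
    qed
  qed
qed

end

section \<open>Supports of semi-magic cubes\<close>

lemma exhaust_3_zero: "k = 0 \<or> k = 1 \<or> k = (2 :: 3)"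
  using exhaust_3[of k] by auto

lemma forall_3_zero: "(\<forall>k :: 3. P k) \<longleftrightarrow> P 0 \<and> P 1 \<and> P 2"
  using exhaust_3_zero by metis

lemma ex_3_zero: "(\<exists>k :: 3. P k) \<longleftrightarrow> P 0 \<or> P 1 \<or> P 2"
  using exhaust_3_zero by metis

lemma UNIV_3_zero: "(UNIV :: 3 set) = {0, 1, 2}"
  using exhaust_3_zero by blast

lemma sum_UNIV_3: "(\<Sum>k\<in>UNIV. f k) = f 0 + f 1 + f (2 :: 3)"
  for f :: "3 \<Rightarrow> 'a::comm_monoid_add"
  unfolding UNIV_3_zero by (simp add: add.assoc)

lemma UNIV_3_distinct: "distinct [k, l, m] \<Longrightarrow> (UNIV :: 3 set) = {k, l, m}"
  by (rule card_seteq[symmetric]) simp_all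

lemma exhaust_3_distinct: "distinct [k, l, m :: 3] \<Longrightarrow> j = k \<or> j = l \<or> j = m"
  using UNIV_3_distinct[of k l m] by blast

lemma obtain_third_3:
  assumes "k \<noteq> (l :: 3)"
  obtains m where "distinct [k, l, m]"
proof -
  have "\<exists>m. distinct [k, l, m]"
  proof (rule ccontr)
    assume "\<nexists>m. distinct [k, l, m]"
    then have "UNIV \<subseteq> {k, l}" using assms by auto
    then have "card (UNIV :: 3 set) \<le> card {k, l}" by (intro card_mono) auto
    then show False using assms by simp
  qed
  then show ?thesis using that by blast
qed

lemma obtain_others_3:
  obtains l m where "distinct [k :: 3, l, m]"
proof -
  obtain l where "k \<noteq> l" by (metis zero_neq_one)
  then show ?thesis using that obtain_third_3[of k l] by metis
qed

lemma sum_3_distinct: "distinct [k, l, m] \<Longrightarrow> sum f (UNIV :: 3 set) = f k + f l + f m"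
  for f :: "3 \<Rightarrow> 'a::comm_monoid_add"
  by (subst UNIV_3_distinct[of k l m]) (auto simp: add.assoc)

text \<open>The cell in layer \<open>k\<close> whose row \<open>r\<close> and column \<open>c\<close> satisfy \<open>r - c = u\<close> and \<open>r + c = v\<close>
  modulo 3. In these coordinates the lines within a layer are the (anti)diagonals, and
  a layer has constant line sums iff it is of the form \<open>a u + b v\<close>.\<close>
definition skew :: "3 \<Rightarrow> 3 \<Rightarrow> 3 \<Rightarrow> 3 \<Rightarrow> 3"
  where "skew k u v = (\<lambda>d. if d = 0 then - (u + v) else if d = 1 then u - v else k)"

lemma numeral_3_reduce: "(3 :: 3) = 0" "(4 :: 3) = 1"
  by simp_all

lemma skew_coords: "skew (i 2) (i 0 - i 1) (i 0 + i 1) = i"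
proof
  fix d :: 3
  have "\<forall>a b :: 3. - (a - b + (a + b)) = a \<and> a - b - (a + b) = b"
    unfolding forall_3_zero by (simp add: numeral_3_reduce)
  then show "skew (i 2) (i 0 - i 1) (i 0 + i 1) d = i d"
    using exhaust_3_zero[of d] by (auto simp: skew_def)
qed

lemma ex_skew: "\<exists>k u v. i = skew k u v"
  using skew_coords[of i] by metis

lemma skew_inj: "skew k u v = skew k' u' v' \<longleftrightarrow> k = k' \<and> u = u' \<and> v = v'"
proof
  assume e: "skew k u v = skew k' u' v'"
  have "k = k'" "- (u + v) = - (u' + v')" "u - v = u' - v'"
    using fun_cong[OF e, of 2] fun_cong[OF e, of 0] fun_cong[OF e, of 1] by (simp_all add: skew_def)
  moreover have "\<forall>a b :: 3. - (a + b) - (a - b) = a \<and> - (a + b) + (a - b) = b"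
    unfolding forall_3_zero by (simp add: numeral_3_reduce)
  ultimately show "k = k' \<and> u = u' \<and> v = v'" by metis
qed simp

definition line_sums_skew :: "((3 \<Rightarrow> 3) \<Rightarrow> 'a::comm_monoid_add) \<Rightarrow> 'a \<Rightarrow> bool"
  where "line_sums_skew x s \<longleftrightarrow>
    (\<forall>u v. (\<Sum>k\<in>UNIV. x (skew k u v)) = s) \<and>
    (\<forall>k w. (\<Sum>t\<in>UNIV. x (skew k t (t + w))) = s) \<and>
    (\<forall>k w. (\<Sum>t\<in>UNIV. x (skew k t (w - t))) = s)"

text \<open>Changing the row of a cell keeps \<open>u - v\<close>, changing its column keeps
  \<open>u + v\<close>; these are the two families of diagonals in the \<open>u\<close>,
  \<open>v\<close> plane.\<close>

lemma line_sums_eq_iff_skew: "line_sums_eq x s \<longleftrightarrow> line_sums_skew x s"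
proof -
  have upd2: "(skew k u v)(2 := j) = skew j u v" for k u v j
    by (auto simp: skew_def fun_eq_iff) (metis exhaust_3_zero)
  have upd0: "(skew k u v)(0 := - (t + (t + (v - u)))) = skew k t (t + (v - u))" for k u v t
    by (auto simp: skew_def fun_eq_iff)
  have upd1: "(skew k u v)(1 := t - (u + v - t)) = skew k t (u + v - t)" for k u v t
    by (auto simp: skew_def fun_eq_iff)
  have eq0: "\<forall>t w :: 3. - (t + (t + w)) = t - w" and eq1: "\<forall>t w :: 3. t - (w - t) = - (t + w)"
    unfolding forall_3_zero by (simp_all add: numeral_3_reduce)
  have bij0: "bij (\<lambda>t :: 3. - (t + (t + w)))" and bij1: "bij (\<lambda>t :: 3. t - (w - t))" for w
    unfolding eq0[rule_format] eq1[rule_format] bij_def by (simp_all add: finite_UNIV_inj_surj inj_def)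
  have s2: "(\<Sum>j\<in>UNIV. x ((skew k u v)(2 := j))) = (\<Sum>k\<in>UNIV. x (skew k u v))" for k u v
    by (simp add: upd2)
  have s0: "(\<Sum>j\<in>UNIV. x ((skew k u v)(0 := j))) = (\<Sum>t\<in>UNIV. x (skew k t (t + (v - u))))" for k u v
    using sum.reindex_bij_betw[OF bij0[of "v - u"], of "\<lambda>j. x ((skew k u v)(0 := j))"]
    by (simp only: upd0)
  have s1: "(\<Sum>j\<in>UNIV. x ((skew k u v)(1 := j))) = (\<Sum>t\<in>UNIV. x (skew k t (u + v - t)))" for k u v
    using sum.reindex_bij_betw[OF bij1[of "u + v"], of "\<lambda>j. x ((skew k u v)(1 := j))"]
    by (simp only: upd1)
  have "line_sums_eq x s \<longleftrightarrow> (\<forall>d k u v. (\<Sum>j\<in>UNIV. x ((skew k u v)(d := j))) = s)"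
    unfolding line_sums_eq_def using ex_skew by metis
  also have "\<dots> \<longleftrightarrow> line_sums_skew x s"
  proof -
    have "(\<forall>k u v. f k (v - u) = s) \<longleftrightarrow> (\<forall>k w. f k w = s)"
      "(\<forall>k u v. f k (u + v) = s) \<longleftrightarrow> (\<forall>k w. f k w = s)" for f :: "3 \<Rightarrow> 3 \<Rightarrow> 'a"
      by (metis diff_zero) (metis add_0)
    note this[of "\<lambda>k w. \<Sum>t\<in>UNIV. x (skew k t (t + w))"] this[of "\<lambda>k w. \<Sum>t\<in>UNIV. x (skew k t (w - t))"]
    then show ?thesis
      unfolding forall_3_zero[of "\<lambda>d. \<forall>k u v. (\<Sum>j\<in>UNIV. x ((skew k u v)(d := j))) = s"] s0 s1 s2
        line_sums_skew_def by (simp add: conj_ac)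
  qed
  finally show ?thesis .
qed

lemma line_sums_skew_expand:
  "line_sums_skew x s \<longleftrightarrow>
    (\<forall>u v. x (skew 0 u v) + x (skew 1 u v) + x (skew 2 u v) = s) \<and>
    (\<forall>k. x (skew k 0 0) + x (skew k 1 1) + x (skew k 2 2) = s \<and>
      x (skew k 0 1) + x (skew k 1 2) + x (skew k 2 0) = s \<and>
      x (skew k 0 2) + x (skew k 1 0) + x (skew k 2 1) = s \<and>
      x (skew k 0 0) + x (skew k 1 2) + x (skew k 2 1) = s \<and>
      x (skew k 0 1) + x (skew k 1 0) + x (skew k 2 2) = s \<and>
      x (skew k 0 2) + x (skew k 1 1) + x (skew k 2 0) = s)"
proof -
  have m: "(2 :: 3) + 1 = 0" "(2 :: 3) + 2 = 1" "(1 :: 3) + 2 = 0" "(0 :: 3) - 1 = 2" "(0 :: 3) - 2 = 1" "(1 :: 3) - 2 = 2"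
    "- (1 :: 3) = 2" "- (2 :: 3) = 1" "(1 :: 3) + 1 = 2" "(2 :: 3) - 1 = 1"
    by simp_all
  show ?thesis
    unfolding line_sums_skew_def sum_UNIV_3
    unfolding forall_3_zero[where P = "\<lambda>w. f w = s" for f] by (simp add: numeral_3_reduce m) blast
qed

text \<open>A function on the affine plane over the field of three elements splits into a constant
  and four parts of mean zero, each constant along one of the four parallel classes. Constant sums
  along the diagonals and antidiagonals annihilate two of them; what remains is a function of
  \<open>u\<close> plus a function of \<open>v\<close>.\<close>

lemma skew_additive:
  fixes x :: "(3 \<Rightarrow> 3) \<Rightarrow> 'a::linordered_idom"
  assumes "line_sums_skew x s"
  shows "x (skew k u v) + x (skew k u' v') = x (skew k u v') + x (skew k u' v)"
proof -
  have "x (skew k 0 0) + x (skew k 1 1) + x (skew k 2 2) = s"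
    "x (skew k 0 1) + x (skew k 1 2) + x (skew k 2 0) = s"
    "x (skew k 0 2) + x (skew k 1 0) + x (skew k 2 1) = s"
    "x (skew k 0 0) + x (skew k 1 2) + x (skew k 2 1) = s"
    "x (skew k 0 1) + x (skew k 1 0) + x (skew k 2 2) = s"
    "x (skew k 0 2) + x (skew k 1 1) + x (skew k 2 0) = s"
    using assms unfolding line_sums_skew_expand by blast+
  then have "x (skew k 1 1) = x (skew k 1 0) + x (skew k 0 1) - x (skew k 0 0)"
    "x (skew k 1 2) = x (skew k 1 0) + x (skew k 0 2) - x (skew k 0 0)"
    "x (skew k 2 1) = x (skew k 2 0) + x (skew k 0 1) - x (skew k 0 0)"
    "x (skew k 2 2) = x (skew k 2 0) + x (skew k 0 2) - x (skew k 0 0)"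
    by linarith+
  then have "x (skew k a b) = x (skew k a 0) + x (skew k 0 b) - x (skew k 0 0)" for a b
    using exhaust_3_zero[of a] exhaust_3_zero[of b] by (elim disjE; simp)
  from this[of u v] this[of u' v'] this[of u v'] this[of u' v] show ?thesis by simp
qed

text \<open>Normal form of a cube with nonnegative entries: \<open>h k\<close> is the minimum of layer \<open>k\<close>.\<close>
definition cube_nf ::
  "'a::linordered_idom \<Rightarrow> (3 \<Rightarrow> 'a) \<Rightarrow> (3 \<Rightarrow> 3 \<Rightarrow> 'a) \<Rightarrow> (3 \<Rightarrow> 3 \<Rightarrow> 'a) \<Rightarrow> 'a \<Rightarrow> 'a \<Rightarrow> bool"
  where "cube_nf s h a b A B \<longleftrightarrow>
    (\<forall>k. 0 \<le> h k) \<and> (\<forall>k u. 0 \<le> a k u) \<and> (\<forall>k v. 0 \<le> b k v) \<and>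
    (\<forall>k. \<exists>u. a k u = 0) \<and> (\<forall>k. \<exists>v. b k v = 0) \<and>
    (\<forall>u. (\<Sum>k\<in>UNIV. a k u) = A) \<and> (\<forall>v. (\<Sum>k\<in>UNIV. b k v) = B) \<and>
    (\<forall>k. 3 * h k + (\<Sum>u\<in>UNIV. a k u) + (\<Sum>v\<in>UNIV. b k v) = s) \<and>
    (\<Sum>k\<in>UNIV. h k) + A + B = s"

lemma cube_nf_swap: "cube_nf s h a b A B \<Longrightarrow> cube_nf s h b a B A"
  unfolding cube_nf_def by (simp add: algebra_simps)

text \<open>By additivity each layer is recovered from its values along the two coordinate lines
  through a minimal cell. Subtracting the minimum there leaves nonnegative \<open>a\<close> and
  \<open>b\<close> that vanish at that cell.\<close>

lemma cube_nf_exists: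
  fixes x :: "(3 \<Rightarrow> 3) \<Rightarrow> 'a::linordered_idom"
  assumes x: "line_sums_eq x s" "\<And>i. 0 \<le> x i"
  shows "\<exists>h a b A B. cube_nf s h a b A B \<and> (\<forall>k u v. x (skew k u v) = h k + a k u + b k v)"
proof -
  have sk: "line_sums_skew x s" using x(1) by (simp add: line_sums_eq_iff_skew)
  have "\<exists>p. \<forall>u v. x (skew k (fst p) (snd p)) \<le> x (skew k u v)" for k
  proof -
    let ?f = "\<lambda>p. x (skew k (fst p) (snd p))"
    have "Min (range ?f) \<in> range ?f" by (intro Min_in) auto
    then obtain p where p: "Min (range ?f) = ?f p" by blast
    have "?f p \<le> x (skew k u v)" for u v
      unfolding p[symmetric] by (rule Min_le) (auto intro: image_eqI[of _ _ "(u, v)"])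
    then show ?thesis by blast
  qed
  then obtain p where p: "\<And>k u v. x (skew k (fst (p k)) (snd (p k))) \<le> x (skew k u v)" by metis
  define u0 where "u0 k = fst (p k)" for k
  define v0 where "v0 k = snd (p k)" for k
  define h where "h k = x (skew k (u0 k) (v0 k))" for k
  define a where "a k u = x (skew k u (v0 k)) - h k" for k u
  define b where "b k v = x (skew k (u0 k) v) - h k" for k v
  have hmin: "h k \<le> x (skew k u v)" for k u v using p by (simp add: h_def u0_def v0_def)
  have eq: "x (skew k u v) = h k + a k u + b k v" for k u v
    using skew_additive[OF sk, of k u v "u0 k" "v0 k"] by (simp add: a_def b_def h_def)
  have layer: "h 0 + a 0 u + b 0 v + (h 1 + a 1 u + b 1 v) + (h 2 + a 2 u + b 2 v) = s" for u v
    using sk unfolding line_sums_skew_expand eq by blast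
  define A where "A = (\<Sum>k\<in>UNIV. a k 0)"
  define B where "B = (\<Sum>k\<in>UNIV. b k 0)"
  have "(\<Sum>k\<in>UNIV. a k u) = A" for u
    using layer[of u 0] layer[of 0 0] by (simp add: A_def sum_UNIV_3)
  moreover have "(\<Sum>k\<in>UNIV. b k v) = B" for v
    using layer[of 0 v] layer[of 0 0] by (simp add: B_def sum_UNIV_3)
  moreover have "(\<Sum>k\<in>UNIV. h k) + A + B = s"
    using layer[of 0 0] by (simp add: A_def B_def sum_UNIV_3)
  moreover have "3 * h k + (\<Sum>u\<in>UNIV. a k u) + (\<Sum>v\<in>UNIV. b k v) = s" for k
  proof -
    have "x (skew k 0 0) + x (skew k 1 1) + x (skew k 2 2) = s"
      using sk unfolding line_sums_skew_expand by blast
    then show ?thesis by (simp add: eq sum_UNIV_3)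
  qed
  moreover have "0 \<le> h k" "0 \<le> a k u" "0 \<le> b k u" for k u
    using x(2) hmin by (simp_all add: h_def a_def b_def)
  moreover have "\<exists>u. a k u = 0" "\<exists>v. b k v = 0" for k
    by (auto simp: a_def b_def h_def)
  ultimately show ?thesis using eq unfolding cube_nf_def by blast
qed

text \<open>Choosing the line \<open>u = f k\<close> in layer \<open>k\<close> gives a permutation
  matrix in every layer, and injectivity of \<open>f\<close> makes them disjoint: a Latin
  square.\<close>

definition has_transversal :: "(3 \<Rightarrow> 3 \<Rightarrow> bool) \<Rightarrow> bool"
  where "has_transversal P \<longleftrightarrow> (\<exists>f. inj f \<and> (\<forall>k. P k (f k)))"

text \<open>The combinatorial type of the non-integral vertices.\<close>
definition has_half :: "(3 \<Rightarrow> 3 \<Rightarrow> bool) \<Rightarrow> (3 \<Rightarrow> 3 \<Rightarrow> bool) \<Rightarrow> bool"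
  where "has_half P Q \<longleftrightarrow> (\<exists>k l m u v. distinct [k, l, m] \<and>
    (\<forall>u'. u' \<noteq> u \<longrightarrow> P k u') \<and> P l u \<and> Q l v \<and> (\<forall>v'. v' \<noteq> v \<longrightarrow> Q m v'))"

text \<open>Supports without a transversal: the cubes with the zeros described here form a space of
  dimension 2.\<close>
definition flat :: "(3 \<Rightarrow> 'a::zero) \<Rightarrow> (3 \<Rightarrow> 3 \<Rightarrow> 'a) \<Rightarrow> (3 \<Rightarrow> 3 \<Rightarrow> 'a) \<Rightarrow> bool"
  where "flat h a b \<longleftrightarrow> (\<exists>k l l' u0 u1 v. distinct [k, l, l'] \<and> u0 \<noteq> u1 \<and>
    h k = 0 \<and> h l = 0 \<and> h l' = 0 \<and> (\<forall>u. a k u = 0) \<and> b k v = 0 \<and> a l u0 = 0 \<and> a l' u1 = 0 \<and>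
    (\<forall>v'. v' \<noteq> v \<longrightarrow> b l v' = 0 \<and> b l' v' = 0))"

text \<open>The three cases are the violations of Hall's condition by one, two and three
  rows.\<close>

lemma no_transversal:
  assumes "\<not> has_transversal P"
  shows "(\<exists>k. \<forall>u. \<not> P k u) \<or> (\<exists>k l u. k \<noteq> l \<and> (\<forall>u'. u' \<noteq> u \<longrightarrow> \<not> P k u' \<and> \<not> P l u')) \<or>
    (\<exists>u. \<forall>k. \<not> P k u)"
proof -
  have "\<not> (P 0 u \<and> P 1 v \<and> P 2 w)" if "distinct [u, v, w]" for u v w
  proof
    assume P: "P 0 u \<and> P 1 v \<and> P 2 w"
    define f where "f k = (if k = 0 then u else if k = (1 :: 3) then v else w)" for k
    have "inj f" using that unfolding inj_def forall_3_zero by (auto simp: f_def)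
    moreover have "\<forall>k. P k (f k)" using P unfolding forall_3_zero by (simp add: f_def)
    ultimately show False using assms by (auto simp: has_transversal_def)
  qed
  note this[of 0 1 2] this[of 0 2 1] this[of 1 0 2] this[of 1 2 0] this[of 2 0 1] this[of 2 1 0]
  then show ?thesis
    unfolding forall_3_zero ex_3_zero by simp sat
qed

section \<open>Hall violations in the normal form of a cube\<close>

context
  fixes s :: "'a::linordered_idom" and h a b A B
  assumes nf: "cube_nf s h a b A B" and s_pos: "0 < s"
begin

lemma nf_nonneg: "0 \<le> h k" "0 \<le> a k u" "0 \<le> b k u"
  using nf by (auto simp: cube_nf_def)

lemma nf_col: "distinct [k, l, m] \<Longrightarrow> a k u + a l u + a m u = A"
  "distinct [k, l, m] \<Longrightarrow> b k u + b l u + b m u = B"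
  using nf sum_3_distinct[of k l m "\<lambda>k. a k u"] sum_3_distinct[of k l m "\<lambda>k. b k u"]
  by (auto simp: cube_nf_def)

lemma nf_row: "distinct [u, v, w] \<Longrightarrow> distinct [u', v', w'] \<Longrightarrow>
    3 * h k + (a k u + a k v + a k w) + (b k u' + b k v' + b k w') = s"
  using nf sum_3_distinct[of u v w "a k"] sum_3_distinct[of u' v' w' "b k"]
  unfolding cube_nf_def by metis

lemma nf_total: "distinct [k, l, m] \<Longrightarrow> h k + h l + h m + A + B = s"
  using nf sum_3_distinct[of k l m h] by (auto simp: cube_nf_def)

lemma nf_le: "a k u \<le> A" "b k u \<le> B"
proof -
  obtain l where "k \<noteq> l" using exhaust_3_zero by (metis zero_neq_one)
  then obtain m where d: "distinct [k, l, m]" by (rule obtain_third_3)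
  show "a k u \<le> A" "b k u \<le> B"
    using nf_col[OF d, of u] nf_nonneg(2,3)[of l u] nf_nonneg(2,3)[of m u] by linarith+
qed

lemma nf_zero: "\<exists>u. a k u = 0" "\<exists>u. b k u = 0"
  using nf by (auto simp: cube_nf_def)

abbreviation (input) "a_pos k u \<equiv> 0 < h k \<or> 0 < a k u"
abbreviation (input) "b_pos k u \<equiv> 0 < h k \<or> 0 < b k u"

lemma notP: "\<not> a_pos k u \<longleftrightarrow> h k = 0 \<and> a k u = 0" and notQ: "\<not> b_pos k u \<longleftrightarrow> h k = 0 \<and> b k u = 0"
  using nf_nonneg(1)[of k] nf_nonneg(2,3)[of k u] by auto

text \<open>With \<open>A = 0\<close> all \<open>a k u\<close> vanish, and
  \<open>h k + b k v\<close> is a nonnegative matrix whose row and column sums are all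
  \<open>s\<close>. It has a positive transversal as in Birkhoff's theorem.\<close>

lemma transversal_if_A_zero:
  assumes "A = 0"
  shows "has_transversal b_pos"
proof (rule ccontr)
  have a0: "a k u = 0" for k u using nf_le(1)[of k u] nf_nonneg(2)[of k u] assms by simp
  have d: "distinct [0, 1, 2 :: 3]" by simp
  assume "\<not> has_transversal b_pos"
  from no_transversal[OF this] show False
  proof (elim disjE exE conjE)
    fix k assume "\<forall>u. \<not> b_pos k u"
    then have "h k = 0" "b k u = 0" for u using notQ by auto
    then show False using nf_row[OF d d, of k] s_pos by (simp add: a0)
  next
    fix k l u assume kl: "k \<noteq> l" and q: "\<forall>u'. u' \<noteq> u \<longrightarrow> \<not> b_pos k u' \<and> \<not> b_pos l u'"
    obtain u1 u2 where u: "distinct [u, u1, u2]" by (rule obtain_others_3)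
    obtain m where m: "distinct [k, l, m]" using kl by (rule obtain_third_3)
    have z: "h k = 0" "h l = 0" "b k u1 = 0" "b l u1 = 0" "b k u2 = 0" "b l u2 = 0"
    proof -
      have q1: "\<not> b_pos k u1" "\<not> b_pos l u1" "\<not> b_pos k u2" "\<not> b_pos l u2" using q u by auto
      show "h k = 0" "h l = 0" "b k u1 = 0" "b l u1 = 0" "b k u2 = 0" "b l u2 = 0"
        using q1[unfolded notQ] by blast+
    qed
    have "3 * 0 + (0 + 0 + 0) + (b k u + 0 + 0) = s"
      using nf_row[OF u u, of k] unfolding z a0 .
    moreover have "3 * 0 + (0 + 0 + 0) + (b l u + 0 + 0) = s"
      using nf_row[OF u u, of l] unfolding z a0 .
    moreover have "0 + 0 + h m + 0 + B = s" using nf_total[OF m] unfolding z assms .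
    ultimately show False
      using nf_col(2)[OF m, of u] nf_nonneg(3)[of m u] nf_nonneg(1)[of m] s_pos by linarith
  next
    fix u assume "\<forall>k. \<not> b_pos k u"
    then have "h k = 0" "b k u = 0" for k using notQ by auto
    then show False using nf_total[OF d] nf_col(2)[OF d, of u] s_pos assms by simp
  qed
qed

text \<open>Layer \<open>l\<close> writes \<open>s\<close> as a sum of two entries that are at most
  \<open>A\<close>, layer \<open>k\<close> as a sum of two that are at most \<open>B\<close>. Since
  \<open>A + B \<le> s\<close>, all these inequalities are tight and \<open>h\<close>
  vanishes.\<close>

lemma flat_if_rows_empty:
  assumes pos: "0 < A" "0 < B" and k: "\<forall>u. \<not> a_pos k u" and l: "\<forall>u. \<not> b_pos l u"
  shows "flat h a b"
proof -
  have zk: "h k = 0" "a k u = 0" for u using k notP by auto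
  have zl: "h l = 0" "b l u = 0" for u using l notQ by auto
  have d: "distinct [0, 1, 2 :: 3]" by simp
  have "k \<noteq> l" using nf_row[OF d d, of k] zk zl s_pos by auto
  then obtain m where m: "distinct [k, l, m]" by (rule obtain_third_3)
  obtain u where u: "a l u = 0" using nf_zero by blast
  obtain v where v: "b k v = 0" using nf_zero by blast
  obtain u1 u2 where us: "distinct [u, u1, u2]" by (rule obtain_others_3)
  obtain v1 v2 where vs: "distinct [v, v1, v2]" by (rule obtain_others_3)
  have tot: "h m + A + B = s" using nf_total[OF m] zk zl by simp
  have "a l u1 + a l u2 = s" using nf_row[OF us us, of l] u zl by simp
  moreover have "b k v1 + b k v2 = s" using nf_row[OF vs vs, of k] v zk by simp
  ultimately have eqs: "h m = 0" "a l u1 = A" "b k v1 = B" "b k v2 = B"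
    using nf_le(1)[of l u1] nf_le(1)[of l u2] nf_le(2)[of k v1] nf_le(2)[of k v2] tot
      nf_nonneg(1)[of m] by linarith+
  have "b m v1 = 0" "b m v2 = 0" "a m u1 = 0"
    using nf_col(2)[OF m, of v1] nf_col(2)[OF m, of v2] nf_col(1)[OF m, of u1] zk zl eqs by simp_all
  then have "\<forall>v'. v' \<noteq> v \<longrightarrow> b m v' = 0 \<and> b l v' = 0"
    using exhaust_3_distinct[OF vs] zl by metis
  moreover have "distinct [k, m, l]" "u1 \<noteq> u" using m us by auto
  ultimately show ?thesis
    unfolding flat_def using zk zl eqs u v \<open>a m u1 = 0\<close> by blast
qed

text \<open>The layer \<open>k\<close> differs from \<open>l\<close> and \<open>l'\<close>, since
  otherwise \<open>s = b k v \<le> B < A + B \<le> s\<close>. Off column \<open>v\<close> it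
  therefore carries all of \<open>B\<close>, while \<open>l\<close> and \<open>l'\<close> share
  \<open>A\<close> in every column.\<close>

lemma flat_if_row_empty_column:
  assumes pos: "0 < A" "0 < B" and k: "\<forall>u. \<not> a_pos k u"
    and l: "l \<noteq> l'" "\<forall>v'. v' \<noteq> v \<longrightarrow> \<not> b_pos l v' \<and> \<not> b_pos l' v'"
  shows "flat h a b"
proof -
  have zk: "h k = 0" "a k u = 0" for u using k notP by auto
  have zl: "h l = 0" "h l' = 0" "v' \<noteq> v \<Longrightarrow> b l v' = 0" "v' \<noteq> v \<Longrightarrow> b l' v' = 0" for v'
  proof -
    obtain v1 where "v1 \<noteq> v" by (metis zero_neq_one)
    then show "h l = 0" "h l' = 0" using l(2) notQ by auto
    show "v' \<noteq> v \<Longrightarrow> b l v' = 0" "v' \<noteq> v \<Longrightarrow> b l' v' = 0" using l(2) notQ by auto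
  qed
  obtain v1 v2 where v: "distinct [v, v1, v2]" by (rule obtain_others_3)
  have s_ge: "A + B \<le> s"
    using nf_total[of 0 1 2] nf_nonneg(1)[of 0] nf_nonneg(1)[of 1] nf_nonneg(1)[of 2] by simp
  have "k \<noteq> l" "k \<noteq> l'"
    using nf_row[OF v v, of k] nf_le(2)[of k v] zk zl v s_ge pos by auto
  then have m: "distinct [k, l, l']" using l(1) by auto
  have s: "s = A + B" using nf_total[OF m] zk zl by simp
  have bk: "v' \<noteq> v \<Longrightarrow> b k v' = B" for v' using nf_col(2)[OF m, of v'] zl by simp
  have bkv: "b k v = 0" using nf_zero(2)[of k] bk pos by (metis less_irrefl)
  have col: "a l u + a l' u = A" for u using nf_col(1)[OF m, of u] zk by simp
  obtain u0 where u0: "a l u0 = 0" using nf_zero by blast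
  obtain u1 where u1: "a l' u1 = 0" using nf_zero by blast
  have "u0 \<noteq> u1" using col[of u0] u0 u1 pos by auto
  then show ?thesis unfolding flat_def using m zk zl u0 u1 bkv by blast
qed

text \<open>A flat normal form is determined by \<open>A = B\<close> and by the way in which column
  \<open>u2\<close> divides \<open>A\<close> between \<open>l\<close> and \<open>l'\<close>. If
  \<open>l\<close> receives a positive share, \<open>l\<close> is the layer with two positive
  entries in \<open>has_half\<close>; otherwise \<open>l'\<close> is.\<close>

lemma half_if_flat:
  assumes pos: "0 < A" "0 < B" and flat: "flat h a b"
  shows "has_half a_pos b_pos"
proof -
  obtain k l l' u0 u1 v where m: "distinct [k, l, l']" and "u0 \<noteq> u1"
    and zk: "h k = 0" "\<And>u. a k u = 0" and bkv: "b k v = 0" and u0: "a l u0 = 0" and u1: "a l' u1 = 0"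
    and zl: "h l = 0" "h l' = 0" "\<And>v'. v' \<noteq> v \<Longrightarrow> b l v' = 0" "\<And>v'. v' \<noteq> v \<Longrightarrow> b l' v' = 0"
    using flat unfolding flat_def by blast
  obtain v1 v2 where v: "distinct [v, v1, v2]" by (rule obtain_others_3)
  have s: "s = A + B" using nf_total[OF m] zk zl by simp
  have bk: "v' \<noteq> v \<Longrightarrow> b k v' = B" for v' using nf_col(2)[OF m, of v'] zl by simp
  have AB: "A = B" using nf_row[OF v v, of k] zk bkv bk[of v1] bk[of v2] v s by auto
  have col: "a l u + a l' u = A" for u using nf_col(1)[OF m, of u] zk by simp
  obtain u2 where u: "distinct [u0, u1, u2]" using \<open>u0 \<noteq> u1\<close> by (rule obtain_third_3)
  have vals: "a l' u0 = A" "a l u1 = A" using col[of u0] col[of u1] u0 u1 by simp_all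
  have bl: "b l v = A - a l u2" "b l' v = a l u2"
    using nf_row[OF u v, of l] nf_row[OF u v, of l'] zl v vals u0 u1 s AB col[of u2] by auto
  have ex: "u' = u0 \<or> u' = u1 \<or> u' = u2" for u' using exhaust_3_distinct[OF u] .
  have Qk: "\<forall>v'. v' \<noteq> v \<longrightarrow> b_pos k v'" using bk pos by simp
  show ?thesis
  proof (cases "a l u2 = 0")
    case True
    then have "a l' u2 = A" using col[of u2] by simp
    then have "\<forall>u'. u' \<noteq> u1 \<longrightarrow> a_pos l' u'" using ex vals pos by metis
    moreover have "a_pos l u1" using vals pos by simp
    moreover have "b_pos l v" using bl True pos by simp
    moreover have "distinct [l', l, k]" using m by auto
    ultimately show ?thesis unfolding has_half_def using Qk by blast
  next
    case False
    then have c: "0 < a l u2" using nf_nonneg(2)[of l u2] by simp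
    then have "\<forall>u'. u' \<noteq> u0 \<longrightarrow> a_pos l u'" using ex vals pos by metis
    moreover have "a_pos l' u0" using vals pos by simp
    moreover have "b_pos l' v" using bl c by simp
    moreover have "distinct [l, l', k]" using m by auto
    ultimately show ?thesis unfolding has_half_def using Qk by blast
  qed
qed

text \<open>Let \<open>m\<close> and \<open>m'\<close> be the layers outside the two pairs. If they
  coincided, the other two layers would give \<open>2 * s = A + B \<le> s\<close>. Hence they
  differ, and the remaining layer \<open>j\<close> has \<open>a j u = A\<close> and
  \<open>b j v = B\<close>, which empties \<open>a\<close> in layer \<open>m'\<close> and
  \<open>b\<close> in layer \<open>m\<close>.\<close>

lemma flat_if_columns:
  assumes pos: "0 < A" "0 < B"
    and k: "k \<noteq> l" "\<forall>u'. u' \<noteq> u \<longrightarrow> \<not> a_pos k u' \<and> \<not> a_pos l u'"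
    and k': "k' \<noteq> l'" "\<forall>v'. v' \<noteq> v \<longrightarrow> \<not> b_pos k' v' \<and> \<not> b_pos l' v'"
  shows "flat h a b"
proof -
  obtain u1 u2 where u: "distinct [u, u1, u2]" by (rule obtain_others_3)
  obtain v1 v2 where v: "distinct [v, v1, v2]" by (rule obtain_others_3)
  have "u1 \<noteq> u" "v1 \<noteq> v" using u v by auto
  then have z: "h k = 0" "h l = 0" "h k' = 0" "h l' = 0" using k(2) k'(2) notP notQ by blast+
  have za: "a k w = 0" "a l w = 0" if "w \<noteq> u" for w using k(2) notP that by auto
  have zb: "b k' w = 0" "b l' w = 0" if "w \<noteq> v" for w using k'(2) notQ that by auto
  obtain m where m: "distinct [k, l, m]" using k(1) by (rule obtain_third_3)
  obtain m' where m': "distinct [k', l', m']" using k'(1) by (rule obtain_third_3)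
  have am: "a m w = A" if "w \<noteq> u" for w using nf_col(1)[OF m, of w] za[OF that] by simp
  have am0: "a m u = 0" using nf_zero(1)[of m] am pos by (metis less_irrefl)
  have bm: "b m' w = B" if "w \<noteq> v" for w using nf_col(2)[OF m', of w] zb[OF that] by simp
  have bm0: "b m' v = 0" using nf_zero(2)[of m'] bm pos by (metis less_irrefl)
  have "m \<noteq> m'"
  proof
    assume mm: "m = m'"
    have zb': "b k w = 0" "b l w = 0" if "w \<noteq> v" for w
      using exhaust_3_distinct[OF m', of k] exhaust_3_distinct[OF m', of l] m mm zb[OF that] by auto
    have "a k u + b k v = s" "a l u + b l v = s"
      using nf_row[OF u v, of k] nf_row[OF u v, of l] z za zb' u v by auto
    moreover have "a k u + a l u = A" using nf_col(1)[OF m, of u] am0 by simp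
    moreover have "b k v + b l v = B" using nf_col(2)[OF m, of v] bm0 mm by simp
    ultimately show False
      using nf_total[OF m] z nf_nonneg(1)[of m] s_pos by linarith
  qed
  then obtain j where j: "distinct [m, m', j]" by (rule obtain_third_3)
  have jk: "j = k \<or> j = l" "m' = k \<or> m' = l" using exhaust_3_distinct[OF m] j by auto
  have jk': "j = k' \<or> j = l'" "m = k' \<or> m = l'" using exhaust_3_distinct[OF m'] j by auto
  have s: "s = A + B" using nf_total[OF j] z jk jk' by auto
  have "a j u + b j v = s"
    using nf_row[OF u v, of j] z za zb u v jk(1) jk'(1) by auto
  then have aj: "a j u = A" "b j v = B" using nf_le(1)[of j u] nf_le(2)[of j v] s by linarith+
  have zm': "a m' w = 0" for w
  proof (cases "w = u")
    case True
    then show ?thesis using nf_col(1)[OF j, of u] am0 aj(1) by simp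
  next
    case False
    then show ?thesis using za jk(2) by auto
  qed
  have zm: "b m w = 0" for w
  proof (cases "w = v")
    case True
    then show ?thesis using nf_col(2)[OF j, of v] bm0 aj(2) by simp
  next
    case False
    then show ?thesis using zb jk'(2) by auto
  qed
  have "distinct [m', j, m]" "u1 \<noteq> u" using j u by auto
  moreover have "h m' = 0" "h j = 0" "h m = 0" using z jk jk' by auto
  moreover have "a j u1 = 0" using za[of u1] \<open>u1 \<noteq> u\<close> jk(1) by auto
  moreover have "\<forall>w. w \<noteq> v \<longrightarrow> b j w = 0 \<and> b m w = 0" using zb zm jk'(1) by auto
  ultimately show ?thesis unfolding flat_def using zm' bm0 am0 by blast
qed

lemma no_transversal_cases:
  assumes "\<not> has_transversal a_pos" "0 < A"
  shows "(\<exists>k. \<forall>u. \<not> a_pos k u) \<or> (\<exists>k l u. k \<noteq> l \<and> (\<forall>u'. u' \<noteq> u \<longrightarrow> \<not> a_pos k u' \<and> \<not> a_pos l u'))"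
proof -
  have False if "\<forall>k. \<not> a_pos k u" for u
  proof -
    have "a k u = 0" for k using that notP by auto
    then show False using nf_col(1)[of 0 1 2 u] assms(2) by simp
  qed
  with no_transversal[OF assms(1)] show ?thesis by blast
qed

end

text \<open>For positive \<open>A\<close> and \<open>B\<close> no column can be empty, so Hall's
  condition fails through one row or two rows, for \<open>a\<close> as well as for \<open>b\<close>.
  Exchanging \<open>a\<close> and \<open>b\<close> reduces the four combinations to the three lemmas
  on flatness.\<close>

lemma support_contains_vertex:
  assumes nf: "cube_nf s h a b A B" and s: "0 < (s :: 'a::linordered_idom)"
  shows "has_transversal (\<lambda>k u. 0 < h k \<or> 0 < a k u) \<or> has_transversal (\<lambda>k u. 0 < h k \<or> 0 < b k u) \<or>
    flat h a b \<and> has_half (\<lambda>k u. 0 < h k \<or> 0 < a k u) (\<lambda>k u. 0 < h k \<or> 0 < b k u) \<or>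
    flat h b a \<and> has_half (\<lambda>k u. 0 < h k \<or> 0 < b k u) (\<lambda>k u. 0 < h k \<or> 0 < a k u)"
proof (cases "has_transversal (\<lambda>k u. 0 < h k \<or> 0 < a k u) \<or> has_transversal (\<lambda>k u. 0 < h k \<or> 0 < b k u)")
  case False
  note nf' = cube_nf_swap[OF nf]
  note nP = False[unfolded de_Morgan_disj, THEN conjunct1] and nQ = False[unfolded de_Morgan_disj, THEN conjunct2]
  have "A \<noteq> 0" using transversal_if_A_zero[OF nf s] nQ by blast
  then have A: "0 < A" using nf_le(1)[OF nf s, of 0 0] nf_nonneg(2)[OF nf s, of 0 0] by simp
  have "B \<noteq> 0" using transversal_if_A_zero[OF nf' s] nP by blast
  then have B: "0 < B" using nf_le(2)[OF nf s, of 0 0] nf_nonneg(3)[OF nf s, of 0 0] by simp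
  have "flat h a b \<or> flat h b a"
    using no_transversal_cases[OF nf s nP A]
  proof (elim disjE exE conjE)
    fix k assume k: "\<forall>u. \<not> (0 < h k \<or> 0 < a k u)"
    from no_transversal_cases[OF nf' s nQ B] show ?thesis
    proof (elim disjE exE conjE)
      fix l assume "\<forall>u. \<not> (0 < h l \<or> 0 < b l u)"
      from flat_if_rows_empty[OF nf s A B k this] show ?thesis ..
    next
      fix l l' v assume "l \<noteq> l'" "\<forall>v'. v' \<noteq> v \<longrightarrow> \<not> (0 < h l \<or> 0 < b l v') \<and> \<not> (0 < h l' \<or> 0 < b l' v')"
      from flat_if_row_empty_column[OF nf s A B k this] show ?thesis ..
    qed
  next
    fix k l u
    assume kl: "k \<noteq> l" "\<forall>u'. u' \<noteq> u \<longrightarrow> \<not> (0 < h k \<or> 0 < a k u') \<and> \<not> (0 < h l \<or> 0 < a l u')"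
    from no_transversal_cases[OF nf' s nQ B] show ?thesis
    proof (elim disjE exE conjE)
      fix m assume "\<forall>u. \<not> (0 < h m \<or> 0 < b m u)"
      from flat_if_row_empty_column[OF nf' s B A this kl] show ?thesis ..
    next
      fix k' l' v assume "k' \<noteq> l'" "\<forall>v'. v' \<noteq> v \<longrightarrow> \<not> (0 < h k' \<or> 0 < b k' v') \<and> \<not> (0 < h l' \<or> 0 < b l' v')"
      from flat_if_columns[OF nf s A B kl this] show ?thesis ..
    qed
  qed
  then show ?thesis
    using half_if_flat[OF nf s A B] half_if_flat[OF nf' s B A] by blast
qed blast

section \<open>The recurrence\<close>

definition cube_of :: "(3 \<Rightarrow> 3 \<Rightarrow> 'a) \<Rightarrow> (3 \<Rightarrow> 3 \<Rightarrow> 'a) \<Rightarrow> (3 \<Rightarrow> 3) \<Rightarrow> 'a::comm_monoid_add"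
  where "cube_of a b i = a (i 2) (i 0 - i 1) + b (i 2) (i 0 + i 1)"

lemma cube_of_skew [simp]: "cube_of a b (skew k u v) = a k u + b k v"
proof -
  have "\<forall>u v :: 3. - (u + v) - (u - v) = u \<and> - (u + v) + (u - v) = v"
    unfolding forall_3_zero by (simp add: numeral_3_reduce)
  moreover have "skew k u v 0 = - (u + v)" "skew k u v 1 = u - v" "skew k u v 2 = k"
    by (simp_all add: skew_def)
  ultimately show ?thesis by (simp only: cube_of_def)
qed

lemma line_sums_cube_of:
  assumes "\<And>u v. (\<Sum>k\<in>UNIV. a k u + b k v) = s"
    and "\<And>k. (\<Sum>u\<in>UNIV. a k u) + (\<Sum>v\<in>UNIV. b k v) = s"
  shows "line_sums_eq (cube_of a b) s"
proof -
  have "a k 0 + a k 1 + a k 2 + (b k 0 + b k 1 + b k 2) = s" for k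
    using assms(2)[of k] by (simp add: sum_UNIV_3)
  moreover have "a 0 u + b 0 v + (a 1 u + b 1 v) + (a 2 u + b 2 v) = s" for u v
    using assms(1)[of u v] by (simp add: sum_UNIV_3)
  ultimately show ?thesis
    unfolding line_sums_eq_iff_skew line_sums_skew_expand cube_of_skew by (simp add: add_ac)
qed

definition transversal_weights :: "real \<Rightarrow> (3 \<Rightarrow> 3) \<Rightarrow> 3 \<Rightarrow> 3 \<Rightarrow> real"
  where "transversal_weights r f k u = (if u = f k then r else 0)"

text \<open>All column sums are 1, and the row sums are 2, 1, 0 for \<open>k\<close>,
  \<open>l\<close> and the third index. Pairing it with the copy that has \<open>k\<close> and the
  third index exchanged makes the row sums add up to 2 in every layer.\<close>

definition half_weights :: "3 \<Rightarrow> 3 \<Rightarrow> 3 \<Rightarrow> 3 \<Rightarrow> 3 \<Rightarrow> real"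
  where "half_weights k l u k' u' = (if k' = k \<and> u' \<noteq> u \<or> k' = l \<and> u' = u then 1 else 0)"

lemma sum_half_weights:
  assumes "distinct [k, l, m]"
  shows "(\<Sum>k'\<in>UNIV. half_weights k l u k' u') = 1"
    "(\<Sum>u'\<in>UNIV. half_weights k l u k' u') = (if k' = k then 2 else if k' = l then 1 else 0)"
proof -
  show "(\<Sum>k'\<in>UNIV. half_weights k l u k' u') = 1"
    unfolding sum_3_distinct[OF assms] using assms by (auto simp: half_weights_def)
  obtain u1 u2 where u: "distinct [u, u1, u2]" by (rule obtain_others_3)
  show "(\<Sum>u'\<in>UNIV. half_weights k l u k' u') = (if k' = k then 2 else if k' = l then 1 else 0)"
    unfolding sum_3_distinct[OF u] using assms u by (auto simp: half_weights_def)
qed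

lemma line_sums_transversal:
  assumes "inj f"
  shows "line_sums_eq (cube_of (transversal_weights r f) (\<lambda>_ _. 0)) r"
    "line_sums_eq (cube_of (\<lambda>_ _. 0) (transversal_weights r f)) r"
proof -
  have "bij f" using assms by (simp add: bij_def finite_UNIV_inj_surj)
  have "(\<Sum>k\<in>UNIV. transversal_weights r f k u) = r" for u
  proof -
    obtain k0 where "u = f k0" using \<open>bij f\<close> by (metis bij_pointE)
    then have "transversal_weights r f k u = (if k = k0 then r else 0)" for k
      using assms by (auto simp: transversal_weights_def inj_eq)
    then show ?thesis by simp
  qed
  moreover have "(\<Sum>u\<in>UNIV. transversal_weights r f k u) = r" for k
    by (simp add: transversal_weights_def)
  ultimately show "line_sums_eq (cube_of (transversal_weights r f) (\<lambda>_ _. 0)) r"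
    "line_sums_eq (cube_of (\<lambda>_ _. 0) (transversal_weights r f)) r"
    by (intro line_sums_cube_of; simp)+
qed

lemma line_sums_half:
  assumes "distinct [k, l, m]"
  shows "line_sums_eq (cube_of (half_weights k l u) (half_weights m l v)) 2"
proof (rule line_sums_cube_of)
  have d: "distinct [m, l, k]" using assms by auto
  show "(\<Sum>k'\<in>UNIV. half_weights k l u k' u' + half_weights m l v k' v') = 2" for u' v'
    by (simp add: sum.distrib sum_half_weights[OF assms] sum_half_weights[OF d])
  show "(\<Sum>u'\<in>UNIV. half_weights k l u k' u') + (\<Sum>v'\<in>UNIV. half_weights m l v k' v') = 2" for k'
    using exhaust_3_distinct[OF assms, of k'] assms
    by (auto simp: sum_half_weights[OF assms] sum_half_weights[OF d])
qed

section \<open>The cone of semi-magic cubes\<close>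

definition semi_magic_space :: "(real ^ (3 \<Rightarrow> 3)) set"
  where "semi_magic_space = {x. \<exists>s. line_sums_eq (($) x) s}"

text \<open>One fixed line stands for all, so that the grade is a linear function on the whole space
  of arrays.\<close>

definition line_sum0 :: "real ^ (3 \<Rightarrow> 3) \<Rightarrow> real"
  where "line_sum0 x = (\<Sum>j\<in>UNIV. x $ ((\<lambda>_. 0)(0 := j)))"

lemma line_sum0: "line_sums_eq (($) x) s \<Longrightarrow> line_sum0 x = s"
  by (simp add: line_sums_eq_def line_sum0_def)

lemma entry_le_line_sum:
  fixes x :: "('d::finite \<Rightarrow> 'n::finite) \<Rightarrow> 'a::linordered_idom"
  assumes "line_sums_eq x s" "\<And>i. 0 \<le> x i"
  shows "x i \<le> s"
proof -
  have "x (i(undefined := i undefined)) \<le> (\<Sum>j\<in>UNIV. x (i(undefined := j)))"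
    using assms(2) by (intro member_le_sum) auto
  then show ?thesis using assms(1) by (simp add: line_sums_eq_def)
qed

lemma subspace_semi_magic: "subspace semi_magic_space"
proof (rule subspaceI)
  show "0 \<in> semi_magic_space" by (auto simp: semi_magic_space_def line_sums_eq_def)
next
  fix x y :: "real ^ (3 \<Rightarrow> 3)" assume "x \<in> semi_magic_space" "y \<in> semi_magic_space"
  then obtain s t where "line_sums_eq (($) x) s" "line_sums_eq (($) y) t"
    by (auto simp: semi_magic_space_def)
  then have "line_sums_eq (($) (x + y)) (s + t)" by (simp add: line_sums_eq_def sum.distrib)
  then show "x + y \<in> semi_magic_space" by (auto simp: semi_magic_space_def)
next
  fix c and x :: "real ^ (3 \<Rightarrow> 3)" assume "x \<in> semi_magic_space"
  then obtain s where "line_sums_eq (($) x) s" by (auto simp: semi_magic_space_def)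
  then have "line_sums_eq (($) (c *\<^sub>R x)) (c * s)"
    by (simp add: line_sums_eq_def flip: sum_distrib_left)
  then show "c *\<^sub>R x \<in> semi_magic_space" by (auto simp: semi_magic_space_def)
qed

text \<open>The projection to the coordinates in \<open>S\<close> is injective on
  \<open>V\<close>.\<close>

lemma dim_le_card_coords:
  fixes V :: "(real ^ 'c::finite) set"
  assumes "subspace V" "finite S" and zero: "\<And>x. x \<in> V \<Longrightarrow> (\<And>i. i \<in> S \<Longrightarrow> x $ i = 0) \<Longrightarrow> x = 0"
  shows "dim V \<le> card S"
proof -
  define g :: "real ^ 'c \<Rightarrow> real ^ 'c" where "g x = (\<chi> i. if i \<in> S then x $ i else 0)" for x
  have lin: "linear g" by (rule linearI) (auto simp: g_def vec_eq_iff)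
  have "inj_on g (span V)"
  proof (rule inj_onI)
    fix x y assume xy: "x \<in> span V" "y \<in> span V" and e: "g x = g y"
    have "x - y \<in> V" using xy assms(1) by (metis span_eq_iff subspace_diff)
    moreover have "(x - y) $ i = 0" if "i \<in> S" for i
      using arg_cong[OF e, of "\<lambda>y. y $ i"] that by (simp add: g_def)
    ultimately show "x = y" using zero[of "x - y"] by simp
  qed
  then have "dim (g ` V) = dim V" by (rule dim_image_eq[OF lin])
  moreover have "dim (g ` V) \<le> card ((\<lambda>i. axis i (1 :: real)) ` S)"
  proof (rule dim_le_card)
    show "g ` V \<subseteq> span ((\<lambda>i. axis i (1 :: real)) ` S)"
    proof
      fix y assume "y \<in> g ` V"
      then have "y = (\<Sum>i\<in>S. y $ i *\<^sub>R axis i (1 :: real))"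
        using assms(2) by (auto simp: g_def vec_eq_iff axis_def if_distrib cong: if_cong)
      moreover have "(\<Sum>i\<in>S. y $ i *\<^sub>R axis i (1 :: real)) \<in> span ((\<lambda>i. axis i (1 :: real)) ` S)"
        by (intro span_sum span_scale span_base) auto
      ultimately show "y \<in> span ((\<lambda>i. axis i (1 :: real)) ` S)" by simp
    qed
  qed (simp add: assms(2))
  moreover have "card ((\<lambda>i. axis i (1 :: real)) ` S) \<le> card S" by (rule card_image_le) (rule assms(2))
  ultimately show ?thesis by linarith
qed

text \<open>A version of the normal form without sign conditions, so that it applies to the linear
  space and not only to the cone.\<close>

lemma additive_form:
  fixes x :: "(3 \<Rightarrow> 3) \<Rightarrow> 'a::linordered_idom"
  assumes "line_sums_eq x s"
  shows "\<exists>a b. (\<forall>k u v. x (skew k u v) = a k u + b k v) \<and>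
    (\<forall>u v. (\<Sum>k\<in>UNIV. a k u + b k v) = s) \<and> (\<forall>k. (\<Sum>u\<in>UNIV. a k u) + (\<Sum>v\<in>UNIV. b k v) = s)"
proof -
  have s: "line_sums_skew x s" using assms by (simp add: line_sums_eq_iff_skew)
  define a where "a k u = x (skew k u 0)" for k u
  define b where "b k v = x (skew k 0 v) - x (skew k 0 0)" for k v
  have eq: "x (skew k u v) = a k u + b k v" for k u v
    using skew_additive[OF s, of k u v 0 0] by (simp add: a_def b_def)
  have "a 0 u + b 0 v + (a 1 u + b 1 v) + (a 2 u + b 2 v) = s" for u v
    using s unfolding line_sums_skew_expand eq by blast
  moreover have "a k 0 + b k 0 + (a k 1 + b k 1) + (a k 2 + b k 2) = s" for k
    using s unfolding line_sums_skew_expand eq by blast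
  ultimately have "(\<forall>u v. (\<Sum>k\<in>UNIV. a k u + b k v) = s) \<and>
      (\<forall>k. (\<Sum>u\<in>UNIV. a k u) + (\<Sum>v\<in>UNIV. b k v) = s)"
    by (simp add: sum_UNIV_3 algebra_simps)
  with eq show ?thesis by blast
qed

text \<open>The cells of the last assumption carry the two parameters of the flat family:
  \<open>a k u0 + b k v1\<close> is the common value of \<open>A\<close> and \<open>B\<close>, and
  \<open>a l u2 + b l v1\<close> is the share of \<open>l\<close> in column \<open>u2\<close>. Once
  both vanish, the line sums force all other cells to vanish.\<close>

lemma flat_zero:
  fixes a b :: "3 \<Rightarrow> 3 \<Rightarrow> 'a::linordered_idom"
  assumes col: "\<And>u v. (\<Sum>k\<in>UNIV. a k u + b k v) = s"
    and row: "\<And>k. (\<Sum>u\<in>UNIV. a k u) + (\<Sum>v\<in>UNIV. b k v) = s"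
    and k: "distinct [k, l, l']" and u: "distinct [u0, u1, u2]" and v: "distinct [v, v1, v2]"
    and z: "\<And>u. a k u + b k v = 0"
      "a l u0 + b l v1 = 0" "a l u0 + b l v2 = 0" "a l' u1 + b l' v1 = 0" "a l' u1 + b l' v2 = 0"
    and S: "a k u0 + b k v1 = 0" "a l u2 + b l v1 = 0"
  shows "a k' u' + b k' v' = 0"
proof -
  have col': "a k u' + b k v' + (a l u' + b l v') + (a l' u' + b l' v') = s" for u' v'
    using col[of u' v'] sum_3_distinct[OF k, of "\<lambda>k. a k u' + b k v'"] by simp
  have row': "a k u0 + a k u1 + a k u2 + (b k v + b k v1 + b k v2) = s" for k
    using row[of k] sum_3_distinct[OF u, of "a k"] sum_3_distinct[OF v, of "b k"] by simp
  have k1: "a k u1 = a k u0" "a k u2 = a k u0" "b k v = - a k u0" "b k v1 = - a k u0"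
    using z(1)[of u0] z(1)[of u1] z(1)[of u2] S(1) by linarith+
  have bl: "b l v1 = - a l u0" "b l v2 = - a l u0" "b l' v1 = - a l' u1" "b l' v2 = - a l' u1"
    using z(2-5) by linarith+
  have k2: "b k v2 = - a k u0" using col'[of u0 v1] col'[of u0 v2] k1 bl by linarith
  have s0: "s = 0" using row'[of k] k1 k2 by linarith
  have l2: "a l u2 = a l u0" using S(2) bl by linarith
  have l1: "a l u1 = a l u0" using col'[of u1 v1] k1 bl s0 by linarith
  have l: "b l v = - a l u0" using row'[of l] l1 l2 bl s0 by linarith
  have l': "a l' u0 = a l' u1" "a l' u2 = a l' u1" "b l' v = - a l' u1"
    using col'[of u0 v1] col'[of u2 v1] col'[of u0 v] k1 bl l2 l s0 by linarith+
  have "u' = u0 \<or> u' = u1 \<or> u' = u2" "v' = v \<or> v' = v1 \<or> v' = v2" "k' = k \<or> k' = l \<or> k' = l'"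
    using exhaust_3_distinct[OF u] exhaust_3_distinct[OF v] exhaust_3_distinct[OF k] by blast+
  then show ?thesis
    using k1 k2 bl l1 l2 l l' by (elim disjE) simp_all
qed

text \<open>\<open>sk\<close> is \<open>skew\<close> or \<open>skew\<close> with its last two
  arguments exchanged, which covers both orders of \<open>a\<close> and \<open>b\<close> in
  \<open>flat\<close>.\<close>

lemma dim_flat_support_aux:
  fixes x :: "real ^ (3 \<Rightarrow> 3)" and sk :: "3 \<Rightarrow> 3 \<Rightarrow> 3 \<Rightarrow> 3 \<Rightarrow> 3"
  assumes x: "\<And>k u v. x $ sk k u v = h k + a k u + b k v" and flat: "flat h a b"
    and form: "\<And>z. z \<in> semi_magic_space \<Longrightarrow> \<exists>a b s. (\<forall>k u v. z $ sk k u v = a k u + b k v) \<and>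
      (\<forall>u v. (\<Sum>k\<in>UNIV. a k u + b k v) = s) \<and> (\<forall>k. (\<Sum>u\<in>UNIV. a k u) + (\<Sum>v\<in>UNIV. b k v) = s)"
    and ex: "\<And>i. \<exists>k u v. i = sk k u v"
  shows "dim (supported_in semi_magic_space {i. x $ i \<noteq> 0}) \<le> 2"
proof -
  let ?V = "supported_in semi_magic_space {i. x $ i \<noteq> 0}"
  have sub: "subspace ?V"
    using subspace_semi_magic unfolding supported_in_def subspace_def by auto (metis add.right_neutral)
  have supp: "z $ i = 0" if "z \<in> ?V" "x $ i = 0" for z i using that by (auto simp: supported_in_def)
  obtain k l l' u0 u1 v where k: "distinct [k, l, l']" and "u0 \<noteq> u1" and
    f: "h k = 0" "h l = 0" "h l' = 0" "\<And>u. a k u = 0" "b k v = 0" "a l u0 = 0" "a l' u1 = 0"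
    "\<And>v'. v' \<noteq> v \<Longrightarrow> b l v' = 0 \<and> b l' v' = 0" using flat unfolding flat_def by blast
  obtain u2 where u: "distinct [u0, u1, u2]" using \<open>u0 \<noteq> u1\<close> by (rule obtain_third_3)
  obtain v1 v2 where v: "distinct [v, v1, v2]" by (rule obtain_others_3)
  have xz: "x $ sk k u v = 0" "x $ sk l u0 v1 = 0" "x $ sk l u0 v2 = 0"
    "x $ sk l' u1 v1 = 0" "x $ sk l' u1 v2 = 0" for u using f v by (auto simp: x)
  have "dim ?V \<le> card {sk k u0 v1, sk l u2 v1}"
  proof (rule dim_le_card_coords[OF sub])
    fix z assume z: "z \<in> ?V" and zS: "\<And>i. i \<in> {sk k u0 v1, sk l u2 v1} \<Longrightarrow> z $ i = 0"
    have "z \<in> semi_magic_space" using z by (simp add: supported_in_def)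
    from form[OF this] obtain a' b' s where e: "\<And>k u v. z $ sk k u v = a' k u + b' k v"
      and c: "\<And>u v. (\<Sum>k\<in>UNIV. a' k u + b' k v) = s" "\<And>k. (\<Sum>u\<in>UNIV. a' k u) + (\<Sum>v\<in>UNIV. b' k v) = s"
      by blast
    have "a' k' u' + b' k' v' = 0" for k' u' v'
    proof (rule flat_zero[OF c k u v])
      show "a' k u + b' k v = 0" for u using supp[OF z xz(1)[of u]] by (simp add: e)
      show "a' l u0 + b' l v1 = 0" using supp[OF z xz(2)] by (simp add: e)
      show "a' l u0 + b' l v2 = 0" using supp[OF z xz(3)] by (simp add: e)
      show "a' l' u1 + b' l' v1 = 0" using supp[OF z xz(4)] by (simp add: e)
      show "a' l' u1 + b' l' v2 = 0" using supp[OF z xz(5)] by (simp add: e)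
      show "a' k u0 + b' k v1 = 0" "a' l u2 + b' l v1 = 0"
        using zS[of "sk k u0 v1"] zS[of "sk l u2 v1"] by (simp_all add: e)
    qed
    then have "z $ i = 0" for i using ex[of i] e by auto
    then show "z = 0" by (simp add: vec_eq_iff)
  qed simp
  also have "\<dots> \<le> 2" by (simp add: card_insert_if)
  finally show ?thesis .
qed

lemma dim_flat_support:
  fixes x :: "real ^ (3 \<Rightarrow> 3)"
  assumes x: "\<And>k u v. x $ skew k u v = h k + a k u + b k v" and flat: "flat h a b \<or> flat h b a"
  shows "dim (supported_in semi_magic_space {i. x $ i \<noteq> 0}) \<le> 2"
proof -
  have form: "\<exists>a b s. (\<forall>k u v. z $ skew k u v = a k u + b k v) \<and>
    (\<forall>u v. (\<Sum>k\<in>UNIV. a k u + b k v) = s) \<and> (\<forall>k. (\<Sum>u\<in>UNIV. a k u) + (\<Sum>v\<in>UNIV. b k v) = s)"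
    if z: "z \<in> semi_magic_space" for z
  proof -
    from z obtain s where "line_sums_eq (($) z) s" by (auto simp: semi_magic_space_def)
    from additive_form[OF this] show ?thesis by blast
  qed
  from flat show ?thesis
  proof
    assume "flat h a b"
    from dim_flat_support_aux[of x skew, OF x this form ex_skew] show ?thesis by simp
  next
    assume f: "flat h b a"
    show ?thesis
    proof (rule dim_flat_support_aux[of x "\<lambda>k u v. skew k v u", OF _ f])
      show "x $ skew k v u = h k + b k u + a k v" for k u v by (simp add: x)
      fix z assume "z \<in> semi_magic_space"
      from form[OF this] obtain a b s where "\<And>k u v. z $ skew k u v = a k u + b k v"
        "\<And>u v. (\<Sum>k\<in>UNIV. a k u + b k v) = s" "\<And>k. (\<Sum>u\<in>UNIV. a k u) + (\<Sum>v\<in>UNIV. b k v) = s" by blast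
      then show "\<exists>a b s. (\<forall>k u v. z $ skew k v u = a k u + b k v) \<and>
          (\<forall>u v. (\<Sum>k\<in>UNIV. a k u + b k v) = s) \<and> (\<forall>k. (\<Sum>u\<in>UNIV. a k u) + (\<Sum>v\<in>UNIV. b k v) = s)"
        by (intro exI[of _ b] exI[of _ a] exI[of _ s]) (simp add: add.commute)
    qed (use ex_skew in blast)
  qed
qed

text \<open>The magic sum of the cube peeled off in a face of dimension \<open>k + 1\<close>. Flat
  supports, which may contain no Latin square, occur only in dimension at most 2.\<close>

definition step_size :: "nat \<Rightarrow> real"
  where "step_size k = (if k < 2 then 2 else 1)"

text \<open>A transversal is taken with weight \<open>r\<close>, that is, the Latin square is
  doubled on faces of dimension at most 2. The cube of magic sum 2 is used only for flat supports,
  where the dimension bound yields \<open>r = 2\<close>.\<close>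

lemma semi_magic_generator:
  fixes x :: "real ^ (3 \<Rightarrow> 3)"
  assumes x: "x \<in> semi_magic_space" "\<And>i. 0 \<le> x $ i" "x \<noteq> 0"
  shows "\<exists>e\<in>semi_magic_space. (\<forall>i. 0 \<le> e $ i \<and> e $ i \<in> \<int>) \<and>
    line_sum0 e = step_size (dim (supported_in semi_magic_space {i. x $ i \<noteq> 0}) - 1) \<and>
    (\<forall>i. e $ i \<noteq> 0 \<longrightarrow> x $ i \<noteq> 0)"
proof -
  obtain s where s: "line_sums_eq (($) x) s" using x(1) by (auto simp: semi_magic_space_def)
  from x(3) obtain i where "x $ i \<noteq> 0" by (auto simp: vec_eq_iff)
  then have "0 < s" using x(2)[of i] entry_le_line_sum[OF s x(2), of i] by simp
  obtain h a b A B where nf: "cube_nf s h a b A B"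
    and eq: "\<And>k u v. x $ skew k u v = h k + a k u + b k v"
    using cube_nf_exists[OF s x(2)] by blast
  note nn = nf_nonneg[OF nf \<open>0 < s\<close>]
  define r where "r = step_size (dim (supported_in semi_magic_space {i. x $ i \<noteq> 0}) - 1)"
  have r: "r \<in> {1, 2}" by (simp add: r_def step_size_def)
  have gen: ?thesis
    if e: "line_sums_eq (cube_of \<alpha> \<beta>) r" "\<And>k u. \<alpha> k u \<in> {0, 1, 2}" "\<And>k u. \<beta> k u \<in> {0, 1, 2}"
      and P: "\<And>k u. \<alpha> k u \<noteq> 0 \<Longrightarrow> 0 < h k \<or> 0 < a k u"
      and Q: "\<And>k v. \<beta> k v \<noteq> 0 \<Longrightarrow> 0 < h k \<or> 0 < b k v" for \<alpha> \<beta> :: "3 \<Rightarrow> 3 \<Rightarrow> real"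
  proof -
    define y :: "real ^ (3 \<Rightarrow> 3)" where "y = (\<chi> i. cube_of \<alpha> \<beta> i)"
    have yl: "line_sums_eq (($) y) r" using e(1) by (simp add: y_def line_sums_eq_def)
    have "0 \<le> y $ i \<and> y $ i \<in> \<int> \<and> (y $ i \<noteq> 0 \<longrightarrow> x $ i \<noteq> 0)" for i
    proof -
      obtain k u v where i: "i = skew k u v" using ex_skew by blast
      have "0 < x $ i" if "\<alpha> k u \<noteq> 0 \<or> \<beta> k v \<noteq> 0"
        using that P[of k u] Q[of k v] nn(1)[of k] nn(2)[of k u] nn(3)[of k v]
        unfolding i eq by linarith
      moreover have "y $ i = \<alpha> k u + \<beta> k v" by (simp add: y_def i)
      ultimately show ?thesis using e(2)[of k u] e(3)[of k v] by auto
    qed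
    moreover have "y \<in> semi_magic_space" using yl by (auto simp: semi_magic_space_def)
    ultimately show ?thesis using line_sum0[OF yl] unfolding r_def by blast
  qed
  have half: ?thesis
    if "flat h a b \<or> flat h b a" "line_sums_eq (cube_of \<alpha> \<beta>) 2" "\<And>k u. \<alpha> k u \<in> {0, 1, 2}" "\<And>k u. \<beta> k u \<in> {0, 1, 2}"
      "\<And>k u. \<alpha> k u \<noteq> 0 \<Longrightarrow> 0 < h k \<or> 0 < a k u" "\<And>k v. \<beta> k v \<noteq> 0 \<Longrightarrow> 0 < h k \<or> 0 < b k v"
    for \<alpha> \<beta> :: "3 \<Rightarrow> 3 \<Rightarrow> real"
  proof (rule gen)
    have "r = 2" using dim_flat_support[OF eq that(1)] by (simp add: r_def step_size_def)
    then show "line_sums_eq (cube_of \<alpha> \<beta>) r" using that(2) by simp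
  qed (use that in auto)
  have tw: "transversal_weights r f k u \<in> {0, 1, 2}" for f k u
    using r by (auto simp: transversal_weights_def)
  from support_contains_vertex[OF nf \<open>0 < s\<close>] show ?thesis
  proof (elim disjE conjE)
    assume "has_transversal (\<lambda>k u. 0 < h k \<or> 0 < a k u)"
    then obtain f where f: "inj f" "\<And>k. 0 < h k \<or> 0 < a k (f k)" by (auto simp: has_transversal_def)
    show ?thesis
      by (rule gen[OF line_sums_transversal(1)[OF f(1)]])
        (use f(2) tw in \<open>auto simp: transversal_weights_def split: if_splits\<close>)
  next
    assume "has_transversal (\<lambda>k u. 0 < h k \<or> 0 < b k u)"
    then obtain f where f: "inj f" "\<And>k. 0 < h k \<or> 0 < b k (f k)" by (auto simp: has_transversal_def)
    show ?thesis
      by (rule gen[OF line_sums_transversal(2)[OF f(1)]])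
        (use f(2) tw in \<open>auto simp: transversal_weights_def split: if_splits\<close>)
  next
    assume flat: "flat h a b" and "has_half (\<lambda>k u. 0 < h k \<or> 0 < a k u) (\<lambda>k u. 0 < h k \<or> 0 < b k u)"
    then obtain k l m u v where f: "distinct [k, l, m]"
      "\<And>u'. u' \<noteq> u \<Longrightarrow> 0 < h k \<or> 0 < a k u'" "0 < h l \<or> 0 < a l u" "0 < h l \<or> 0 < b l v"
      "\<And>v'. v' \<noteq> v \<Longrightarrow> 0 < h m \<or> 0 < b m v'" unfolding has_half_def by blast
    show ?thesis
      by (rule half[OF disjI1[OF flat] line_sums_half[OF f(1), of u v]])
        (use f(2-) in \<open>auto simp: half_weights_def split: if_splits\<close>)
  next
    assume flat: "flat h b a" and "has_half (\<lambda>k u. 0 < h k \<or> 0 < b k u) (\<lambda>k u. 0 < h k \<or> 0 < a k u)"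
    then obtain k l m u v where d: "distinct [k, l, m]" and f:
      "\<And>u'. u' \<noteq> u \<Longrightarrow> 0 < h k \<or> 0 < b k u'" "0 < h l \<or> 0 < b l u" "0 < h l \<or> 0 < a l v"
      "\<And>v'. v' \<noteq> v \<Longrightarrow> 0 < h m \<or> 0 < a m v'" unfolding has_half_def by blast
    have d': "distinct [m, l, k]" using d by auto
    show ?thesis
      by (rule half[OF disjI2[OF flat] line_sums_half[OF d', of v u]])
        (use f in \<open>auto simp: half_weights_def split: if_splits\<close>)
  qed
qed

interpretation semi_magic: graded_cone semi_magic_space line_sum0 step_size
proof (rule graded_cone.intro)
  show "subspace semi_magic_space" by (rule subspace_semi_magic)
  show "linear line_sum0"
    by (rule linearI) (simp_all add: line_sum0_def sum.distrib sum_distrib_left)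
  show "0 < step_size k" for k by (simp add: step_size_def)
  show "x $ c \<le> line_sum0 x" if x: "x \<in> semi_magic_space" "\<And>c. 0 \<le> x $ c" for x c
  proof -
    obtain s where s: "line_sums_eq (($) x) s" using x(1) by (auto simp: semi_magic_space_def)
    show ?thesis using entry_le_line_sum[OF s x(2)] line_sum0[OF s] by simp
  qed
  show "\<exists>e\<in>semi_magic_space. (\<forall>c. 0 \<le> e $ c \<and> e $ c \<in> \<int>) \<and>
      line_sum0 e = step_size (dim (supported_in semi_magic_space {c. x $ c \<noteq> 0}) - 1) \<and>
      (\<forall>c. e $ c \<noteq> 0 \<longrightarrow> x $ c \<noteq> 0)"
    if "x \<in> semi_magic_space" "\<And>c. 0 \<le> x $ c" "x \<noteq> 0" for x
    using that by (rule semi_magic_generator)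
qed

text \<open>Five cells determine the additive layer 0 and with it the magic sum; given the sum, four
  more determine layer 1; layer 2 is the rest.\<close>

lemma dim_semi_magic: "dim semi_magic_space \<le> 9"
proof -
  define S where "S = {skew 0 0 0, skew 0 1 0, skew 0 2 0, skew 0 0 1, skew 0 0 2,
    skew 1 0 0, skew 1 1 0, skew 1 2 0, skew 1 0 1}"
  have zero: "x = 0" if x: "x \<in> semi_magic_space" and xS: "\<And>i. i \<in> S \<Longrightarrow> x $ i = 0" for x
  proof -
    obtain s where "line_sums_eq (($) x) s" using x by (auto simp: semi_magic_space_def)
    then have s: "line_sums_skew (($) x) s" by (simp add: line_sums_eq_iff_skew)
    have z: "x $ skew 0 0 0 = 0" "x $ skew 0 1 0 = 0" "x $ skew 0 2 0 = 0" "x $ skew 0 0 1 = 0"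
      "x $ skew 0 0 2 = 0" "x $ skew 1 0 0 = 0" "x $ skew 1 1 0 = 0" "x $ skew 1 2 0 = 0" "x $ skew 1 0 1 = 0"
      by (rule xS, simp add: S_def)+
    have add: "x $ skew k u v = x $ skew k u 0 + x $ skew k 0 v - x $ skew k 0 0" for k u v
      using skew_additive[OF s, of k u v 0 0] by simp
    have l0: "x $ skew 0 u v = 0" for u v
      using add[of 0 u v] exhaust_3_zero[of u] exhaust_3_zero[of v] by (elim disjE; simp add: z)
    have diag: "x $ skew k 0 0 + x $ skew k 1 1 + x $ skew k 2 2 = s" for k
      using s unfolding line_sums_skew_expand by blast
    have s0: "s = 0" using diag[of 0] by (simp add: l0)
    have "x $ skew 1 0 2 = 0" using diag[of 1] add[of 1 1 1] add[of 1 2 2] z s0 by simp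
    then have l1: "x $ skew 1 u v = 0" for u v
      using add[of 1 u v] exhaust_3_zero[of u] exhaust_3_zero[of v] by (elim disjE; simp add: z)
    have "x $ skew 0 u v + x $ skew 1 u v + x $ skew 2 u v = 0" for u v
      using s s0 unfolding line_sums_skew_expand by blast
    then have l2: "x $ skew 2 u v = 0" for u v by (simp add: l0 l1)
    have "x $ i = 0" for i
    proof -
      obtain k u v where "i = skew k u v" using ex_skew by blast
      then show ?thesis using exhaust_3_zero[of k] l0 l1 l2 by auto
    qed
    then show ?thesis by (simp add: vec_eq_iff)
  qed
  have "dim semi_magic_space \<le> card S"
    by (rule dim_le_card_coords[OF subspace_semi_magic _ zero]) (simp_all add: S_def)
  moreover have "card S \<le> 9" unfolding S_def by (simp add: skew_inj)
  ultimately show ?thesis by linarith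
qed

text \<open>The coefficients are those of (1 - t)^7 (1 - t^2)^2 = (1 - t)^9 (1 + t)^2.\<close>

lemma steps_step_size_9: "steps step_size 9 g s =
  g s - 7 * g (s - 1) + 19 * g (s - 2) - 21 * g (s - 3) - 6 * g (s - 4) + 42 * g (s - 5)
  - 42 * g (s - 6) + 6 * g (s - 7) + 21 * g (s - 8) - 19 * g (s - 9) + 7 * g (s - 10) - g (s - 11)"
proof -
  let ?T = "stepdiff 1" and ?D = "stepdiff 2"
  have T4: "?T (?T (?T (?T g))) s = g s - 4 * g (s - 1) + 6 * g (s - 2) - 4 * g (s - 3) + g (s - 4)" for g s
    by (simp add: stepdiff_def)
  have T3: "?T (?T (?T g)) s = g s - 3 * g (s - 1) + 3 * g (s - 2) - g (s - 3)" for g s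
    by (simp add: stepdiff_def)
  have D2: "?D (?D g) s = g s - 2 * g (s - 2) + g (s - 4)" for g s
    by (simp add: stepdiff_def)
  have "steps step_size 9 g = ?D (?D (?T (?T (?T (?T (?T (?T (?T g))))))))"
    by (simp add: eval_nat_numeral step_size_def)
  then have "steps step_size 9 g s = ?D (?D (?T (?T (?T (?T (?T (?T (?T g)))))))) s" by (rule fun_cong)
  also have "\<dots> = g s - 7 * g (s - 1) + 19 * g (s - 2) - 21 * g (s - 3) - 6 * g (s - 4) + 42 * g (s - 5)
  - 42 * g (s - 6) + 6 * g (s - 7) + 21 * g (s - 8) - 19 * g (s - 9) + 7 * g (s - 10) - g (s - 11)"
    unfolding D2 T4 T3 by (simp add: stepdiff_def)
  finally show ?thesis .
qed

text \<open>Subtracting 1 from every entry turns positive cubes into nonnegative ones. This is what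
  keeps the numerator of the generating function below degree 9.\<close>
lemma card_positive_slice:
  "card (semi_magic.slice UNIV 0 (real n + 3)) = SH TYPE(3) TYPE(3) n"
proof -
  let ?f = "\<lambda>x :: (3 \<Rightarrow> 3) \<Rightarrow> nat. (\<chi> i. real (x i) + 1)"
  have "bij_betw ?f (semi_magic_hypercubes n) (semi_magic.slice UNIV 0 (real n + 3))"
  proof (rule bij_betwI[where g = "\<lambda>x i. nat \<lfloor>x $ i\<rfloor> - 1"])
    show "?f \<in> semi_magic_hypercubes n \<rightarrow> semi_magic.slice UNIV 0 (real n + 3)"
    proof
      fix x :: "(3 \<Rightarrow> 3) \<Rightarrow> nat" assume "x \<in> semi_magic_hypercubes n"
      then have l: "line_sums_eq (($) (?f x)) (real n + 3)"
        by (simp add: semi_magic_hypercubes_def line_sums_eq_def sum.distrib flip: of_nat_sum)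
      moreover have "real (x i) + 1 \<noteq> 0" for i
        by (metis add_is_0 of_nat_1 of_nat_add of_nat_eq_0_iff one_neq_zero)
      moreover have "?f x \<in> semi_magic_space" using l by (auto simp: semi_magic_space_def)
      ultimately show "?f x \<in> semi_magic.slice UNIV 0 (real n + 3)"
        using line_sum0[OF l] by (simp add: semi_magic.slice_def)
    qed
    have pos: "real (nat \<lfloor>x $ i\<rfloor> - Suc 0) = x $ i - 1" if x: "x \<in> semi_magic.slice UNIV 0 (real n + 3)" for x i
    proof -
      have "0 \<le> x $ i" "x $ i \<noteq> 0" "x $ i \<in> \<int>" using x by (auto simp: semi_magic.slice_def)
      then obtain z where "x $ i = of_int z" "0 < z" by (auto elim!: Ints_cases)
      then show ?thesis by (simp add: of_nat_diff)
    qed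
    show "(\<lambda>x i. nat \<lfloor>x $ i\<rfloor> - 1) \<in> semi_magic.slice UNIV 0 (real n + 3) \<rightarrow> semi_magic_hypercubes n"
    proof
      fix x assume x: "x \<in> semi_magic.slice UNIV 0 (real n + 3)"
      then have "x \<in> semi_magic_space" "line_sum0 x = real n + 3"
        by (simp_all add: semi_magic.slice_def)
      then obtain s where s: "line_sums_eq (($) x) s" "line_sum0 x = real n + 3"
        by (auto simp: semi_magic_space_def)
      have "real (\<Sum>j\<in>UNIV. nat \<lfloor>x $ (i(k := j))\<rfloor> - 1) = real n" for i k
        using s(1) line_sum0[OF s(1)] s(2) by (simp add: pos[OF x] line_sums_eq_def sum_subtractf)
      then show "(\<lambda>i. nat \<lfloor>x $ i\<rfloor> - 1) \<in> semi_magic_hypercubes n"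
        unfolding semi_magic_hypercubes_def line_sums_eq_def of_nat_eq_iff by simp
    qed
    show "?f (\<lambda>i. nat \<lfloor>x $ i\<rfloor> - 1) = x" if "x \<in> semi_magic.slice UNIV 0 (real n + 3)" for x
      by (simp add: pos[OF that] vec_eq_iff)
    have "nat \<lfloor>real m + 1\<rfloor> - 1 = m" for m
    proof -
      have "real m + 1 = real (Suc m)" by simp
      then show ?thesis by (simp only: floor_of_nat nat_int diff_Suc_1)
    qed
    then show "(\<lambda>i. nat \<lfloor>?f x $ i\<rfloor> - 1) = x" for x by (simp only: vec_lambda_beta)
  qed
  then show ?thesis unfolding SH_def by (rule bij_betw_same_card[symmetric])
qed

lemma card_positive_slice_small:
  assumes "n < 3"
  shows "card (semi_magic.slice UNIV 0 (real n)) = 0"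
proof -
  have "x \<notin> semi_magic.slice UNIV 0 (real n)" for x
  proof
    assume x: "x \<in> semi_magic.slice UNIV 0 (real n)"
    have "1 \<le> x $ i" for i
    proof -
      have "0 \<le> x $ i" "x $ i \<noteq> 0" "x $ i \<in> \<int>" using x by (auto simp: semi_magic.slice_def)
      then show ?thesis by (auto elim!: Ints_cases)
    qed
    then have "(\<Sum>j\<in>(UNIV :: 3 set). 1) \<le> line_sum0 x" unfolding line_sum0_def by (intro sum_mono)
    then show False using x assms by (simp add: semi_magic.slice_def)
  qed
  then have "semi_magic.slice UNIV 0 (real n) = {}" by blast
  then show ?thesis by simp
qed

lemma SH_recurrence:
  defines "f \<equiv> \<lambda>n j. if j \<le> n then real (SH TYPE(3) TYPE(3) (n - j)) else 0"
  assumes "9 \<le> n"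
  shows "f n 0 - 7 * f n 1 + 19 * f n 2 - 21 * f n 3 - 6 * f n 4 + 42 * f n 5 - 42 * f n 6
    + 6 * f n 7 + 21 * f n 8 - 19 * f n 9 + 7 * f n 10 - f n 11 = 0"
proof -
  define g where "g s = real (card (semi_magic.slice UNIV 0 s))" for s
  have fg: "g (real n + 3 - real j) = f n j" if "j \<le> 11" for j
  proof (cases "j \<le> n")
    case True
    then have eq: "real n + 3 - real j = real (n - j) + 3" by (simp add: of_nat_diff)
    show ?thesis unfolding g_def f_def eq card_positive_slice by (simp add: True)
  next
    case False
    \<comment> \<open>The default value 0 for \<open>j > n\<close> is the true count: positive cubes
      have magic sum at least 3, and here the grade is 1 or 2.\<close>
    then have eq: "real n + 3 - real j = real (n + 3 - j)" and small: "n + 3 - j < 3"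
      using assms(2) that by (auto simp: of_nat_diff)
    show ?thesis unfolding g_def f_def eq card_positive_slice_small[OF small] by (simp add: False)
  qed
  have face: "supported_in semi_magic_space UNIV = semi_magic_space" by (auto simp: supported_in_def)
  have "stepbound step_size (dim semi_magic_space) g"
    using semi_magic.stepbound_slice[of UNIV 0] unfolding face g_def .
  from stepbound_mono[OF this dim_semi_magic] have "stepbound step_size 9 g"
    by (simp add: step_size_def)
  \<comment> \<open>The step sizes add up to 2 + 2 + 7 = 11, and \<open>n + 3\<close> exceeds 11
    exactly from \<open>n = 9\<close> on.\<close>
  moreover have "(\<Sum>i<9. step_size i) < real n + 3"
  proof -
    have "(\<Sum>i<9. step_size i) = 11" by (simp add: eval_nat_numeral step_size_def)
    then show ?thesis using assms(2) by linarith
  qed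
  ultimately have "steps step_size 9 g (real n + 3) = 0" unfolding stepbound_def by blast
  moreover have "g (real n + 3) = f n 0" "g (real n + 3 - 1) = f n 1" "g (real n + 3 - 2) = f n 2"
    "g (real n + 3 - 3) = f n 3" "g (real n + 3 - 4) = f n 4" "g (real n + 3 - 5) = f n 5"
    "g (real n + 3 - 6) = f n 6" "g (real n + 3 - 7) = f n 7" "g (real n + 3 - 8) = f n 8"
    "g (real n + 3 - 9) = f n 9" "g (real n + 3 - 10) = f n 10" "g (real n + 3 - 11) = f n 11"
    using fg[of 0] fg[of 1] fg[of 2] fg[of 3] fg[of 4] fg[of 5] fg[of 6] fg[of 7] fg[of 8]
      fg[of 9] fg[of 10] fg[of 11]
    by (simp_all only: of_nat_numeral of_nat_0 of_nat_1 diff_zero order_refl zero_le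
      numeral_le_iff one_le_numeral semiring_norm simp_thms)
  ultimately show ?thesis by (simp only: steps_step_size_9)
qed

section \<open>The first values\<close>

definition reduced :: "(3 \<Rightarrow> 3 \<Rightarrow> nat) set"
  where "reduced = {a. (\<forall>k. \<exists>u. a k u = 0) \<and> (\<forall>u u'. (\<Sum>k\<in>UNIV. a k u) = (\<Sum>k\<in>UNIV. a k u'))}"

definition reduced_rows :: "(3 \<Rightarrow> nat) \<Rightarrow> (3 \<Rightarrow> 3 \<Rightarrow> nat) set"
  where "reduced_rows p = {a \<in> reduced. \<forall>k. (\<Sum>u\<in>UNIV. a k u) = p k}"

definition reduced_pairs :: "nat \<Rightarrow> ((3 \<Rightarrow> 3 \<Rightarrow> nat) \<times> (3 \<Rightarrow> 3 \<Rightarrow> nat)) set"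
  where "reduced_pairs n = {(a, b). a \<in> reduced \<and> b \<in> reduced \<and>
    (\<forall>k. \<exists>h. 3 * h + (\<Sum>u\<in>UNIV. a k u) + (\<Sum>v\<in>UNIV. b k v) = n)}"

definition layer_min :: "nat \<Rightarrow> (3 \<Rightarrow> 3 \<Rightarrow> nat) \<Rightarrow> (3 \<Rightarrow> 3 \<Rightarrow> nat) \<Rightarrow> 3 \<Rightarrow> nat"
  where "layer_min n a b k = (n - (\<Sum>u\<in>UNIV. a k u) - (\<Sum>v\<in>UNIV. b k v)) div 3"

lemma layer_min:
  assumes "(a, b) \<in> reduced_pairs n"
  shows "3 * layer_min n a b k + (\<Sum>u\<in>UNIV. a k u) + (\<Sum>v\<in>UNIV. b k v) = n"
proof -
  obtain h where "3 * h + (\<Sum>u\<in>UNIV. a k u) + (\<Sum>v\<in>UNIV. b k v) = n"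
    using assms by (auto simp: reduced_pairs_def)
  moreover from this have "n - (\<Sum>u\<in>UNIV. a k u) - (\<Sum>v\<in>UNIV. b k v) = 3 * h" by simp
  ultimately show ?thesis by (simp add: layer_min_def)
qed

text \<open>Surjectivity is the normal form over the integers. It is unique because
  \<open>layer_min\<close> is the minimum of its layer and \<open>a\<close>, \<open>b\<close> are
  then read off along lines where the other one vanishes.\<close>

lemma bij_reduced_pairs:
  "bij_betw (\<lambda>(a, b). cube_of (\<lambda>k u. layer_min n a b k + a k u) b) (reduced_pairs n) (semi_magic_hypercubes n)"
  (is "bij_betw ?f _ _")
proof -
  have "?f (a, b) \<in> semi_magic_hypercubes n" if ab: "(a, b) \<in> reduced_pairs n" for a b
  proof -
    have row: "3 * layer_min n a b k + (a k 0 + a k 1 + a k 2) + (b k 0 + b k 1 + b k 2) = n" for k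
      using layer_min[OF ab, of k] by (simp add: sum_UNIV_3)
    have col: "a 0 u + a 1 u + a 2 u = a 0 0 + a 1 0 + a 2 0" "b 0 u + b 1 u + b 2 u = b 0 0 + b 1 0 + b 2 0" for u
      using ab by (auto simp: reduced_pairs_def reduced_def sum_UNIV_3)
    have "line_sums_eq (cube_of (\<lambda>k u. layer_min n a b k + a k u) b) n"
    proof (rule line_sums_cube_of)
      show "(\<Sum>u\<in>UNIV. layer_min n a b k + a k u) + (\<Sum>v\<in>UNIV. b k v) = n" for k
        using row[of k] by (simp add: sum_UNIV_3)
      \<comment> \<open>The row equations add up to \<open>3 * n\<close>; as the column sums of
        \<open>a\<close> and of \<open>b\<close> are constant, this is three times the sum over
        \<open>k\<close> at any \<open>u\<close>, \<open>v\<close>.\<close>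
      show "(\<Sum>k\<in>UNIV. layer_min n a b k + a k u + b k v) = n" for u v
        unfolding sum_UNIV_3
        using row[of 0] row[of 1] row[of 2] col(1)[of u] col(1)[of 1] col(1)[of 2]
          col(2)[of v] col(2)[of 1] col(2)[of 2]
        by linarith
    qed
    then show ?thesis by (simp add: semi_magic_hypercubes_def)
  qed
  moreover have "inj_on ?f (reduced_pairs n)"
  proof (rule inj_onI, clarify)
    fix a b a' b' assume r: "(a, b) \<in> reduced_pairs n" "(a', b') \<in> reduced_pairs n"
      and e: "cube_of (\<lambda>k u. layer_min n a b k + a k u) b = cube_of (\<lambda>k u. layer_min n a' b' k + a' k u) b'"
    have eq: "layer_min n a b k + a k u + b k v = layer_min n a' b' k + a' k u + b' k v" for k u v
      using fun_cong[OF e, of "skew k u v"] by simp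
    have "a k u = a' k u \<and> b k u = b' k u" for k u
    proof -
      obtain u0 v0 u1 v1 where z: "a k u0 = 0" "b k v0 = 0" "a' k u1 = 0" "b' k v1 = 0"
        using r unfolding reduced_pairs_def reduced_def by blast
      \<comment> \<open>At a common zero of \<open>a k\<close> and \<open>b k\<close> the left side
        of \<open>eq\<close> is the first minimum and the right side is at least the second; the
        zeros of \<open>a'\<close> and \<open>b'\<close> give the converse.\<close>
      have "layer_min n a b k = layer_min n a' b' k"
        using eq[of k u0 v0] eq[of k u1 v1] z by simp
      then have eq': "a k u + b k v = a' k u + b' k v" for u v using eq[of k u v] by simp
      show ?thesis
        using eq'[of u v0] eq'[of u v1] eq'[of u0 v0] eq'[of u1 v1] eq'[of u0 u] eq'[of u1 u] z by simp
    qed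
    then show "a = a' \<and> b = b'" by (auto simp: fun_eq_iff)
  qed
  moreover have "x \<in> ?f ` reduced_pairs n" if x: "x \<in> semi_magic_hypercubes n" for x
  proof -
    have "line_sums_eq (\<lambda>i. int (x i)) (int n)"
      using x by (simp add: semi_magic_hypercubes_def line_sums_eq_def flip: of_nat_sum)
    then have "\<exists>h a b A B. cube_nf (int n) h a b A B \<and>
        (\<forall>k u v. int (x (skew k u v)) = h k + a k u + b k v)"
      by (rule cube_nf_exists) simp
    then obtain h a b A B where nf: "cube_nf (int n) h a b A B"
      and eq: "\<And>k u v. int (x (skew k u v)) = h k + a k u + b k v" by blast
    have nn: "0 \<le> h k" "0 \<le> a k u" "0 \<le> b k u" for k u using nf by (auto simp: cube_nf_def)
    define a' where "a' k u = nat (a k u)" for k u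
    define b' where "b' k u = nat (b k u)" for k u
    have int: "int (a' k u) = a k u" "int (b' k u) = b k u" for k u using nn by (simp_all add: a'_def b'_def)
    have red: "a' \<in> reduced" "b' \<in> reduced"
    proof -
      have "int (\<Sum>k\<in>UNIV. a' k u) = A" "int (\<Sum>k\<in>UNIV. b' k u) = B" for u
        using nf by (simp_all add: int cube_nf_def)
      then have "(\<Sum>k\<in>UNIV. a' k u) = (\<Sum>k\<in>UNIV. a' k u')" "(\<Sum>k\<in>UNIV. b' k u) = (\<Sum>k\<in>UNIV. b' k u')" for u u'
        by (metis of_nat_eq_iff)+
      moreover have "\<exists>u. a' k u = 0" "\<exists>u. b' k u = 0" for k
        using nf by (auto simp: cube_nf_def a'_def b'_def) (metis nat_zero_as_int of_nat_0)+
      ultimately show "a' \<in> reduced" "b' \<in> reduced" unfolding reduced_def by blast+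
    qed
    have row: "3 * nat (h k) + (\<Sum>u\<in>UNIV. a' k u) + (\<Sum>v\<in>UNIV. b' k v) = n" for k
    proof -
      have "int (3 * nat (h k) + (\<Sum>u\<in>UNIV. a' k u) + (\<Sum>v\<in>UNIV. b' k v)) = int n"
        using nf nn(1)[of k] by (simp add: int cube_nf_def)
      then show ?thesis by (simp only: of_nat_eq_iff)
    qed
    then have ab: "(a', b') \<in> reduced_pairs n" using red by (auto simp: reduced_pairs_def)
    have "layer_min n a' b' k = nat (h k)" for k using row[of k] layer_min[OF ab, of k] by simp
    then have "x (skew k u v) = layer_min n a' b' k + a' k u + b' k v" for k u v
      using eq[of k u v] nn by (simp add: a'_def b'_def flip: nat_add_distrib)
    note val = this
    have "x = ?f (a', b')"
    proof
      fix i
      obtain k u v where i: "i = skew k u v" using ex_skew by blast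
      show "x i = ?f (a', b') i" unfolding i prod.case cube_of_skew by (rule val)
    qed
    with ab show ?thesis by blast
  qed
  ultimately show ?thesis unfolding bij_betw_def by auto
qed

lemma finite_reduced_rows: "finite (reduced_rows p)"
proof -
  have "a k u \<le> p k" if a: "a \<in> reduced_rows p" for a k u
  proof -
    have "a k u \<le> (\<Sum>u\<in>UNIV. a k u)" by (intro member_le_sum) auto
    then show ?thesis using a by (simp add: reduced_rows_def)
  qed
  then have "reduced_rows p \<subseteq> PiE UNIV (\<lambda>k. PiE UNIV (\<lambda>u. {..p k}))" by auto
  then show ?thesis by (rule finite_subset) (intro finite_PiE; simp)
qed

text \<open>The pairs are sorted by the row sums \<open>p\<close> of the first matrix and the layer
  minima \<open>h\<close>, which force the row sums of the second matrix.\<close>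

lemma SH_eq_sum:
  "SH TYPE(3) TYPE(3) n =
    (\<Sum>p\<in>{p. \<forall>k. p k \<le> n}. card (reduced_rows p) *
      (\<Sum>h\<in>{h. \<forall>k. h k \<le> (n - p k) div 3}. card (reduced_rows (\<lambda>k. n - p k - 3 * h k))))"
proof -
  have fin: "finite {p :: 3 \<Rightarrow> nat. \<forall>k. p k \<le> m k}" for m
  proof -
    have "{p :: 3 \<Rightarrow> nat. \<forall>k. p k \<le> m k} \<subseteq> PiE UNIV (\<lambda>k. {..m k})" by auto
    then show ?thesis by (rule finite_subset) (intro finite_PiE; simp)
  qed
  let ?I = "SIGMA p:{p :: 3 \<Rightarrow> nat. \<forall>k. p k \<le> n}. {h :: 3 \<Rightarrow> nat. \<forall>k. h k \<le> (n - p k) div 3}"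
  let ?S = "\<lambda>(p, h). reduced_rows p \<times> reduced_rows (\<lambda>k. n - p k - 3 * h k)"
  have "reduced_pairs n = (\<Union>i\<in>?I. ?S i)"
  proof (intro equalityI subsetI)
    fix x assume x: "x \<in> reduced_pairs n"
    obtain a b where ab: "x = (a, b)" by fastforce
    define p where "p k = (\<Sum>u\<in>UNIV. a k u)" for k
    define h where "h k = layer_min n a b k" for k
    have row: "3 * h k + p k + (\<Sum>v\<in>UNIV. b k v) = n" for k
      using layer_min[of a b n k] x by (simp add: ab h_def p_def)
    have le: "p k \<le> n" "h k \<le> (n - p k) div 3" "(\<Sum>v\<in>UNIV. b k v) = n - p k - 3 * h k" for k
      using row[of k] by auto
    have red: "a \<in> reduced" "b \<in> reduced" using x by (auto simp: ab reduced_pairs_def)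
    have "x \<in> ?S (p, h)" using red le(3) by (auto simp: ab reduced_rows_def p_def)
    moreover have "(p, h) \<in> ?I" using le by auto
    ultimately show "x \<in> (\<Union>i\<in>?I. ?S i)" by blast
  next
    fix x assume "x \<in> (\<Union>i\<in>?I. ?S i)"
    then obtain p h a b where i: "\<And>k. p k \<le> n" "\<And>k. h k \<le> (n - p k) div 3" and x: "x = (a, b)"
      and a: "a \<in> reduced_rows p" and b: "b \<in> reduced_rows (\<lambda>k. n - p k - 3 * h k)" by auto
    have "3 * h k + (\<Sum>u\<in>UNIV. a k u) + (\<Sum>v\<in>UNIV. b k v) = n" for k
      using a b i(1)[of k] i(2)[of k] by (auto simp: reduced_rows_def)
    then show "x \<in> reduced_pairs n" using a b by (auto simp: x reduced_pairs_def reduced_rows_def)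
  qed
  then have "SH TYPE(3) TYPE(3) n = card (\<Union>i\<in>?I. ?S i)"
    unfolding SH_def using bij_betw_same_card[OF bij_reduced_pairs[of n]] by simp
  also have "\<dots> = (\<Sum>i\<in>?I. card (?S i))"
  proof (rule card_UN_disjoint)
    show "finite ?I"
      using fin[of "\<lambda>_. n"] fin[of "\<lambda>k. (n - p k) div 3" for p] by (intro finite_SigmaI)
    show "\<forall>i\<in>?I. finite (?S i)" using finite_reduced_rows by auto
    show "\<forall>i\<in>?I. \<forall>j\<in>?I. i \<noteq> j \<longrightarrow> ?S i \<inter> ?S j = {}"
    proof (intro ballI impI, rule ccontr)
      fix i j assume ij: "i \<in> ?I" "j \<in> ?I" "i \<noteq> j" "?S i \<inter> ?S j \<noteq> {}"
      obtain p h p' h' where e: "i = (p, h)" "j = (p', h')" by fastforce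
      from ij(4) obtain a b where ab: "a \<in> reduced_rows p" "a \<in> reduced_rows p'"
        "b \<in> reduced_rows (\<lambda>k. n - p k - 3 * h k)" "b \<in> reduced_rows (\<lambda>k. n - p' k - 3 * h' k)"
        by (auto simp: e)
      have p: "p = p'" using ab(1,2) by (auto simp: reduced_rows_def fun_eq_iff)
      have "h k = h' k" for k
      proof -
        have "n - p k - 3 * h k = n - p k - 3 * h' k" using ab(3,4) p by (auto simp: reduced_rows_def)
        moreover have "h k \<le> (n - p k) div 3" "h' k \<le> (n - p k) div 3" using ij(1,2) p by (auto simp: e)
        ultimately show ?thesis by linarith
      qed
      then show False using ij(3) p by (auto simp: e)
    qed
  qed
  also have "\<dots> = (\<Sum>(p, h)\<in>?I. card (reduced_rows p) * card (reduced_rows (\<lambda>k. n - p k - 3 * h k)))"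
    by (intro sum.cong) (auto simp: card_cartesian_product)
  also have "\<dots> = (\<Sum>p\<in>{p. \<forall>k. p k \<le> n}. \<Sum>h\<in>{h. \<forall>k. h k \<le> (n - p k) div 3}.
      card (reduced_rows p) * card (reduced_rows (\<lambda>k. n - p k - 3 * h k)))"
    using fin[of "\<lambda>_. n"] fin[of "\<lambda>k. (n - p k) div 3" for p]
    by (intro sum.Sigma[symmetric]) auto
  finally show ?thesis by (simp only: sum_distrib_left)
qed

section \<open>Evaluation of the counts for magic sums up to 8\<close>

definition triple :: "'a \<Rightarrow> 'a \<Rightarrow> 'a \<Rightarrow> 3 \<Rightarrow> 'a"
  where "triple x y z k = (if k = 0 then x else if k = 1 then y else z)"

lemma triple_simps [simp]: "triple x y z 0 = x" "triple x y z 1 = y" "triple x y z 2 = z"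
  by (simp_all add: triple_def)

lemma triple_eta: "triple (f 0) (f 1) (f 2) = f"
  by (rule ext) (metis exhaust_3_zero triple_simps)

lemma sum_triple:
  "(\<Sum>p\<in>{p :: 3 \<Rightarrow> nat. \<forall>k. p k \<le> m k}. f p) = (\<Sum>x\<le>m 0. \<Sum>y\<le>m 1. \<Sum>z\<le>m 2. f (triple x y z))"
proof -
  have "(\<Sum>p\<in>{p :: 3 \<Rightarrow> nat. \<forall>k. p k \<le> m k}. f p) =
      (\<Sum>(x, y, z)\<in>{..m 0} \<times> {..m 1} \<times> {..m 2}. f (triple x y z))"
    by (rule sum.reindex_bij_witness[of _ "\<lambda>(x, y, z). triple x y z" "\<lambda>p. (p 0, p 1, p 2)"])
      (auto simp: triple_eta forall_3_zero)
  then show ?thesis by (simp add: sum.cartesian_product case_prod_unfold)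
qed

definition red_count :: "nat \<Rightarrow> nat \<Rightarrow> nat \<Rightarrow> nat"
  where "red_count x y z = card (reduced_rows (triple x y z))"

text \<open>Adding \<open>i\<close>, \<open>j\<close>, \<open>k\<close> to the rows of a reduced matrix shows that this counts all matrices with
  equal column sums and row sums \<open>x\<close>, \<open>y\<close>, \<open>z\<close>.\<close>
definition dom_count :: "nat \<Rightarrow> nat \<Rightarrow> nat \<Rightarrow> nat"
  where "dom_count x y z = (\<Sum>i\<le>x div 3. \<Sum>j\<le>y div 3. \<Sum>k\<le>z div 3. red_count (x - 3 * i) (y - 3 * j) (z - 3 * k))"

lemma SH_eq_sum_red_count:
  "SH TYPE(3) TYPE(3) n = (\<Sum>x\<le>n. \<Sum>y\<le>n. \<Sum>z\<le>n. red_count x y z * dom_count (n - x) (n - y) (n - z))"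
proof -
  have tr: "(\<lambda>k. n - triple x y z k - 3 * triple i j l k) = triple (n - x - 3 * i) (n - y - 3 * j) (n - z - 3 * l)"
    for x y z i j l by (auto simp: fun_eq_iff triple_def)
  show ?thesis
    unfolding SH_eq_sum sum_triple[where m = "\<lambda>_. n"]
      sum_triple[where m = "\<lambda>k. (n - triple x y z k) div 3" for x y z]
    by (simp only: tr red_count_def dom_count_def triple_simps)
qed

lemma red_count_perm:
  assumes "bij \<pi>"
  shows "card (reduced_rows (p \<circ> \<pi>)) = card (reduced_rows p)"
proof -
  have inv: "bij (inv \<pi>)" using assms by (rule bij_imp_bij_inv)
  have id: "\<pi> \<circ> inv \<pi> = id" "inv \<pi> \<circ> \<pi> = id"
    using assms surj_iff inj_iff unfolding bij_def by blast+
  have into: "a \<circ> \<sigma> \<in> reduced_rows (q \<circ> \<sigma>)" if "a \<in> reduced_rows q" "bij \<sigma>" for a q and \<sigma> :: "3 \<Rightarrow> 3"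
  proof -
    have "(\<Sum>k\<in>UNIV. (a \<circ> \<sigma>) k u) = (\<Sum>k\<in>UNIV. a k u)" for u
      using sum.reindex_bij_betw[OF that(2), of "\<lambda>k. a k u"] by simp
    then show ?thesis using that(1) unfolding reduced_rows_def reduced_def by auto
  qed
  have "bij_betw (\<lambda>a. a \<circ> \<pi>) (reduced_rows p) (reduced_rows (p \<circ> \<pi>))"
  proof (rule bij_betwI[where g = "\<lambda>a. a \<circ> inv \<pi>"])
    show "(\<lambda>a. a \<circ> inv \<pi>) \<in> reduced_rows (p \<circ> \<pi>) \<rightarrow> reduced_rows p"
      using into[OF _ inv, of _ "p \<circ> \<pi>"] by (simp add: comp_assoc id Pi_def)
  qed (use into[OF _ assms] in \<open>simp_all add: comp_assoc id Pi_def\<close>)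
  then show ?thesis by (rule bij_betw_same_card[symmetric])
qed

lemma red_count_swap: "red_count x y z = red_count y x z" "red_count x y z = red_count x z y"
proof -
  have e: "triple x y z = triple y x z \<circ> Transposition.transpose 0 1"
    "triple x y z = triple x z y \<circ> Transposition.transpose 1 2"
    by (simp_all add: fun_eq_iff forall_3_zero Transposition.transpose_def)
  show "red_count x y z = red_count y x z" unfolding red_count_def by (subst e(1)) (rule red_count_perm[OF bij_transpose])
  show "red_count x y z = red_count x z y" unfolding red_count_def by (subst e(2)) (rule red_count_perm[OF bij_transpose])
qed

lemma dom_count_swap: "dom_count x y z = dom_count y x z" "dom_count x y z = dom_count x z y"
proof -
  show "dom_count x y z = dom_count y x z" unfolding dom_count_def by (subst sum.swap) (simp add: red_count_swap(1))
  show "dom_count x y z = dom_count x z y" unfolding dom_count_def by (subst (2) sum.swap) (simp add: red_count_swap(2))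
qed

text \<open>The possible rows with sum \<open>p\<close> of a reduced matrix, listed without
  repetition according to the position of the first zero.\<close>

definition boundary :: "nat \<Rightarrow> (nat \<times> nat \<times> nat) list"
  where "boundary p = map (\<lambda>j. (0, j, p - j)) [0..<Suc p] @ map (\<lambda>i. (i, 0, p - i)) [1..<Suc p] @
    map (\<lambda>i. (i, p - i, 0)) [1..<p]"

lemma set_boundary: "(i, j, l) \<in> set (boundary p) \<longleftrightarrow> i + j + l = p \<and> (i = 0 \<or> j = 0 \<or> l = 0)"
  by (auto simp: boundary_def image_iff)

lemma distinct_boundary: "distinct (boundary p)"
  by (auto simp: boundary_def distinct_map inj_on_def)

text \<open>Tests whether two rows can be completed to column sums \<open>A\<close> by a nonnegative
  third row that contains a zero. The value is 0 or 1, so that summing it counts.\<close>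

definition max_sum_eq :: "nat \<Rightarrow> nat \<times> nat \<times> nat \<Rightarrow> nat \<times> nat \<times> nat \<Rightarrow> nat"
  where "max_sum_eq A = (\<lambda>(i, j, l) (i', j', l').
    if i + i' \<le> A then if j + j' \<le> A then if l + l' \<le> A then
      if i + i' = A \<or> j + j' = A \<or> l + l' = A then 1 else 0 else 0 else 0 else 0)"

lemma red_count_eq_0: "\<not> 3 dvd (x + y + z) \<Longrightarrow> red_count x y z = 0"
proof -
  assume n: "\<not> 3 dvd (x + y + z)"
  have False if "a \<in> reduced_rows (triple x y z)" for a
  proof -
    have rows: "a 0 0 + a 0 1 + a 0 2 = x" "a 1 0 + a 1 1 + a 1 2 = y" "a 2 0 + a 2 1 + a 2 2 = z"
      using that by (simp_all add: reduced_rows_def forall_3_zero sum_UNIV_3)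
    have cols: "a 0 u + a 1 u + a 2 u = a 0 0 + a 1 0 + a 2 0" for u
      using that by (auto simp: reduced_rows_def reduced_def sum_UNIV_3)
    have "x + y + z = (a 0 0 + a 1 0 + a 2 0) + (a 0 1 + a 1 1 + a 2 1) + (a 0 2 + a 1 2 + a 2 2)"
      unfolding rows[symmetric] by simp
    also have "\<dots> = 3 * (a 0 0 + a 1 0 + a 2 0)" unfolding cols[of 1] cols[of 2] by simp
    finally show False using n by simp
  qed
  then have "reduced_rows (triple x y z) = {}" by blast
  then show ?thesis by (simp add: red_count_def)
qed

text \<open>The common column sum must be \<open>A\<close>, so the first two rows determine the
  third.\<close>

lemma red_count_eq:
  assumes "x + y + z = 3 * A"
  shows "red_count x y z = sum_list (map (\<lambda>a. sum_list (map (max_sum_eq A a) (boundary y))) (boundary x))"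
proof -
  let ?X = "set (boundary x)" and ?Y = "set (boundary y)"
  let ?S = "{(a, b) \<in> ?X \<times> ?Y. max_sum_eq A a b = 1}"
  let ?r = "\<lambda>v. (v 0, v 1, v (2 :: 3)) :: nat \<times> nat \<times> nat"
  let ?f = "\<lambda>a. (?r (a 0), ?r (a (1 :: 3)))"
  let ?t = "\<lambda>(i, j, l). triple i j l :: 3 \<Rightarrow> nat"
  let ?g = "\<lambda>(a, b). triple (?t a) (?t b) (\<lambda>u. A - ?t a u - ?t b u)"
  have "bij_betw ?f (reduced_rows (triple x y z)) ?S"
  proof (rule bij_betwI[where g = ?g])
    have red: "?f a \<in> ?S \<and> ?g (?f a) = a" if a: "a \<in> reduced_rows (triple x y z)" for a
    proof -
      have rows: "a 0 0 + a 0 1 + a 0 2 = x" "a 1 0 + a 1 1 + a 1 2 = y" "a 2 0 + a 2 1 + a 2 2 = z"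
        using a by (simp_all add: reduced_rows_def forall_3_zero sum_UNIV_3)
      have cols: "a 0 u + a 1 u + a 2 u = a 0 0 + a 1 0 + a 2 0" for u
        using a by (auto simp: reduced_rows_def reduced_def sum_UNIV_3)
      have A: "a 0 u + a 1 u + a 2 u = A" for u
        using rows cols[of 1] cols[of 2] cols[of u] assms by linarith
      have zero: "a k 0 = 0 \<or> a k 1 = 0 \<or> a k 2 = 0" for k
        using a by (auto simp: reduced_rows_def reduced_def ex_3_zero)
      have "a 2 = (\<lambda>u. A - a 0 u - a 1 u)"
      proof
        show "a 2 u = A - a 0 u - a 1 u" for u using A[of u] by simp
      qed
      moreover have "?t (?r v) = v" for v by (simp add: triple_eta)
      ultimately have "?g (?f a) = triple (a 0) (a 1) (a 2)" by simp
      then have "?g (?f a) = a" by (simp only: triple_eta)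
      moreover have "max_sum_eq A (?r (a 0)) (?r (a 1)) = 1"
        using A[of 0] A[of 1] A[of 2] zero[of 2] by (auto simp: max_sum_eq_def)
      ultimately show ?thesis using rows zero[of 0] zero[of 1] by (simp add: set_boundary)
    qed
    show "?f \<in> reduced_rows (triple x y z) \<rightarrow> ?S" using red by blast
    show "?g (?f a) = a" if "a \<in> reduced_rows (triple x y z)" for a using red[OF that] by blast
    have inv: "?g s \<in> reduced_rows (triple x y z) \<and> ?f (?g s) = s" if s: "s \<in> ?S" for s
    proof -
      obtain i j l i' j' l' where e: "s = ((i, j, l), (i', j', l'))" by (metis prod.exhaust)
      have b: "i + j + l = x" "i = 0 \<or> j = 0 \<or> l = 0" "i' + j' + l' = y" "i' = 0 \<or> j' = 0 \<or> l' = 0"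
        using s by (auto simp: e set_boundary)
      have m: "i + i' \<le> A" "j + j' \<le> A" "l + l' \<le> A" "i + i' = A \<or> j + j' = A \<or> l + l' = A"
        using s by (auto simp: e max_sum_eq_def split: if_splits)
      have "(A - i - i') + (A - j - j') + (A - l - l') = z"
        using assms b(1,3) m(1-3) by linarith
      then show ?thesis
        using b m by (auto simp: e reduced_rows_def reduced_def forall_3_zero ex_3_zero sum_UNIV_3)
    qed
    show "?g \<in> ?S \<rightarrow> reduced_rows (triple x y z)" using inv by blast
    show "?f (?g s) = s" if "s \<in> ?S" for s using inv[OF that] by blast
  qed
  then have "red_count x y z = card ?S" unfolding red_count_def by (rule bij_betw_same_card)
  also have "?S = {s \<in> ?X \<times> ?Y. max_sum_eq A (fst s) (snd s) = 1}" by auto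
  also have "card \<dots> = (\<Sum>s\<in>?X \<times> ?Y. if max_sum_eq A (fst s) (snd s) = 1 then 1 else 0)"
    by (simp only: card_eq_sum sum.inter_filter finite_cartesian_product List.finite_set)
  also have "\<dots> = (\<Sum>s\<in>?X \<times> ?Y. max_sum_eq A (fst s) (snd s))"
    by (intro sum.cong refl) (auto simp: max_sum_eq_def)
  also have "\<dots> = (\<Sum>a\<in>?X. \<Sum>b\<in>?Y. max_sum_eq A a b)"
    by (simp add: sum.cartesian_product case_prod_unfold)
  also have "\<dots> = sum_list (map (\<lambda>a. sum_list (map (max_sum_eq A a) (boundary y))) (boundary x))"
    by (simp add: sum.distinct_set_conv_list distinct_boundary)
  finally show ?thesis .
qed

lemma boundary_table:
  "boundary 0 = [(0, 0, 0)]"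
  "boundary (Suc 0) = [(0, 0, Suc 0), (0, Suc 0, 0), (Suc 0, 0, 0)]"
  "boundary 2 = [(0, 0, 2), (0, Suc 0, Suc 0), (0, 2, 0), (Suc 0, 0, Suc 0), (2, 0, 0), (Suc 0, Suc 0, 0)]"
  "boundary 3 = [(0, 0, 3), (0, Suc 0, 2), (0, 2, Suc 0), (0, 3, 0), (Suc 0, 0, 2), (2, 0, Suc 0), (3, 0, 0), (Suc 0, 2, 0), (2, Suc 0, 0)]"
  "boundary 4 = [(0, 0, 4), (0, Suc 0, 3), (0, 2, 2), (0, 3, Suc 0), (0, 4, 0), (Suc 0, 0, 3), (2, 0, 2), (3, 0, Suc 0), (4, 0, 0), (Suc 0, 3, 0), (2, 2, 0), (3, Suc 0, 0)]"
  "boundary 5 = [(0, 0, 5), (0, Suc 0, 4), (0, 2, 3), (0, 3, 2), (0, 4, Suc 0), (0, 5, 0), (Suc 0, 0, 4), (2, 0, 3), (3, 0, 2), (4, 0, Suc 0), (5, 0, 0), (Suc 0, 4, 0), (2, 3, 0), (3, 2, 0), (4, Suc 0, 0)]"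
  "boundary 6 = [(0, 0, 6), (0, Suc 0, 5), (0, 2, 4), (0, 3, 3), (0, 4, 2), (0, 5, Suc 0), (0, 6, 0), (Suc 0, 0, 5), (2, 0, 4), (3, 0, 3), (4, 0, 2), (5, 0, Suc 0), (6, 0, 0), (Suc 0, 5, 0), (2, 4, 0), (3, 3, 0), (4, 2, 0), (5, Suc 0, 0)]"
  "boundary 7 = [(0, 0, 7), (0, Suc 0, 6), (0, 2, 5), (0, 3, 4), (0, 4, 3), (0, 5, 2), (0, 6, Suc 0), (0, 7, 0), (Suc 0, 0, 6), (2, 0, 5), (3, 0, 4), (4, 0, 3), (5, 0, 2), (6, 0, Suc 0), (7, 0, 0), (Suc 0, 6, 0), (2, 5, 0), (3, 4, 0), (4, 3, 0), (5, 2, 0), (6, Suc 0, 0)]"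
  "boundary 8 = [(0, 0, 8), (0, Suc 0, 7), (0, 2, 6), (0, 3, 5), (0, 4, 4), (0, 5, 3), (0, 6, 2), (0, 7, Suc 0), (0, 8, 0), (Suc 0, 0, 7), (2, 0, 6), (3, 0, 5), (4, 0, 4), (5, 0, 3), (6, 0, 2), (7, 0, Suc 0), (8, 0, 0), (Suc 0, 7, 0), (2, 6, 0), (3, 5, 0), (4, 4, 0), (5, 3, 0), (6, 2, 0), (7, Suc 0, 0)]"
  by (simp_all add: boundary_def upt_rec)

text \<open>The tables are grouped by the common column sum and list increasing triples only;
  \<open>red_count_permutations\<close> supplies the other orders.\<close>

lemma red_count_table_0:
  "red_count 0 0 0 = Suc 0"
  by (simp_all add: red_count_eq[where A = "0"] boundary_table max_sum_eq_def)

lemma red_count_table_1: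
  "red_count 0 0 3 = 0" "red_count 0 (Suc 0) 2 = 3" "red_count (Suc 0) (Suc 0) (Suc 0) = 6"
  by (simp_all add: red_count_eq[where A = "Suc 0"] boundary_table max_sum_eq_def)

lemma red_count_table_2:
  "red_count 0 0 6 = 0" "red_count 0 (Suc 0) 5 = 0" "red_count 0 2 4 = 3" "red_count 0 3 3 = 6" "red_count (Suc 0) (Suc 0) 4 = 3"
  "red_count (Suc 0) 2 3 = 12" "red_count 2 2 2 = 21"
  by (simp_all add: red_count_eq[where A = "2"] boundary_table max_sum_eq_def)

lemma red_count_table_3:
  "red_count 0 (Suc 0) 8 = 0" "red_count 0 2 7 = 0" "red_count 0 3 6 = 3" "red_count 0 4 5 = 6" "red_count (Suc 0) (Suc 0) 7 = 0"
  "red_count (Suc 0) 2 6 = 3" "red_count (Suc 0) 3 5 = 12" "red_count (Suc 0) 4 4 = 18" "red_count 2 2 5 = 12" "red_count 2 3 4 = 27"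
  "red_count 3 3 3 = 36"
  by (simp_all add: red_count_eq[where A = "3"] boundary_table max_sum_eq_def)

lemma red_count_table_4:
  "red_count 0 4 8 = 3" "red_count 0 5 7 = 6" "red_count 0 6 6 = 6" "red_count (Suc 0) 3 8 = 3" "red_count (Suc 0) 4 7 = 12" "red_count (Suc 0) 5 6 = 18"
  "red_count 2 2 8 = 3" "red_count 2 3 7 = 12" "red_count 2 4 6 = 27" "red_count 2 5 5 = 36" "red_count 3 3 6 = 24" "red_count 3 4 5 = 42" "red_count 4 4 4 = 51"
  by (simp_all add: red_count_eq[where A = "4"] boundary_table max_sum_eq_def)

lemma red_count_table_5:
  "red_count 0 7 8 = 6" "red_count (Suc 0) 6 8 = 18" "red_count (Suc 0) 7 7 = 18" "red_count 2 5 8 = 27" "red_count 2 6 7 = 36" "red_count 3 4 8 = 24"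
  "red_count 3 5 7 = 42" "red_count 3 6 6 = 54" "red_count 4 4 7 = 36" "red_count 4 5 6 = 57" "red_count 5 5 5 = 66"
  by (simp_all add: red_count_eq[where A = "5"] boundary_table max_sum_eq_def)

lemma red_count_table_6:
  "red_count 2 8 8 = 36" "red_count 3 7 8 = 54" "red_count 4 6 8 = 57" "red_count 4 7 7 = 72" "red_count 5 5 8 = 48" "red_count 5 6 7 = 72" "red_count 6 6 6 = 81"
  by (simp_all add: red_count_eq[where A = "6"] boundary_table max_sum_eq_def)

lemma red_count_table_7:
  "red_count 5 8 8 = 90" "red_count 6 7 8 = 87" "red_count 7 7 7 = 96"
  by (simp_all add: red_count_eq[where A = "7"] boundary_table max_sum_eq_def)

lemma red_count_table_8:
  "red_count 8 8 8 = 111"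
  by (simp_all add: red_count_eq[where A = "8"] boundary_table max_sum_eq_def)

lemmas red_count_table = red_count_table_0 red_count_table_1 red_count_table_2 red_count_table_3 red_count_table_4 red_count_table_5 red_count_table_6 red_count_table_7 red_count_table_8

lemma red_count_table_zero:
  "red_count 0 0 (Suc 0) = 0" "red_count 0 0 2 = 0" "red_count 0 0 4 = 0" "red_count 0 0 5 = 0" "red_count 0 0 7 = 0"
  "red_count 0 0 8 = 0" "red_count 0 (Suc 0) (Suc 0) = 0" "red_count 0 (Suc 0) 3 = 0" "red_count 0 (Suc 0) 4 = 0" "red_count 0 (Suc 0) 6 = 0"
  "red_count 0 (Suc 0) 7 = 0" "red_count 0 2 2 = 0" "red_count 0 2 3 = 0" "red_count 0 2 5 = 0" "red_count 0 2 6 = 0"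
  "red_count 0 2 8 = 0" "red_count 0 3 4 = 0" "red_count 0 3 5 = 0" "red_count 0 3 7 = 0" "red_count 0 3 8 = 0"
  "red_count 0 4 4 = 0" "red_count 0 4 6 = 0" "red_count 0 4 7 = 0" "red_count 0 5 5 = 0" "red_count 0 5 6 = 0"
  "red_count 0 5 8 = 0" "red_count 0 6 7 = 0" "red_count 0 6 8 = 0" "red_count 0 7 7 = 0" "red_count 0 8 8 = 0"
  "red_count (Suc 0) (Suc 0) 2 = 0" "red_count (Suc 0) (Suc 0) 3 = 0" "red_count (Suc 0) (Suc 0) 5 = 0" "red_count (Suc 0) (Suc 0) 6 = 0" "red_count (Suc 0) (Suc 0) 8 = 0"
  "red_count (Suc 0) 2 2 = 0" "red_count (Suc 0) 2 4 = 0" "red_count (Suc 0) 2 5 = 0" "red_count (Suc 0) 2 7 = 0" "red_count (Suc 0) 2 8 = 0"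
  "red_count (Suc 0) 3 3 = 0" "red_count (Suc 0) 3 4 = 0" "red_count (Suc 0) 3 6 = 0" "red_count (Suc 0) 3 7 = 0" "red_count (Suc 0) 4 5 = 0"
  "red_count (Suc 0) 4 6 = 0" "red_count (Suc 0) 4 8 = 0" "red_count (Suc 0) 5 5 = 0" "red_count (Suc 0) 5 7 = 0" "red_count (Suc 0) 5 8 = 0"
  "red_count (Suc 0) 6 6 = 0" "red_count (Suc 0) 6 7 = 0" "red_count (Suc 0) 7 8 = 0" "red_count (Suc 0) 8 8 = 0" "red_count 2 2 3 = 0"
  "red_count 2 2 4 = 0" "red_count 2 2 6 = 0" "red_count 2 2 7 = 0" "red_count 2 3 3 = 0" "red_count 2 3 5 = 0"
  "red_count 2 3 6 = 0" "red_count 2 3 8 = 0" "red_count 2 4 4 = 0" "red_count 2 4 5 = 0" "red_count 2 4 7 = 0"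
  "red_count 2 4 8 = 0" "red_count 2 5 6 = 0" "red_count 2 5 7 = 0" "red_count 2 6 6 = 0" "red_count 2 6 8 = 0"
  "red_count 2 7 7 = 0" "red_count 2 7 8 = 0" "red_count 3 3 4 = 0" "red_count 3 3 5 = 0" "red_count 3 3 7 = 0"
  "red_count 3 3 8 = 0" "red_count 3 4 4 = 0" "red_count 3 4 6 = 0" "red_count 3 4 7 = 0" "red_count 3 5 5 = 0"
  "red_count 3 5 6 = 0" "red_count 3 5 8 = 0" "red_count 3 6 7 = 0" "red_count 3 6 8 = 0" "red_count 3 7 7 = 0"
  "red_count 3 8 8 = 0" "red_count 4 4 5 = 0" "red_count 4 4 6 = 0" "red_count 4 4 8 = 0" "red_count 4 5 5 = 0"
  "red_count 4 5 7 = 0" "red_count 4 5 8 = 0" "red_count 4 6 6 = 0" "red_count 4 6 7 = 0" "red_count 4 7 8 = 0"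
  "red_count 4 8 8 = 0" "red_count 5 5 6 = 0" "red_count 5 5 7 = 0" "red_count 5 6 6 = 0" "red_count 5 6 8 = 0"
  "red_count 5 7 7 = 0" "red_count 5 7 8 = 0" "red_count 6 6 7 = 0" "red_count 6 6 8 = 0" "red_count 6 7 7 = 0"
  "red_count 6 8 8 = 0" "red_count 7 7 8 = 0" "red_count 7 8 8 = 0"
  by (rule red_count_eq_0, presburger)+

lemma red_count_permutations:
  "red_count x y z = v \<Longrightarrow> red_count x y z = v \<and> red_count x z y = v \<and> red_count y x z = v \<and> red_count y z x = v \<and> red_count z x y = v \<and> red_count z y x = v"
  by (metis red_count_swap)

lemma dom_count_permutations:
  "dom_count x y z = v \<Longrightarrow> dom_count x y z = v \<and> dom_count x z y = v \<and> dom_count y x z = v \<and> dom_count y z x = v \<and> dom_count z x y = v \<and> dom_count z y x = v"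
  by (metis dom_count_swap)

lemma sum_atMost_numeral: "(\<Sum>i\<le>numeral k. f i) = (\<Sum>i\<le>pred_numeral k. f i) + f (numeral k :: nat)"
  by (simp add: numeral_eq_Suc)

text \<open>Triples whose sum is not divisible by 3 are absent, because they are multiplied by a
  vanishing \<open>red_count\<close> in \<open>SH_eq_sum_red_count\<close>. The values at
  \<open>x = y = z\<close> are the numbers of 3 x 3 semi-magic squares.\<close>

lemma dom_count_table:
  "dom_count 0 0 0 = Suc 0" "dom_count 0 0 3 = Suc 0" "dom_count 0 0 6 = Suc 0" "dom_count 0 (Suc 0) 2 = 3" "dom_count 0 (Suc 0) 5 = 3"
  "dom_count 0 (Suc 0) 8 = 3" "dom_count 0 2 4 = 6" "dom_count 0 2 7 = 6" "dom_count 0 3 3 = 7" "dom_count 0 3 6 = 10" "dom_count 0 4 5 = 12"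
  "dom_count 0 4 8 = 15" "dom_count 0 5 7 = 18" "dom_count 0 6 6 = 19" "dom_count 0 7 8 = 27" "dom_count (Suc 0) (Suc 0) (Suc 0) = 6"
  "dom_count (Suc 0) (Suc 0) 4 = 9" "dom_count (Suc 0) (Suc 0) 7 = 9" "dom_count (Suc 0) 2 3 = 15" "dom_count (Suc 0) 2 6 = 18"
  "dom_count (Suc 0) 3 5 = 27" "dom_count (Suc 0) 3 8 = 30" "dom_count (Suc 0) 4 4 = 30" "dom_count (Suc 0) 4 7 = 42" "dom_count (Suc 0) 5 6 = 48"
  "dom_count (Suc 0) 6 8 = 69" "dom_count (Suc 0) 7 7 = 72" "dom_count 2 2 2 = 21" "dom_count 2 2 5 = 33" "dom_count 2 2 8 = 36" "dom_count 2 3 4 = 45"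
  "dom_count 2 3 7 = 57" "dom_count 2 4 6 = 75" "dom_count 2 5 5 = 81" "dom_count 2 5 8 = 111" "dom_count 2 6 7 = 123" "dom_count 2 8 8 = 177"
  "dom_count 3 3 3 = 55" "dom_count 3 3 6 = 85" "dom_count 3 4 5 = 105" "dom_count 3 4 8 = 135" "dom_count 3 5 7 = 165" "dom_count 3 6 6 = 175"
  "dom_count 3 7 8 = 255" "dom_count 4 4 4 = 120" "dom_count 4 4 7 = 180" "dom_count 4 5 6 = 210" "dom_count 4 6 8 = 315" "dom_count 4 7 7 = 330"
  "dom_count 5 5 5 = 231" "dom_count 5 5 8 = 336" "dom_count 5 6 7 = 378" "dom_count 5 8 8 = 567" "dom_count 6 6 6 = 406" "dom_count 6 7 8 = 630"
  "dom_count 7 7 7 = 666" "dom_count 8 8 8 = 1035"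
  by (simp_all add: dom_count_def sum_atMost_numeral red_count_table[THEN red_count_permutations])

lemma SH_value_0: "SH TYPE(3) TYPE(3) 0 = Suc 0"
  by (simp add: SH_eq_sum_red_count sum_atMost_numeral red_count_table[THEN red_count_permutations] red_count_table_zero[THEN red_count_permutations]
      dom_count_table[THEN dom_count_permutations])

lemma SH_value_1: "SH TYPE(3) TYPE(3) (Suc 0) = 12"
  by (simp add: SH_eq_sum_red_count sum_atMost_numeral red_count_table[THEN red_count_permutations] red_count_table_zero[THEN red_count_permutations]
      dom_count_table[THEN dom_count_permutations])

lemma SH_value_2: "SH TYPE(3) TYPE(3) 2 = 132"
  by (simp add: SH_eq_sum_red_count sum_atMost_numeral red_count_table[THEN red_count_permutations] red_count_table_zero[THEN red_count_permutations]
      dom_count_table[THEN dom_count_permutations])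

lemma SH_value_3: "SH TYPE(3) TYPE(3) 3 = 847"
  by (simp add: SH_eq_sum_red_count sum_atMost_numeral red_count_table[THEN red_count_permutations] red_count_table_zero[THEN red_count_permutations]
      dom_count_table[THEN dom_count_permutations])

lemma SH_value_4: "SH TYPE(3) TYPE(3) 4 = 3921"
  by (simp add: SH_eq_sum_red_count sum_atMost_numeral red_count_table[THEN red_count_permutations] red_count_table_zero[THEN red_count_permutations]
      dom_count_table[THEN dom_count_permutations])

lemma SH_value_5: "SH TYPE(3) TYPE(3) 5 = 14286"
  by (simp add: SH_eq_sum_red_count sum_atMost_numeral red_count_table[THEN red_count_permutations] red_count_table_zero[THEN red_count_permutations]
      dom_count_table[THEN dom_count_permutations])

lemma SH_value_6: "SH TYPE(3) TYPE(3) 6 = 43687"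
  by (simp add: SH_eq_sum_red_count sum_atMost_numeral red_count_table[THEN red_count_permutations] red_count_table_zero[THEN red_count_permutations]
      dom_count_table[THEN dom_count_permutations])

lemma SH_value_7: "SH TYPE(3) TYPE(3) 7 = 116757"
  by (simp add: SH_eq_sum_red_count sum_atMost_numeral red_count_table[THEN red_count_permutations] red_count_table_zero[THEN red_count_permutations]
      dom_count_table[THEN dom_count_permutations])

lemma SH_value_8: "SH TYPE(3) TYPE(3) 8 = 280656"
  by (simp add: SH_eq_sum_red_count sum_atMost_numeral red_count_table[THEN red_count_permutations] red_count_table_zero[THEN red_count_permutations]
      dom_count_table[THEN dom_count_permutations])

lemmas SH_values = SH_value_0 SH_value_1 SH_value_2 SH_value_3 SH_value_4 SH_value_5 SH_value_6 SH_value_7 SH_value_8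

section \<open>The generating function\<close>

text \<open>A denominator (1 - t)^9 (1 + t)^2 yields a polynomial of degree 8 plus (-1)^s times a
  linear one. Hence the two branches differ only in their linear and constant terms.\<close>

definition SH_even :: "real \<Rightarrow> real"
  where "SH_even x = 9/2240 * x^8 + 27/560 * x^7 + 87/320 * x^6 + 297/320 * x^5
    + 1341/640 * x^4 + 513/160 * x^3 + 3653/1120 * x^2 + 627/280 * x + 1"

definition SH_odd :: "real \<Rightarrow> real"
  where "SH_odd x = 9/2240 * x^8 + 27/560 * x^7 + 87/320 * x^6 + 297/320 * x^5
    + 1341/640 * x^4 + 513/160 * x^3 + 3653/1120 * x^2 + 4071/2240 * x + 47/128"

lemma quasi_polynomial_recurrence_even:
  "SH_even x - 7 * SH_odd (x - 1) + 19 * SH_even (x - 2) - 21 * SH_odd (x - 3) - 6 * SH_even (x - 4)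
    + 42 * SH_odd (x - 5) - 42 * SH_even (x - 6) + 6 * SH_odd (x - 7) + 21 * SH_even (x - 8)
    - 19 * SH_odd (x - 9) + 7 * SH_even (x - 10) - SH_odd (x - 11) = 0"
  unfolding SH_even_def SH_odd_def by algebra

lemma quasi_polynomial_recurrence_odd:
  "SH_odd x - 7 * SH_even (x - 1) + 19 * SH_odd (x - 2) - 21 * SH_even (x - 3) - 6 * SH_odd (x - 4)
    + 42 * SH_even (x - 5) - 42 * SH_odd (x - 6) + 6 * SH_even (x - 7) + 21 * SH_odd (x - 8)
    - 19 * SH_even (x - 9) + 7 * SH_odd (x - 10) - SH_even (x - 11) = 0"
  unfolding SH_even_def SH_odd_def by algebra

lemma SH_closed_form: "real (SH TYPE(3) TYPE(3) n) = (if even n then SH_even n else SH_odd n)"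
proof (induction n rule: less_induct)
  case (less n)
  show ?case
  proof (cases "n < 9")
    case True
    then have "n = 0 \<or> n = Suc 0 \<or> n = 2 \<or> n = 3 \<or> n = 4 \<or> n = 5 \<or> n = 6 \<or> n = 7 \<or> n = 8" by linarith
    then show ?thesis
      by (elim disjE) (simp_all add: SH_values SH_even_def SH_odd_def)
  next
    case False
    define f where "f = (\<lambda>n j. if j \<le> n then real (SH TYPE(3) TYPE(3) (n - j)) else 0)"
    have f: "f n j = (if even (n + j) then SH_even (real n - real j) else SH_odd (real n - real j))"
      if "0 < j" "j \<le> 11" for j
    proof (cases "j \<le> n")
      case True
      then have "real n - real j = real (n - j)" "even (n + j) = even (n - j)" by (simp_all add: of_nat_diff)
      then show ?thesis using less.IH[of "n - j"] True that by (simp add: f_def)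
    next
      case F: False
      \<comment> \<open>The recurrence reaches the arguments -1 and -2, where
        \<open>SH_odd (-1) = 0\<close> and \<open>SH_even (-2) = 0\<close> agree with the default
        value of \<open>f\<close>.\<close>
      then have "n = 9 \<and> j = 10 \<or> n = 9 \<and> j = 11 \<or> n = 10 \<and> j = 11" using False that by arith
      then show ?thesis by (elim disjE) (simp_all add: f_def SH_even_def SH_odd_def)
    qed
    have rec: "f n 0 - 7 * f n 1 + 19 * f n 2 - 21 * f n 3 - 6 * f n 4 + 42 * f n 5 - 42 * f n 6
        + 6 * f n 7 + 21 * f n 8 - 19 * f n 9 + 7 * f n 10 - f n 11 = 0"
      unfolding f_def by (rule SH_recurrence) (use False in simp)
    have f0: "f n 0 = real (SH TYPE(3) TYPE(3) n)" by (simp add: f_def)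
    show ?thesis
    proof (cases "even n")
      case True
      then show ?thesis
        using rec quasi_polynomial_recurrence_even[of "real n"]
        by (simp add: f f0)
    next
      case odd: False
      then show ?thesis
        using rec quasi_polynomial_recurrence_odd[of "real n"]
        by (simp add: f f0)
    qed
  qed
qed

lemma denominator_expand:
  fixes x :: "'a::idom"
  shows "(1 - x)^9 * (1 + x)^2 = 1 - 7 * x^1 + 19 * x^2 - 21 * x^3 - 6 * x^4 + 42 * x^5 - 42 * x^6
    + 6 * x^7 + 21 * x^8 - 19 * x^9 + 7 * x^10 - x^11"
  by algebra

lemma fps_numeral_mult_X_nth:
  "fps_nth (numeral k * fps_X ^ m :: real fps) n = (if n = m then numeral k else 0)"
  by (simp add: numeral_fps_const fps_X_power_nth)

lemma SH_fps:
  defines "F \<equiv> Abs_fps (\<lambda>s. real (SH TYPE(3) TYPE(3) s))"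
  shows "F * ((1 - fps_X)^9 * (1 + fps_X)^2) =
    fps_X^8 + 5 * fps_X^7 + 67 * fps_X^6 + 130 * fps_X^5 + 242 * fps_X^4
      + 130 * fps_X^3 + 67 * fps_X^2 + 5 * fps_X + 1" (is "?L = ?R")
proof (rule fps_ext)
  fix n
  define f where "f = (\<lambda>n j. if j \<le> n then real (SH TYPE(3) TYPE(3) (n - j)) else 0)"
  have c: "fps_nth (F * (numeral k * fps_X ^ j)) n = numeral k * f n j" for k j
  proof -
    have eq: "F * (numeral k * fps_X ^ j) = fps_const (numeral k) * (F * fps_X ^ j)"
      by (simp only: numeral_fps_const mult.left_commute)
    show ?thesis
      unfolding eq fps_mult_left_const_nth by (simp add: F_def f_def fps_X_power_mult_right_nth)
  qed
  have c1: "fps_nth (F * fps_X ^ j) n = f n j" "fps_nth F n = f n 0" for j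
    by (simp_all add: F_def f_def fps_X_power_mult_right_nth)
  have lhs: "fps_nth ?L n =
    f n 0 - 7 * f n 1 + 19 * f n 2 - 21 * f n 3 - 6 * f n 4 + 42 * f n 5 - 42 * f n 6
    + 6 * f n 7 + 21 * f n 8 - 19 * f n 9 + 7 * f n 10 - f n 11"
    unfolding denominator_expand ring_distribs mult_1_right fps_add_nth fps_sub_nth c c1 by simp
  have rhs: "fps_nth ?R n =
    (if n = 8 then 1 else if n = 7 then 5 else if n = 6 then 67 else if n = 5 then 130 else if n = 4 then 242
      else if n = 3 then 130 else if n = 2 then 67 else if n = 1 then 5 else if n = 0 then 1 else 0)"
    using fps_numeral_mult_X_nth[where m = 1]
    by (simp add: fps_numeral_mult_X_nth fps_X_power_nth)
  show "fps_nth ?L n = fps_nth ?R n"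
  proof (cases "n < 9")
    case True
    then have "n = 0 \<or> n = Suc 0 \<or> n = 2 \<or> n = 3 \<or> n = 4 \<or> n = 5 \<or> n = 6 \<or> n = 7 \<or> n = 8" by linarith
    then show ?thesis
      unfolding lhs rhs f_def by (elim disjE) (simp_all add: SH_values)
  next
    case False
    then show ?thesis
      unfolding lhs rhs f_def by (subst SH_recurrence) auto
  qed
qed

lemma SH_fps_div:
  defines "F \<equiv> Abs_fps (\<lambda>s. real (SH TYPE(3) TYPE(3) s))"
  shows "F = (fps_X^8 + 5 * fps_X^7 + 67 * fps_X^6 + 130 * fps_X^5 + 242 * fps_X^4
            + 130 * fps_X^3 + 67 * fps_X^2 + 5 * fps_X + 1)
         / ((1 - fps_X)^9 * (1 + fps_X)^2)"
proof -
  have "fps_nth ((1 - fps_X)^9 * (1 + fps_X)^2 :: real fps) 0 = 1" by (simp add: fps_power_zeroth)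
  then have "((1 - fps_X)^9 * (1 + fps_X)^2 :: real fps) \<noteq> 0" by (metis fps_zero_nth zero_neq_one)
  then show ?thesis
    unfolding SH_fps[symmetric] F_def by (rule nonzero_mult_div_cancel_right[symmetric])
qed

lemma SH_fps_cutoff:
  defines "F \<equiv> Abs_fps (\<lambda>s. real (SH TYPE(3) TYPE(3) s))"
  shows "fps_cutoff 8 F = 1 + 12 * fps_X + 132 * fps_X^2 + 847 * fps_X^3 + 3921 * fps_X^4
           + 14286 * fps_X^5 + 43687 * fps_X^6 + 116757 * fps_X^7" (is "_ = ?R")
proof (rule fps_ext)
  fix n
  have rhs: "fps_nth ?R n =
    (if n = 7 then 116757 else if n = 6 then 43687 else if n = 5 then 14286 else if n = 4 then 3921
      else if n = 3 then 847 else if n = 2 then 132 else if n = 1 then 12 else if n = 0 then 1 else 0)"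
    using fps_numeral_mult_X_nth[where m = 1]
    by (simp add: fps_numeral_mult_X_nth fps_X_power_nth)
  show "fps_nth (fps_cutoff 8 F) n = fps_nth ?R n"
  proof (cases "n < 8")
    case True
    then have "n = 0 \<or> n = Suc 0 \<or> n = 2 \<or> n = 3 \<or> n = 4 \<or> n = 5 \<or> n = 6 \<or> n = 7" by linarith
    then show ?thesis
      unfolding rhs by (elim disjE) (simp_all add: SH_values F_def)
  next
    case False
    then show ?thesis unfolding rhs by simp
  qed
qed

section \<open>Non-integral vertices\<close>

text \<open>The endpoints of a segment with \<open>x\<close> in its interior vanish wherever
  \<open>x\<close> does, so both would equal \<open>x\<close>.\<close>

lemma unique_support_vertex:
  assumes x: "x \<in> stochastic_hypercubes"
    and unique: "\<And>a. a \<in> stochastic_hypercubes \<Longrightarrow> (\<And>i. x $ i = 0 \<Longrightarrow> a $ i = 0) \<Longrightarrow> a = x"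
  shows "x \<in> polytope_vertices stochastic_hypercubes"
proof -
  have False if a: "a \<in> stochastic_hypercubes" and b: "b \<in> stochastic_hypercubes"
    and seg: "x \<in> open_segment a b" for a b
  proof -
    obtain u where u: "a \<noteq> b" "0 < u" "u < 1" "x = (1 - u) *\<^sub>R a + u *\<^sub>R b"
      using seg by (auto simp: in_segment)
    have zero: "a $ i = 0 \<and> b $ i = 0" if "x $ i = 0" for i
    proof -
      have "(1 - u) * a $ i + u * b $ i = 0" using u(4) that by simp
      moreover have "0 \<le> (1 - u) * a $ i" "0 \<le> u * b $ i"
        using a b u by (simp_all add: stochastic_hypercubes_def)
      ultimately have "(1 - u) * a $ i = 0" "u * b $ i = 0" by linarith+
      then show ?thesis using u by simp
    qed
    have "a = x" "b = x" using unique[OF a] unique[OF b] zero by blast+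
    then show False using u(1) by simp
  qed
  then show ?thesis using x by (auto simp: polytope_vertices_def extreme_point_of_def)
qed

definition half_cube :: "real ^ (3 \<Rightarrow> 3)"
  where "half_cube = (\<chi> i. cube_of (half_weights 0 1 0) (half_weights 2 1 0) i / 2)"

lemma half_cube_skew: "half_cube $ skew k u v = (half_weights 0 1 0 k u + half_weights 2 1 0 k v) / 2"
  by (simp add: half_cube_def)

lemma line_sums_half_cube: "line_sums_eq (($) half_cube) 1"
proof -
  have "line_sums_eq (cube_of (half_weights 0 1 0) (half_weights 2 1 0)) 2"
    by (rule line_sums_half) simp
  then show ?thesis by (simp add: line_sums_eq_def half_cube_def flip: sum_divide_distrib)
qed

lemma half_cube_nonneg: "0 \<le> half_cube $ i"
proof -
  obtain k u v where i: "i = skew k u v" using ex_skew by blast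
  show ?thesis unfolding i half_cube_skew by (simp add: half_weights_def)
qed

lemma half_cube_stochastic: "half_cube \<in> stochastic_hypercubes"
  by (simp add: stochastic_hypercubes_def half_cube_nonneg line_sums_half_cube)

text \<open>Subtracting the multiple of the half-integral cube that agrees with \<open>y\<close> in one cell leaves a
  cube to which \<open>flat_zero\<close> applies.\<close>
lemma half_cube_unique:
  assumes y: "y \<in> stochastic_hypercubes" and zero: "\<And>i. half_cube $ i = 0 \<Longrightarrow> y $ i = 0"
  shows "y = half_cube"
proof -
  \<comment> \<open>This makes \<open>z\<close> vanish at \<open>skew 2 1 1\<close>, where
    \<open>half_cube\<close> is 1/2. The other free cell of \<open>flat_zero\<close>, here
    \<open>skew 1 2 1\<close>, is already a zero of \<open>half_cube\<close>.\<close>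
  define c where "c = 2 * y $ skew 2 1 1"
  define z where "z i = y $ i - c * half_cube $ i" for i
  have "line_sums_eq z (1 - c)"
    using y line_sums_half_cube
    by (simp add: z_def line_sums_eq_def stochastic_hypercubes_def sum_subtractf flip: sum_distrib_left)
  from additive_form[OF this] obtain a b where eq: "\<And>k u v. z (skew k u v) = a k u + b k v"
    and col: "\<And>u v. (\<Sum>k\<in>UNIV. a k u + b k v) = 1 - c"
    and row: "\<And>k. (\<Sum>u\<in>UNIV. a k u) + (\<Sum>v\<in>UNIV. b k v) = 1 - c" by blast
  have z0: "z (skew k u v) = 0" if "half_weights 0 1 0 k u + half_weights 2 1 0 k v = 0" for k u v
  proof -
    have "half_cube $ skew k u v = 0" unfolding half_cube_skew that by simp
    then show ?thesis using zero by (simp add: z_def)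
  qed
  have "a k u + b k v = 0" for k u v
  proof (rule flat_zero[OF col row, of 2 1 0 1 0 2 0 1 2])
    show "a 2 u + b 2 0 = 0" for u unfolding eq[symmetric] by (rule z0) (simp add: half_weights_def)
    show "a 1 1 + b 1 1 = 0" "a 1 1 + b 1 2 = 0" "a 0 0 + b 0 1 = 0" "a 0 0 + b 0 2 = 0" "a 1 2 + b 1 1 = 0"
      unfolding eq[symmetric] by (rule z0, simp add: half_weights_def)+
    show "a 2 1 + b 2 1 = 0"
      unfolding eq[symmetric] by (simp add: z_def c_def half_cube_skew half_weights_def)
  qed simp_all
  then have z: "z i = 0" for i using ex_skew[of i] eq by auto
  have "(\<Sum>j\<in>UNIV. z ((\<lambda>_. 0)(0 := j))) = 1 - c"
    using \<open>line_sums_eq z (1 - c)\<close> unfolding line_sums_eq_def by blast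
  then have "c = 1" by (simp add: z)
  then show ?thesis using z by (simp add: z_def vec_eq_iff)
qed

lemma half_cube_not_integral: "half_cube $ skew 2 1 1 \<notin> \<int>"
proof -
  have "half_cube $ skew 2 1 1 = 1 / 2" by (simp add: half_cube_skew half_weights_def)
  moreover have "(1 / 2 :: real) \<notin> \<int>"
  proof
    assume "(1 / 2 :: real) \<in> \<int>"
    then obtain n where "(1 / 2 :: real) = of_int n" by (auto elim: Ints_cases)
    then have "of_int (2 * n) = (1 :: real)" by simp
    then have "2 * n = 1" by (simp only: of_int_eq_1_iff)
    then show False by presburger
  qed
  ultimately show ?thesis by metis
qed

lemma not_integral_3: "\<not> integral_polytope (stochastic_hypercubes :: (real ^ (3 \<Rightarrow> 3)) set)"
proof -
  have "half_cube \<in> polytope_vertices stochastic_hypercubes"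
    using half_cube_stochastic half_cube_unique by (rule unique_support_vertex)
  then show ?thesis using half_cube_not_integral unfolding integral_polytope_def by blast
qed

section \<open>Dimension four by shearing\<close>

definition shear :: "(4 \<Rightarrow> 3) \<Rightarrow> 3 \<Rightarrow> 3"
  where "shear i = triple (i 0) (i 1) (i 2 + i 3)"

definition unshear :: "3 \<Rightarrow> (3 \<Rightarrow> 3) \<Rightarrow> 4 \<Rightarrow> 3"
  where "unshear t j d = (if d = 0 then j 0 else if d = 1 then j 1 else if d = 2 then j 2 - t else t)"

lemma exhaust_4_zero: "d = 0 \<or> d = 1 \<or> d = 2 \<or> d = (3 :: 4)"
  using exhaust_4[of d] by auto

lemma shear_unshear: "shear (unshear t j) = j"
proof -
  have "shear (unshear t j) = triple (j 0) (j 1) (j 2)" by (simp add: shear_def unshear_def)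
  then show ?thesis by (simp only: triple_eta)
qed

lemma unshear_shear: "unshear (i 3) (shear i) = i"
proof
  fix d :: 4
  show "unshear (i 3) (shear i) d = i d"
    using exhaust_4_zero[of d] by (elim disjE) (simp_all add: shear_def unshear_def)
qed

lemma bij_add_3: "bij (\<lambda>j :: 3. j + t)"
  unfolding bij_def by (simp add: finite_UNIV_inj_surj inj_def)

text \<open>Lines along axis 2 and along axis 3 both become lines along axis 2 of the cube, up to a
  cyclic shift.\<close>

lemma shear_stochastic:
  assumes x: "x \<in> stochastic_hypercubes"
  shows "(\<chi> i. x $ shear i) \<in> stochastic_hypercubes"
proof -
  have line: "(\<Sum>j\<in>UNIV. x $ (i(k := j))) = 1" for i k
    using x by (simp add: stochastic_hypercubes_def line_sums_eq_def)
  have upd: "shear (i(0 := j)) = (shear i)(0 := j)" "shear (i(1 := j)) = (shear i)(1 := j)"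
    "shear (i(2 := j)) = (shear i)(2 := j + i 3)" "shear (i(3 := j)) = (shear i)(2 := j + i 2)" for i j
    by (simp_all add: fun_eq_iff forall_3_zero shear_def add.commute)
  have "(\<Sum>j\<in>UNIV. x $ shear (i(k := j))) = 1" for i k
    using exhaust_4_zero[of k]
  proof (elim disjE)
    assume "k = 2"
    then show ?thesis
      using sum.reindex_bij_betw[OF bij_add_3[of "i 3"], of "\<lambda>j. x $ ((shear i)(2 := j))"]
      by (simp add: upd line)
  next
    assume "k = 3"
    then show ?thesis
      using sum.reindex_bij_betw[OF bij_add_3[of "i 2"], of "\<lambda>j. x $ ((shear i)(2 := j))"]
      by (simp add: upd line)
  qed (simp_all add: upd line)
  then show ?thesis using x by (simp add: stochastic_hypercubes_def line_sums_eq_def)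
qed

lemma unshear_stochastic:
  assumes x: "x \<in> stochastic_hypercubes"
  shows "(\<chi> j. x $ unshear t j) \<in> stochastic_hypercubes"
proof -
  have line: "(\<Sum>j\<in>UNIV. x $ (i(k := j))) = 1" for i k
    using x by (simp add: stochastic_hypercubes_def line_sums_eq_def)
  have upd: "unshear t (i(0 := j)) = (unshear t i)(0 := j)" "unshear t (i(1 := j)) = (unshear t i)(1 := j)"
    "unshear t (i(2 := j)) = (unshear t i)(2 := j + - t)" for i j
    by (auto simp: fun_eq_iff unshear_def)
  have "(\<Sum>j\<in>UNIV. x $ unshear t (i(k := j))) = 1" for i k
    using exhaust_3_zero[of k]
  proof (elim disjE)
    assume "k = 2"
    then show ?thesis
      using sum.reindex_bij_betw[OF bij_add_3[of "- t"], of "\<lambda>j. x $ ((unshear t i)(2 := j))"]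
      by (simp only: upd line)
  qed (simp_all add: upd line)
  then show ?thesis using x by (simp add: stochastic_hypercubes_def line_sums_eq_def)
qed

text \<open>For an array supported in the sheared cube, each slice \<open>i 3 = t\<close> becomes,
  after unshearing, a stochastic cube supported in \<open>half_cube\<close>, so it equals
  \<open>half_cube\<close>.\<close>

lemma not_integral_4: "\<not> integral_polytope (stochastic_hypercubes :: (real ^ (4 \<Rightarrow> 3)) set)"
proof -
  let ?w = "(\<chi> i. half_cube $ shear i) :: real ^ (4 \<Rightarrow> 3)"
  have "?w \<in> polytope_vertices stochastic_hypercubes"
  proof (rule unique_support_vertex)
    show "?w \<in> stochastic_hypercubes" by (rule shear_stochastic[OF half_cube_stochastic])
    fix a :: "real ^ (4 \<Rightarrow> 3)"
    assume a: "a \<in> stochastic_hypercubes" and zero: "\<And>i. ?w $ i = 0 \<Longrightarrow> a $ i = 0"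
    have "(\<chi> j. a $ unshear t j) = half_cube" for t
    proof (rule half_cube_unique[OF unshear_stochastic[OF a]])
      fix j assume "half_cube $ j = 0"
      then show "(\<chi> j. a $ unshear t j) $ j = 0" using zero[of "unshear t j"] by (simp add: shear_unshear)
    qed
    then have "a $ unshear t j = half_cube $ j" for t j by (metis vec_lambda_beta)
    then have "a $ i = half_cube $ shear i" for i by (metis unshear_shear)
    then show "a = ?w" by (simp add: vec_eq_iff)
  qed
  moreover have "?w $ unshear 0 (skew 2 1 1) \<notin> \<int>"
    using half_cube_not_integral by (simp add: shear_unshear)
  ultimately show ?thesis unfolding integral_polytope_def by blast
qed

section \<open>Permanents and Latin squares\<close>

text \<open>The iterated derivative of \<open>\<lambda>v. \<Prod>r\<in>S. v r\<close> in the directions \<open>cs\<close>; it is a permanent, independent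
  of \<open>v\<close>, if \<open>length cs = card S\<close>.\<close>
fun polar :: "('a \<Rightarrow> 'b::comm_ring_1) list \<Rightarrow> 'a set \<Rightarrow> ('a \<Rightarrow> 'b) \<Rightarrow> 'b"
  where
    "polar [] S v = (\<Prod>r\<in>S. v r)"
  | "polar (c # cs) S v = (\<Sum>r\<in>S. c r * polar cs (S - {r}) v)"

text \<open>The restriction of \<open>polar cs S\<close> to the line \<open>v + t * w\<close>, as a
  polynomial in \<open>t\<close>.\<close>

definition polar_poly :: "('a \<Rightarrow> 'b::comm_ring_1) list \<Rightarrow> 'a set \<Rightarrow> ('a \<Rightarrow> 'b) \<Rightarrow> ('a \<Rightarrow> 'b) \<Rightarrow> 'b poly"
  where "polar_poly cs S v w = polar (map (\<lambda>c r. [:c r:]) cs) S (\<lambda>r. [:v r, w r:])"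

lemma polar_poly_Nil: "polar_poly [] S v w = (\<Prod>r\<in>S. [:v r, w r:])"
  by (simp add: polar_poly_def)

lemma polar_poly_Cons:
  "polar_poly (c # cs) S v w = (\<Sum>r\<in>S. smult (c r) (polar_poly cs (S - {r}) v w))"
  by (simp add: polar_poly_def)

lemma poly_polar_poly: "poly (polar_poly cs S v w) t = polar cs S (\<lambda>r. v r + t * w r)"
  by (induction cs arbitrary: S) (simp_all add: polar_poly_Nil polar_poly_Cons poly_prod poly_sum)

lemma degree_coeff_polar_poly:
  assumes "finite S" "length cs \<le> card S"
  shows "degree (polar_poly cs S v w) \<le> card S - length cs \<and>
    coeff (polar_poly cs S v w) (card S - length cs) = polar cs S w"
  using assms
proof (induction cs arbitrary: S)
  case Nil
  then show ?case
  proof (induction S)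
    case empty
    then show ?case by (simp add: polar_poly_Nil)
  next
    case (insert r S)
    let ?q = "\<Prod>r\<in>S. [:v r, w r:]"
    have q: "degree ?q \<le> card S" "coeff ?q (card S) = (\<Prod>r\<in>S. w r)"
      using insert by (simp_all add: polar_poly_Nil)
    have "degree ([:v r, w r:] * ?q) \<le> 1 + card S"
      by (intro order.trans[OF degree_mult_le] add_mono q) (simp add: degree_pCons_le)
    moreover have "coeff ?q (Suc (card S)) = 0" using q(1) by (intro coeff_eq_0) simp
    ultimately show ?case using insert.hyps q by (simp add: polar_poly_Nil)
  qed
next
  case (Cons c cs)
  have len: "length cs \<le> card (S - {r})" "card (S - {r}) - length cs = card S - length (c # cs)" if "r \<in> S" for r
    using that Cons.prems by auto
  have IH: "degree (polar_poly cs (S - {r}) v w) \<le> card S - length (c # cs) \<and>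
    coeff (polar_poly cs (S - {r}) v w) (card S - length (c # cs)) = polar cs (S - {r}) w" if "r \<in> S" for r
    using Cons.IH[of "S - {r}"] Cons.prems(1) len[OF that] by simp
  have "degree (polar_poly (c # cs) S v w) \<le> card S - length (c # cs)"
    unfolding polar_poly_Cons
    using IH by (intro degree_sum_le Cons.prems order.trans[OF degree_smult_le]) auto
  moreover have "coeff (polar_poly (c # cs) S v w) (card S - length (c # cs)) = polar (c # cs) S w"
    unfolding polar_poly_Cons using IH by (simp add: coeff_sum)
  ultimately show ?case by blast
qed

lemma sum_remove_swap:
  assumes "finite S"
  shows "(\<Sum>r\<in>S. \<Sum>r'\<in>S - {r}. f r r') = (\<Sum>r\<in>S. \<Sum>r'\<in>S - {r}. f r' r)"
proof -
  have "(\<Sum>r\<in>S. \<Sum>r'\<in>S - {r}. f r r') = (\<Sum>r\<in>S. \<Sum>r'\<in>S. if r \<noteq> r' then f r r' else 0)"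
    using assms by (intro sum.cong refl sum.mono_neutral_cong_left) auto
  also have "\<dots> = (\<Sum>r'\<in>S. \<Sum>r\<in>S. if r \<noteq> r' then f r r' else 0)" by (rule sum.swap)
  also have "\<dots> = (\<Sum>r\<in>S. \<Sum>r'\<in>S - {r}. f r' r)"
    using assms by (intro sum.cong refl sum.mono_neutral_cong_right) auto
  finally show ?thesis .
qed

lemma smult_sum_right: "smult c (sum f A) = (\<Sum>i\<in>A. smult c (f i))"
  by (induction A rule: infinite_finite_induct) (simp_all add: smult_add_right)

lemma pderiv_sum_poly: "pderiv (sum f A) = (\<Sum>i\<in>A. pderiv (f i))"
  using higher_pderiv_sum[of 1 f A] by simp

text \<open>Differentiating along the line adds \<open>w\<close> to the directions; directional
  derivatives commute, so it may be put in front.\<close>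

lemma pderiv_polar_poly:
  fixes v w :: "'a \<Rightarrow> 'b::{idom, semiring_char_0}"
  assumes "finite S"
  shows "pderiv (polar_poly cs S v w) = polar_poly (w # cs) S v w"
  using assms
proof (induction cs arbitrary: S)
  case Nil
  then show ?case
    by (simp add: polar_poly_Nil polar_poly_Cons pderiv_prod pderiv_pCons mult.commute)
next
  case (Cons c cs)
  have diff: "S - {r} - {r'} = S - {r'} - {r}" for r r' :: 'a by blast
  have "pderiv (polar_poly (c # cs) S v w) =
      (\<Sum>r\<in>S. smult (c r) (polar_poly (w # cs) (S - {r}) v w))"
    using Cons by (simp add: polar_poly_Cons[of c] pderiv_sum_poly pderiv_smult)
  also have "\<dots> = (\<Sum>r\<in>S. \<Sum>r'\<in>S - {r}. smult (c r * w r') (polar_poly cs (S - {r} - {r'}) v w))"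
    by (simp add: polar_poly_Cons smult_sum_right)
  also have "\<dots> = (\<Sum>r\<in>S. \<Sum>r'\<in>S - {r}. smult (c r' * w r) (polar_poly cs (S - {r'} - {r}) v w))"
    by (rule sum_remove_swap[OF Cons.prems])
  also have "\<dots> = polar_poly (w # c # cs) S v w"
    by (simp add: polar_poly_Cons smult_sum_right diff mult.commute)
  finally show ?case .
qed

section \<open>Positivity, stability and real-rootedness\<close>

lemma polar_pos:
  fixes v :: "'a \<Rightarrow> real"
  assumes "finite S" "length cs \<le> card S" "\<And>c r. c \<in> set cs \<Longrightarrow> r \<in> S \<Longrightarrow> 0 < c r"
    "\<And>r. r \<in> S \<Longrightarrow> 0 < v r"
  shows "0 < polar cs S v"
  using assms
proof (induction cs arbitrary: S)
  case Nil
  then show ?case by (auto intro: prod_pos)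
next
  case (Cons c cs)
  then show ?case by (auto intro!: sum_pos mult_pos_pos Cons.IH)
qed

lemma polar_of_real:
  "polar (map (\<lambda>c r. complex_of_real (c r)) cs) S (\<lambda>r. of_real (v r)) = of_real (polar cs S v)"
  by (induction cs arbitrary: S) auto

text \<open>The logarithmic derivative at 0 is the sum of -1/x over the roots \<open>x\<close>, and
  -1/x lies in the lower half-plane together with \<open>x\<close>.\<close>

lemma Im_pderiv_div_neg:
  fixes p :: "complex poly"
  assumes "\<And>t. poly p t = 0 \<Longrightarrow> Im t < 0" "0 < degree p"
  shows "Im (poly (pderiv p) 0 / poly p 0) < 0"
  using assms
proof (induction "degree p" arbitrary: p)
  case 0
  then show ?case by simp
next
  case (Suc n)
  obtain x where x: "poly p x = 0"
    using fundamental_theorem_of_algebra[of p] Suc.hyps(2) by (auto simp: constant_degree)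
  then obtain q where q: "p = [:-x, 1:] * q" by (auto simp: poly_eq_0_iff_dvd)
  have "q \<noteq> 0" using q Suc.prems(2) by auto
  then have deg: "degree p = Suc (degree q)" unfolding q by (subst degree_mult_eq) auto
  have x0: "Im x < 0" using Suc.prems(1) x by blast
  have q0: "poly q 0 \<noteq> 0" using Suc.prems(1)[of 0] by (auto simp: q)
  have "x \<noteq> 0" using x0 by auto
  have eq: "poly (pderiv p) 0 / poly p 0 = - (1 / x) + poly (pderiv q) 0 / poly q 0"
    using \<open>x \<noteq> 0\<close> q0 unfolding q pderiv_mult by (simp add: pderiv_pCons field_simps)
  have "Im (- (1 / x)) < 0"
  proof -
    have "0 < (Re x)\<^sup>2 + (Im x)\<^sup>2" using x0 by (intro add_nonneg_pos) auto
    then show ?thesis using x0 by (simp add: Im_divide divide_less_0_iff)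
  qed
  moreover have "Im (poly (pderiv q) 0 / poly q 0) \<le> 0"
  proof (cases "degree q = 0")
    case True
    then show ?thesis by (metis degree_eq_zeroE div_0 complex.sel(2) order_refl pderiv_0 pderiv_pCons poly_0 add.right_neutral pCons_0_0 smult_0_right zero_complex.sel(2))
  next
    case False
    then show ?thesis using Suc.hyps(1)[of q] Suc.hyps(2) deg Suc.prems(1) by (force simp: q)
  qed
  ultimately show ?case unfolding eq by simp
qed

text \<open>Stability passes to derivatives as in the Gauss--Lucas theorem.\<close>
lemma polar_stable:
  fixes v :: "'a \<Rightarrow> complex"
  assumes "finite S" "length cs \<le> card S" "\<And>c r. c \<in> set cs \<Longrightarrow> r \<in> S \<Longrightarrow> 0 < c r"
    "\<And>r. r \<in> S \<Longrightarrow> 0 < Im (v r)"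
  shows "polar (map (\<lambda>c r. complex_of_real (c r)) cs) S v \<noteq> 0"
  using assms
proof (induction cs arbitrary: v)
  case Nil
  then show ?case by (fastforce simp: prod_zero_iff)
next
  case (Cons c cs)
  let ?cs = "map (\<lambda>c r. complex_of_real (c r)) cs"
  let ?c = "\<lambda>r. complex_of_real (c r)"
  define P where "P = polar_poly ?cs S v ?c"
  \<comment> \<open>For \<open>t\<close> with nonnegative imaginary part the point
    \<open>v + t * c\<close> stays in the upper half-plane, where the induction hypothesis excludes
    zeros.\<close>
  have "Im t < 0" if "poly P t = 0" for t
  proof (rule ccontr)
    assume "\<not> Im t < 0"
    then have "0 < Im (v r + t * ?c r)" if "r \<in> S" for r
      using Cons.prems(3)[of c r] Cons.prems(4)[OF that] that by (simp add: add_pos_nonneg)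
    then have "polar ?cs S (\<lambda>r. v r + t * ?c r) \<noteq> 0"
      using Cons.prems by (intro Cons.IH) auto
    with that show False by (simp add: P_def poly_polar_poly)
  qed
  moreover have "0 < degree P"
  proof -
    have "coeff P (card S - length cs) = of_real (polar cs S c)"
      using degree_coeff_polar_poly[of S ?cs v ?c] Cons.prems by (simp add: P_def polar_of_real)
    moreover have "0 < polar cs S c" using Cons.prems by (intro polar_pos) auto
    ultimately have "card S - length cs \<le> degree P" by (intro le_degree) simp
    then show ?thesis using Cons.prems by simp
  qed
  ultimately have "Im (poly (pderiv P) 0 / poly P 0) < 0" by (rule Im_pderiv_div_neg)
  then have "poly (pderiv P) 0 \<noteq> 0" by auto
  then show ?case using Cons.prems(1) by (simp add: P_def pderiv_polar_poly poly_polar_poly)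
qed

text \<open>The numbers \<open>r i\<close> are -1/z for the roots \<open>z\<close>. Normalising by
  the value at 0 makes their sum the logarithmic derivative at 0.\<close>

lemma negative_rooted_factor:
  fixes f :: "complex poly"
  assumes "\<forall>z. poly f z = 0 \<longrightarrow> z \<in> \<real> \<and> Re z < 0"
  shows "\<exists>r. (\<forall>i. 0 \<le> r i) \<and> (\<forall>t. poly f t = poly f 0 * (\<Prod>i<degree f. 1 + of_real (r i) * t)) \<and>
    poly (pderiv f) 0 = poly f 0 * (\<Sum>i<degree f. of_real (r i))"
  using assms
proof (induction "degree f" arbitrary: f)
  case 0
  then obtain c where "f = [:c:]" by (metis degree_eq_zeroE)
  then show ?case by (intro exI[of _ "\<lambda>_. 0"]) (simp add: pderiv_pCons)
next
  case (Suc n)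
  obtain z where z: "poly f z = 0"
    using fundamental_theorem_of_algebra[of f] Suc.hyps(2) by (auto simp: constant_degree)
  with Suc.prems have zr: "z \<in> \<real>" "Re z < 0" by auto
  define x where "x = Re z"
  have zx: "z = of_real x" using zr by (simp add: x_def)
  obtain q where q: "f = [:-of_real x, 1:] * q" using z by (auto simp: poly_eq_0_iff_dvd zx)
  have "q \<noteq> 0" using q Suc.hyps(2) by auto
  then have deg: "degree f = Suc (degree q)" unfolding q by (subst degree_mult_eq) auto
  have x0: "x < 0" using zr by (simp add: x_def)
  have qr: "\<forall>w. poly q w = 0 \<longrightarrow> w \<in> \<real> \<and> Re w < 0"
    using Suc.prems by (simp add: q)
  have "n = degree q" using deg Suc.hyps(2) by simp
  from Suc.hyps(1)[OF this qr] obtain r where r: "\<forall>i. 0 \<le> r i" "\<forall>t. poly q t = poly q 0 * (\<Prod>i<degree q. 1 + of_real (r i) * t)"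
    "poly (pderiv q) 0 = poly q 0 * (\<Sum>i<degree q. of_real (r i))"
    by (elim exE conjE)
  define r' where "r' i = (if i < degree q then r i else - 1 / x)" for i
  have f0: "poly f 0 = - of_real x * poly q 0" by (simp add: q)
  have last: "of_real (r' (degree q)) = - 1 / complex_of_real x" by (simp add: r'_def)
  have "poly f t = poly f 0 * (\<Prod>i<degree f. 1 + of_real (r' i) * t)" for t
  proof -
    have "poly f t = (t - of_real x) * (poly q 0 * (\<Prod>i<degree q. 1 + of_real (r i) * t))"
      using r(2)[rule_format, of t] by (simp add: q algebra_simps)
    moreover have "t - of_real x = - of_real x * (1 + of_real (r' (degree q)) * t)"
      using x0 unfolding last by (simp add: field_simps)
    moreover have "(\<Prod>i<degree q. 1 + of_real (r i) * t) = (\<Prod>i<degree q. 1 + of_real (r' i) * t)"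
      by (intro prod.cong) (auto simp: r'_def)
    ultimately show ?thesis unfolding deg f0 by (simp add: mult_ac)
  qed
  moreover have "poly (pderiv f) 0 = poly f 0 * (\<Sum>i<degree f. of_real (r' i))"
  proof -
    have "poly (pderiv f) 0 = poly q 0 - of_real x * (poly q 0 * (\<Sum>i<degree q. of_real (r i)))"
      unfolding q pderiv_mult using r(3) by (simp add: pderiv_pCons)
    moreover have "(\<Sum>i<degree q. complex_of_real (r i)) = (\<Sum>i<degree q. of_real (r' i))"
      by (intro sum.cong) (auto simp: r'_def)
    ultimately have "poly (pderiv f) 0 = poly q 0 - of_real x * (poly q 0 * (\<Sum>i<degree q. of_real (r' i)))"
      by simp
    then show ?thesis using x0 unfolding deg f0
      by (simp only: sum.lessThan_Suc last) (simp add: field_simps)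
  qed
  moreover have "\<forall>i. 0 \<le> r' i" using r(1) x0 by (auto simp: r'_def divide_nonneg_neg)
  ultimately show ?case by blast
qed

lemma prod_le_mean_power:
  fixes x :: "nat \<Rightarrow> real"
  assumes "\<And>i. i < n \<Longrightarrow> 0 \<le> x i"
  shows "(\<Prod>i<n. x i) \<le> ((\<Sum>i<n. x i) / n) ^ n"
proof (cases "n = 0")
  case False
  have nn: "0 \<le> prod x {..<n}" using assms by (intro prod_nonneg) auto
  have "prod x {..<n} powr (1 / real n) \<le> (\<Sum>i<n. x i / real n)"
    using arith_geom_mean[of "{..<n}" x] False assms by (auto simp: lessThan_empty_iff)
  then have "(prod x {..<n} powr (1 / real n)) ^ n \<le> ((\<Sum>i<n. x i) / n) ^ n"
    by (intro power_mono) (simp_all add: sum_divide_distrib)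
  moreover have "(prod x {..<n} powr (1 / real n)) ^ n = prod x {..<n}"
    using nn False by (cases "prod x {..<n} = 0") (simp_all add: abs_of_nonneg[OF nn] powr_powr flip: powr_realpow' powr_realpow)
  ultimately show ?thesis by simp
qed simp

text \<open>By stability the restriction to the line has only real roots, and by positivity they are
  negative. So it is a product of \<open>n\<close> factors \<open>1 + r i * t\<close> up to a
  constant; the arithmetic-geometric mean inequality replaces each factor by their mean, which the
  derivative at 0 determines.\<close>

lemma polar_line_le:
  fixes y z :: "'a \<Rightarrow> real"
  assumes "finite S" "length cs < card S" "\<And>c r. c \<in> set cs \<Longrightarrow> r \<in> S \<Longrightarrow> 0 < c r"
    "\<And>r. r \<in> S \<Longrightarrow> 0 < y r" "\<And>r. r \<in> S \<Longrightarrow> 0 < z r" "0 \<le> t" "n = card S - length cs"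
  shows "polar cs S (\<lambda>r. y r + t * z r) \<le>
    polar cs S y * (1 + t * polar (z # cs) S y / (n * polar cs S y)) ^ n"
proof -
  let ?C = "\<lambda>c r. complex_of_real (c r)"
  define f where "f = polar_poly (map ?C cs) S (?C y) (?C z)"
  define a where "a = polar cs S y"
  define b where "b = polar (z # cs) S y"
  have a0: "0 < a" unfolding a_def using assms by (intro polar_pos) auto
  have b0: "0 < b" unfolding b_def using assms by (intro polar_pos) auto
  have n0: "0 < n" using assms by simp
  have val: "poly f (of_real t) = of_real (polar cs S (\<lambda>r. y r + t * z r))" for t
    using polar_of_real[of cs S "\<lambda>r. y r + t * z r"] by (simp add: f_def poly_polar_poly)
  have fa: "poly f 0 = of_real a" using val[of 0] by (simp add: a_def)
  have fb: "poly (pderiv f) 0 = of_real b"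
    using polar_of_real[of "z # cs" S y] assms(1) by (simp add: f_def b_def pderiv_polar_poly poly_polar_poly)
  have roots: "w \<in> \<real> \<and> Re w < 0" if w: "poly f w = 0" for w
  proof -
    have upper: "Im u \<le> 0" if "poly f u = 0" for u
    proof (rule ccontr)
      assume "\<not> Im u \<le> 0"
      then have "polar (map ?C cs) S (\<lambda>r. ?C y r + u * ?C z r) \<noteq> 0"
        using assms by (intro polar_stable) auto
      with that show False by (simp add: f_def poly_polar_poly)
    qed
    have cnj: "cnj (polar (map ?C cs) S v) = polar (map ?C cs) S (\<lambda>r. cnj (v r))" for v
      by (induction cs arbitrary: S) auto
    have "poly f (cnj w) = cnj (poly f w)" by (simp add: f_def poly_polar_poly cnj)
    then have "poly f (cnj w) = 0" using w by simp
    with upper[OF w] upper[of "cnj w"] have "Im w = 0" by simp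
    then have wr: "w = of_real (Re w)" by (simp add: complex_eq_iff)
    have "Re w < 0"
    proof (rule ccontr)
      assume "\<not> Re w < 0"
      then have "0 < polar cs S (\<lambda>r. y r + Re w * z r)"
        using assms by (intro polar_pos add_pos_nonneg) (auto intro!: mult_nonneg_nonneg less_imp_le[OF assms(5)])
      with w val[of "Re w"] wr show False by simp
    qed
    with wr show ?thesis by (metis Reals_of_real)
  qed
  have "degree f \<le> n"
    using degree_coeff_polar_poly[of S "map ?C cs"] assms by (simp add: f_def)
  moreover have "n \<le> degree f"
  proof (rule le_degree)
    have "coeff f n = of_real (polar cs S z)"
      using degree_coeff_polar_poly[of S "map ?C cs" "?C y" "?C z"] assms by (simp add: f_def polar_of_real)
    moreover have "0 < polar cs S z" using assms by (intro polar_pos) auto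
    ultimately show "coeff f n \<noteq> 0" by simp
  qed
  ultimately have deg: "degree f = n" by simp
  have "\<forall>w. poly f w = 0 \<longrightarrow> w \<in> \<real> \<and> Re w < 0" using roots by blast
  from negative_rooted_factor[OF this, unfolded deg]
  obtain r where r: "\<forall>i. 0 \<le> r i" "\<forall>t. poly f t = poly f 0 * (\<Prod>i<n. 1 + of_real (r i) * t)"
    "poly (pderiv f) 0 = poly f 0 * (\<Sum>i<n. of_real (r i))"
    by (elim exE conjE)
  have "complex_of_real b = of_real (a * (\<Sum>i<n. r i))" using r(3) by (simp add: fa fb)
  then have b: "b = a * (\<Sum>i<n. r i)" by (simp only: of_real_eq_iff)
  have "complex_of_real (polar cs S (\<lambda>r. y r + t * z r)) = of_real (a * (\<Prod>i<n. 1 + r i * t))"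
    using r(2)[rule_format, of "of_real t"] by (simp add: fa val)
  then have "polar cs S (\<lambda>r. y r + t * z r) = a * (\<Prod>i<n. 1 + r i * t)" by (simp only: of_real_eq_iff)
  also have "\<dots> \<le> a * ((\<Sum>i<n. 1 + r i * t) / n) ^ n"
    using a0 assms(6) r(1) by (intro mult_left_mono prod_le_mean_power) auto
  also have "(\<Sum>i<n. 1 + r i * t) / n = 1 + t * b / (n * a)"
    using n0 a0 by (simp add: sum.distrib b field_simps sum_distrib_left)
  finally show ?thesis by (simp add: a_def b_def)
qed

section \<open>Gurvits' capacity bound\<close>

lemma linear_coeff_ge:
  fixes a b C :: real
  assumes "\<And>t. 0 < t \<Longrightarrow> C * t \<le> a + b * t"
  shows "C \<le> b"
proof (rule ccontr)
  assume "\<not> C \<le> b"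
  then have pos: "0 < C - b" by simp
  let ?t = "(\<bar>a\<bar> + 1) / (C - b)"
  have "0 < ?t" using pos by (intro divide_pos_pos) auto
  from assms[OF this] have "(C - b) * ?t \<le> a" unfolding left_diff_distrib by linarith
  then show False using pos by simp
qed

text \<open>The hypothesis bounds \<open>C\<close> by the infimum of the right side divided by
  \<open>t\<close>. For \<open>n = 1\<close> this is a limit as \<open>t\<close> grows, otherwise it
  is attained.\<close>

lemma power_coeff_ge:
  fixes a b C :: real
  assumes "0 < a" "0 < b" "0 < n" "\<And>t. 0 < t \<Longrightarrow> C * t \<le> a * (1 + t * b / (real n * a)) ^ n"
  shows "C * ((real n - 1) / real n) ^ (n - 1) \<le> b"
proof (cases "n = 1")
  case True
  have "C * t \<le> a + b * t" if "0 < t" for t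
  proof -
    have "a * (1 + t * b / (real n * a)) ^ n = a + b * t" using assms(1) True by (simp add: field_simps)
    with assms(4)[OF that] show ?thesis by simp
  qed
  then show ?thesis using True linear_coeff_ge[of C a b] by simp
next
  case False
  then obtain m where m: "n = Suc m" "0 < m" using assms(3) by (cases n) auto
  \<comment> \<open>The minimiser of \<open>(1 + t * b / (n * a)) ^ n / t\<close>; there the base of
    the power is \<open>n / (n - 1)\<close>.\<close>
  let ?t = "real n * a / (b * m)"
  have t: "0 < ?t" using assms m by simp
  have "?t * b / (real n * a) = 1 / m" using assms(1-3) m(2) by simp
  then have "1 + ?t * b / (real n * a) = real n / m" using m by (simp add: field_simps)
  with assms(4)[OF t] have "C * ?t \<le> a * (real n / m) ^ n" by simp
  then have "C * ?t * (m / n) ^ n \<le> a * (real n / m) ^ n * (m / n) ^ n"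
    by (intro mult_right_mono) auto
  also have "a * (real n / m) ^ n * (m / n) ^ n = a"
    using m by (simp flip: power_mult_distrib add: mult.assoc)
  also have "C * ?t * (m / n) ^ n = C * (real m / n) ^ m * a / b"
  proof -
    have "(real m / n) ^ n = (real m / n) ^ m * (m / n)" by (simp add: m)
    moreover have "?t * (m / n) = a / b" using m assms(3) by simp
    ultimately show ?thesis by (metis mult.assoc mult.commute times_divide_eq_right)
  qed
  finally have "C * (real m / n) ^ m * a \<le> b * a"
    using assms(1,2) by (simp only: pos_divide_le_eq mult.commute[of a b])
  then have "C * (real m / n) ^ m \<le> b" using assms(1) by (simp only: mult_le_cancel_right_pos)
  then show ?thesis by (simp add: m)
qed

definition list_comb :: "real list \<Rightarrow> ('a \<Rightarrow> real) list \<Rightarrow> 'a \<Rightarrow> real"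
  where "list_comb xs ds r = (\<Sum>(x, d)\<leftarrow>zip xs ds. x * d r)"

lemma list_comb_simps:
  "list_comb [] ds r = 0" "list_comb xs [] r = 0"
  "list_comb (x # xs) (d # ds) r = list_comb xs ds r + x * d r"
  by (simp_all add: list_comb_def)

lemma list_comb_pos:
  "\<lbrakk>length xs = length ds; ds \<noteq> []; \<And>x. x \<in> set xs \<Longrightarrow> 0 < x; \<And>d. d \<in> set ds \<Longrightarrow> 0 < d r\<rbrakk>
    \<Longrightarrow> 0 < list_comb xs ds r"
proof (induction xs ds rule: list_induct2)
  case (Cons x xs d ds)
  then show ?case by (cases ds) (auto simp: list_comb_simps intro!: add_pos_pos)
qed (simp add: list_comb_simps)

text \<open>One step of Gurvits' capacity argument: fixing the column \<open>d\<close> loses at most the factor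
  \<open>((n - 1) / n)\<^sup>n\<^sup>-\<^sup>1\<close>.\<close>
lemma capacity_step:
  assumes "finite S" "length cs + length ds + 1 = card S"
    and pos: "\<And>c r. c \<in> set (cs @ d # ds) \<Longrightarrow> r \<in> S \<Longrightarrow> 0 < c r"
    and cap: "\<And>xs. length xs = Suc (length ds) \<Longrightarrow> (\<And>x. x \<in> set xs \<Longrightarrow> 0 < x) \<Longrightarrow>
      C * prod_list xs \<le> polar cs S (list_comb xs (d # ds))"
    and xs: "length xs = length ds" "\<And>x. x \<in> set xs \<Longrightarrow> 0 < x"
  shows "C * (real (length ds) / Suc (length ds)) ^ length ds * prod_list xs \<le> polar (d # cs) S (list_comb xs ds)"
proof -
  define y where "y = list_comb xs ds"
  have cap': "C * prod_list xs * t \<le> polar cs S (\<lambda>r. y r + t * d r)" if "0 < t" for t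
    using cap[of "t # xs"] xs that by (auto simp: y_def list_comb_simps[abs_def] mult_ac)
  show ?thesis
  proof (cases "ds = []")
    \<comment> \<open>Without remaining columns \<open>y\<close> is 0, so
      \<open>polar_line_le\<close>, which asks for positive \<open>y\<close>, cannot be applied. But
      then the polynomial in \<open>t\<close> is affine and its slope can be bounded
      directly.\<close>
    case True
    have deg: "degree (polar_poly cs S y d) \<le> 1" using degree_coeff_polar_poly[of S cs y d] assms(1,2) True
      by (simp flip: assms(2))
    define a where "a = coeff (polar_poly cs S y d) 0"
    define b where "b = coeff (polar_poly cs S y d) 1"
    have ab: "polar_poly cs S y d = [:a, b:]"
      using deg unfolding a_def b_def
      by (intro poly_eqI) (auto simp: coeff_pCons coeff_eq_0 split: nat.splits)
    have "C * t \<le> a + b * t" if "0 < t" for t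
    proof -
      have "polar cs S (\<lambda>r. y r + t * d r) = a + b * t"
        using poly_polar_poly[of cs S y d t] unfolding ab by (simp add: mult.commute)
      moreover have "prod_list xs = 1" using True xs by simp
      ultimately show ?thesis using cap'[OF that] by simp
    qed
    then have "C \<le> b" by (rule linear_coeff_ge)
    also have "b = polar (d # cs) S y"
    proof -
      have "[:b:] = polar_poly (d # cs) S y d"
        using pderiv_polar_poly[OF assms(1), of cs y d] by (simp add: ab pderiv_pCons)
      then have "poly [:b:] 0 = poly (polar_poly (d # cs) S y d) 0" by (rule arg_cong)
      then show ?thesis by (simp only: poly_polar_poly) simp
    qed
    finally show ?thesis using True xs by (simp add: y_def)
  next
    case False
    have ypos: "0 < y r" if "r \<in> S" for r
      unfolding y_def using xs False pos that by (intro list_comb_pos) auto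
    have dpos: "0 < d r" if "r \<in> S" for r using pos that by simp
    have "C * prod_list xs * ((real (Suc (length ds)) - 1) / real (Suc (length ds))) ^ (Suc (length ds) - 1)
        \<le> polar (d # cs) S y"
    proof (rule power_coeff_ge)
      show "0 < polar cs S y" "0 < polar (d # cs) S y"
        using assms(1,2) ypos pos by (intro polar_pos; auto)+
      fix t :: real assume t: "0 < t"
      have "polar cs S (\<lambda>r. y r + t * d r) \<le>
          polar cs S y * (1 + t * polar (d # cs) S y / (real (Suc (length ds)) * polar cs S y)) ^ Suc (length ds)"
        using assms(1,2) ypos dpos pos t by (intro polar_line_le) auto
      with cap'[OF t] show "C * prod_list xs * t \<le>
          polar cs S y * (1 + t * polar (d # cs) S y / (real (Suc (length ds)) * polar cs S y)) ^ Suc (length ds)"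
        by linarith
    qed simp
    then show ?thesis by (simp add: y_def mult_ac)
  qed
qed

lemma fact_power_Suc:
  "(fact (Suc n) / real (Suc n) ^ Suc n :: real) = fact n / real n ^ n * (real n / Suc n) ^ n"
  by (cases "n = 0") (simp_all add: power_divide)

text \<open>\<open>C\<close> bounds from below the capacity, the infimum of p(x) divided by the
  product of the x. The columns move one by one from \<open>ds\<close> to the directions, and by
  \<open>fact_power_Suc\<close> the losses telescope to n!/n^n. The final point 0 is an arbitrary
  choice.\<close>

lemma capacity_bound:
  assumes "finite S" "length cs + length ds = card S"
    and "\<And>c r. c \<in> set (cs @ ds) \<Longrightarrow> r \<in> S \<Longrightarrow> 0 < c r"
    and "\<And>xs. length xs = length ds \<Longrightarrow> (\<And>x. x \<in> set xs \<Longrightarrow> 0 < x) \<Longrightarrow>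
      C * prod_list xs \<le> polar cs S (list_comb xs ds)"
  shows "C * (fact (length ds) / real (length ds) ^ length ds) \<le> polar (rev ds @ cs) S (\<lambda>_. 0)"
  using assms
proof (induction ds arbitrary: cs C)
  case Nil
  then show ?case by (simp add: list_comb_simps[abs_def])
next
  case (Cons d ds)
  let ?C = "C * (real (length ds) / Suc (length ds)) ^ length ds"
  have step: "?C * prod_list xs \<le> polar (d # cs) S (list_comb xs ds)"
    if "length xs = length ds" "\<And>x. x \<in> set xs \<Longrightarrow> 0 < x" for xs
  proof (rule capacity_step[OF Cons.prems(1) _ _ _ that])
    show "length cs + length ds + 1 = card S" using Cons.prems(2) by simp
    show "0 < c r" if "c \<in> set (cs @ d # ds)" "r \<in> S" for c r using Cons.prems(3) that by blast
    show "C * prod_list xs \<le> polar cs S (list_comb xs (d # ds))"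
      if "length xs = Suc (length ds)" "\<And>x. x \<in> set xs \<Longrightarrow> 0 < x" for xs
      by (rule Cons.prems(4)) (use that in auto)
  qed
  have "?C * (fact (length ds) / real (length ds) ^ length ds) \<le> polar (rev ds @ d # cs) S (\<lambda>_. 0)"
  proof (rule Cons.IH[OF Cons.prems(1)])
    show "length (d # cs) + length ds = card S" using Cons.prems(2) by simp
    show "0 < c r" if "c \<in> set ((d # cs) @ ds)" "r \<in> S" for c r using Cons.prems(3)[of c r] that by auto
  qed (rule step)
  moreover have "C * (fact (length (d # ds)) / real (length (d # ds)) ^ length (d # ds)) =
      ?C * (fact (length ds) / real (length ds) ^ length ds)"
    unfolding length_Cons fact_power_Suc by (simp only: mult_ac)
  ultimately show ?case by simp
qed

text \<open>The capacity argument is for positive entries; a 0/1 matrix is reached by adding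
  \<open>e > 0\<close> everywhere and letting it tend to 0.\<close>

lemma tendsto_polar:
  fixes A :: "'j \<Rightarrow> 'a \<Rightarrow> real"
  shows "((\<lambda>e. polar (map (\<lambda>j r. A j r + e) js) S v) \<longlongrightarrow> polar (map A js) S v) (at_right 0)"
proof (induction js arbitrary: S)
  case (Cons j js)
  have "((\<lambda>e. A j r + e) \<longlongrightarrow> A j r) (at_right 0)" for r
    by (rule tendsto_eq_intros refl)+ simp
  then show ?case by (auto intro!: tendsto_sum tendsto_mult Cons.IH)
qed simp

section \<open>Perfect matchings of regular bipartite graphs\<close>

definition matchings :: "('j \<Rightarrow> 'a \<Rightarrow> bool) \<Rightarrow> 'j set \<Rightarrow> 'a set \<Rightarrow> ('j \<Rightarrow> 'a) set"
  where "matchings P J S = {f \<in> J \<rightarrow>\<^sub>E S. inj_on f J \<and> (\<forall>j\<in>J. P j (f j))}"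

lemma matchings_insert:
  assumes "j \<notin> J"
  shows "matchings P (insert j J) S = (\<Union>r\<in>{r\<in>S. P j r}. (\<lambda>f. f(j := r)) ` matchings P J (S - {r}))"
proof (intro equalityI subsetI)
  fix f assume f: "f \<in> matchings P (insert j J) S"
  then have fj: "f j \<in> S" "P j (f j)" by (auto simp: matchings_def)
  have "f(j := undefined) \<in> matchings P J (S - {f j})"
    unfolding matchings_def
  proof (intro CollectI conjI ballI)
    have "f k \<noteq> f j" if "k \<in> J" for k
      using f assms that unfolding matchings_def inj_on_def by blast
    then show "f(j := undefined) \<in> J \<rightarrow>\<^sub>E S - {f j}"
      using f assms by (auto simp: matchings_def PiE_iff extensional_def)
    show "inj_on (f(j := undefined)) J"
      using f assms by (auto simp: matchings_def inj_on_def)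
    show "P k ((f(j := undefined)) k)" if "k \<in> J" for k
      using f assms that by (auto simp: matchings_def)
  qed
  moreover have "f = (f(j := undefined))(j := f j)" by simp
  ultimately show "f \<in> (\<Union>r\<in>{r\<in>S. P j r}. (\<lambda>f. f(j := r)) ` matchings P J (S - {r}))"
    using fj by blast
next
  fix f assume "f \<in> (\<Union>r\<in>{r\<in>S. P j r}. (\<lambda>f. f(j := r)) ` matchings P J (S - {r}))"
  then obtain r g where "r \<in> S" "P j r" "g \<in> matchings P J (S - {r})" "f = g(j := r)" by auto
  with assms show "f \<in> matchings P (insert j J) S"
    unfolding matchings_def by (auto simp: PiE_iff extensional_def inj_on_def)
qed

lemma finite_matchings: "finite J \<Longrightarrow> finite S \<Longrightarrow> finite (matchings P J S)"
  unfolding matchings_def by (rule finite_subset[OF _ finite_PiE[of J "\<lambda>_. S"]]) auto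

lemma card_matchings_insert:
  assumes "finite J" "finite S" "j \<notin> J"
  shows "card (matchings P (insert j J) S) = (\<Sum>r\<in>{r\<in>S. P j r}. card (matchings P J (S - {r})))"
proof -
  have "card (matchings P (insert j J) S) =
      (\<Sum>r\<in>{r\<in>S. P j r}. card ((\<lambda>f. f(j := r)) ` matchings P J (S - {r})))"
    unfolding matchings_insert[OF assms(3)]
  proof (rule card_UN_disjoint)
    show "\<forall>r\<in>{r\<in>S. P j r}. \<forall>r'\<in>{r\<in>S. P j r}. r \<noteq> r' \<longrightarrow>
      (\<lambda>f. f(j := r)) ` matchings P J (S - {r}) \<inter> (\<lambda>f. f(j := r')) ` matchings P J (S - {r'}) = {}"
      by (auto dest!: fun_cong[where x = j])
  qed (use assms in \<open>auto simp: finite_matchings\<close>)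
  also have "\<dots> = (\<Sum>r\<in>{r\<in>S. P j r}. card (matchings P J (S - {r})))"
  proof (intro sum.cong refl card_image inj_onI)
    fix r f g assume "f \<in> matchings P J (S - {r})" "g \<in> matchings P J (S - {r})" and e: "f(j := r) = g(j := r)"
    then have "f j = g j" using assms(3) by (auto simp: matchings_def PiE_iff extensional_def)
    with e show "f = g" by (metis fun_upd_triv fun_upd_upd)
  qed
  finally show ?thesis .
qed

lemma polar_eq_card_matchings:
  assumes "finite S" "distinct js" "length js = card S"
  shows "polar (map (\<lambda>j r. of_bool (P j r)) js) S v = real (card (matchings P (set js) S))"
  using assms
proof (induction js arbitrary: S)
  case Nil
  then show ?case by (simp add: matchings_def)
next
  case (Cons j js)
  have "polar (map (\<lambda>j r. of_bool (P j r)) (j # js)) S v =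
      (\<Sum>r\<in>S. of_bool (P j r) * real (card (matchings P (set js) (S - {r}))))"
    using Cons.prems by (auto intro!: sum.cong Cons.IH)
  also have "\<dots> = (\<Sum>r\<in>{r\<in>S. P j r}. real (card (matchings P (set js) (S - {r}))))"
    using Cons.prems(1) by (intro sum.mono_neutral_cong_right) auto
  also have "\<dots> = real (card (matchings P (set (j # js)) S))"
    using Cons.prems by (simp add: card_matchings_insert)
  finally show ?case .
qed

text \<open>The capacity is at least k^n: in each row the arithmetic-geometric mean inequality
  applies to \<open>k\<close> terms, and over all rows each \<open>x j\<close> occurs
  \<open>k\<close> times with exponent 1/k.\<close>

lemma prod_sum_ge_regular:
  fixes x :: "'j \<Rightarrow> real"
  assumes "finite J" "finite S" "0 < k" "card S = n"
    and row: "\<And>r. r \<in> S \<Longrightarrow> card {j\<in>J. P j r} = k"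
    and col: "\<And>j. j \<in> J \<Longrightarrow> card {r\<in>S. P j r} = k"
    and x: "\<And>j. j \<in> J \<Longrightarrow> 0 < x j"
  shows "real k ^ n * (\<Prod>j\<in>J. x j) \<le> (\<Prod>r\<in>S. \<Sum>j\<in>{j\<in>J. P j r}. x j)"
proof -
  have row_le: "k * (\<Prod>j\<in>{j\<in>J. P j r}. x j powr (1 / k)) \<le> (\<Sum>j\<in>{j\<in>J. P j r}. x j)" if "r \<in> S" for r
  proof -
    have "(\<Prod>j\<in>{j\<in>J. P j r}. x j) powr (1 / k) \<le> (\<Sum>j\<in>{j\<in>J. P j r}. x j / k)"
      using arith_geom_mean[of "{j\<in>J. P j r}" x] row[OF that] assms(1,3) x
      by (fastforce simp: less_imp_le)
    also have "\<dots> = (\<Sum>j\<in>{j\<in>J. P j r}. x j) / k" by (simp add: sum_divide_distrib)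
    finally show ?thesis
      using assms(3) x by (subst prod_powr_distrib[symmetric]) (auto simp: field_simps less_imp_le)
  qed
  have "(\<Prod>r\<in>S. \<Prod>j\<in>{j\<in>J. P j r}. x j powr (1 / k)) = (\<Prod>r\<in>S. \<Prod>j\<in>J. if P j r then x j powr (1 / k) else 1)"
    using assms(1) by (intro prod.cong refl prod.mono_neutral_cong_left) auto
  also have "\<dots> = (\<Prod>j\<in>J. \<Prod>r\<in>S. if P j r then x j powr (1 / k) else 1)" by (rule prod.swap)
  also have "\<dots> = (\<Prod>j\<in>J. \<Prod>r\<in>{r\<in>S. P j r}. x j powr (1 / k))"
    using assms(2) by (intro prod.cong refl prod.mono_neutral_cong_right) auto
  also have "\<dots> = (\<Prod>j\<in>J. x j)"
  proof (intro prod.cong refl)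
    fix j assume j: "j \<in> J"
    have "(x j powr (1 / k)) ^ k = x j" using x[OF j] assms(3)
      by (simp add: powr_powr flip: powr_realpow)
    then show "(\<Prod>r\<in>{r\<in>S. P j r}. x j powr (1 / k)) = x j" by (simp add: col[OF j])
  qed
  finally have "real k ^ n * (\<Prod>j\<in>J. x j) = (\<Prod>r\<in>S. k * (\<Prod>j\<in>{j\<in>J. P j r}. x j powr (1 / k)))"
    by (simp add: prod.distrib assms(4))
  also have "\<dots> \<le> (\<Prod>r\<in>S. \<Sum>j\<in>{j\<in>J. P j r}. x j)"
    using row_le by (intro prod_mono conjI mult_nonneg_nonneg prod_nonneg) auto
  finally show ?thesis .
qed

text \<open>Van der Waerden's inequality for regular bipartite graphs.\<close>
theorem card_matchings_ge:
  fixes P :: "'j \<Rightarrow> 'a \<Rightarrow> bool"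
  assumes "finite J" "finite S" "card J = n" "card S = n" "0 < k"
    and row: "\<And>r. r \<in> S \<Longrightarrow> card {j\<in>J. P j r} = k"
    and col: "\<And>j. j \<in> J \<Longrightarrow> card {r\<in>S. P j r} = k"
  shows "fact n * (real k / n) ^ n \<le> card (matchings P J S)"
proof -
  obtain js where js: "set js = J" "distinct js" using finite_distinct_list[OF assms(1)] by blast
  have len: "length js = n" using js assms(3) distinct_card by force
  let ?A = "\<lambda>j r. of_bool (P j r) :: real"
  have bound: "real k ^ n * (fact n / real n ^ n) \<le> polar (map (\<lambda>j r. ?A j r + e) (rev js)) S (\<lambda>_. 0)"
    if e: "0 < e" for e
  proof -
    let ?ds = "map (\<lambda>j r. ?A j r + e) js"
    have "real k ^ n * (fact (length ?ds) / real (length ?ds) ^ length ?ds) \<le> polar (rev ?ds @ []) S (\<lambda>_. 0)"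
    proof (rule capacity_bound)
      show "real k ^ n * prod_list xs \<le> polar [] S (list_comb xs ?ds)"
        if xs: "length xs = length ?ds" "\<And>x. x \<in> set xs \<Longrightarrow> 0 < x" for xs
      proof -
        define X where "X j = the (map_of (zip js xs) j)" for j
        have "xs = map X js"
        proof (rule nth_equalityI)
          show "xs ! i = map X js ! i" if "i < length xs" for i
            using that xs(1) js(2) by (simp add: X_def map_of_zip_nth)
        qed (use xs in simp)
        note xs_eq = this
        have Xpos: "0 < X j" if "j \<in> J" for j using xs(2)[of "X j"] that js(1) by (simp add: xs_eq)
        have comb: "list_comb xs ?ds r = (\<Sum>j\<in>J. X j * (?A j r + e))" for r
        proof -
          have "list_comb (map X ks) (map (\<lambda>j r. ?A j r + e) ks) r = (\<Sum>j\<leftarrow>ks. X j * (?A j r + e))" for ks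
            by (induction ks) (simp_all add: list_comb_simps)
          then show ?thesis using js by (simp add: xs_eq sum_list_distinct_conv_sum_set)
        qed
        have "real k ^ n * prod_list xs = real k ^ n * (\<Prod>j\<in>J. X j)"
          using prod.distinct_set_conv_list[OF js(2), of X] js(1) by (simp add: xs_eq)
        also have "\<dots> \<le> (\<Prod>r\<in>S. \<Sum>j\<in>{j\<in>J. P j r}. X j)"
          using assms Xpos by (intro prod_sum_ge_regular) auto
        also have "\<dots> \<le> (\<Prod>r\<in>S. list_comb xs ?ds r)"
        proof (intro prod_mono conjI sum_nonneg)
          fix r assume "r \<in> S"
          have "(\<Sum>j\<in>{j\<in>J. P j r}. X j) = (\<Sum>j\<in>J. X j * ?A j r)"
            using assms(1) by (intro sum.mono_neutral_cong_left) auto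
          also have "\<dots> \<le> list_comb xs ?ds r"
            unfolding comb using Xpos e by (intro sum_mono mult_left_mono) (auto simp: less_imp_le)
          finally show "(\<Sum>j\<in>{j\<in>J. P j r}. X j) \<le> list_comb xs ?ds r" .
        qed (use Xpos in \<open>auto simp: less_imp_le\<close>)
        finally show ?thesis by simp
      qed
    qed (use assms len e in \<open>auto simp: add_nonneg_pos\<close>)
    then show ?thesis by (simp add: len rev_map)
  qed
  have "real k ^ n * (fact n / real n ^ n) \<le> polar (map ?A (rev js)) S (\<lambda>_. 0)"
  proof (rule tendsto_lowerbound[OF tendsto_polar])
    show "\<forall>\<^sub>F e in at_right 0. real k ^ n * (fact n / real n ^ n) \<le>
        polar (map (\<lambda>j r. ?A j r + e) (rev js)) S (\<lambda>_. 0)"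
      using bound by (simp add: eventually_at_filter)
  qed simp
  also have "\<dots> = card (matchings P J S)"
    using js len assms(2,4) by (subst polar_eq_card_matchings) auto
  finally show ?thesis by (simp add: power_divide mult.commute)
qed

section \<open>Counting Latin squares layer by layer\<close>

text \<open>Latin rectangles, as lists of their rows.\<close>
definition disjoint_perms :: "nat \<Rightarrow> ('n \<Rightarrow> 'n) list set"
  where "disjoint_perms m = {ps. length ps = m \<and> (\<forall>p\<in>set ps. bij p) \<and>
    (\<forall>j. distinct (map (\<lambda>p. p j) ps))}"

lemma finite_disjoint_perms: "finite (disjoint_perms m :: ('n::finite \<Rightarrow> 'n) list set)"
  by (rule finite_subset[OF _ finite_lists_length_eq[of UNIV m]]) (auto simp: disjoint_perms_def)

lemma card_Compl_finite: "card (- A) = CARD('a::finite) - card (A :: 'a set)"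
  by (simp add: Compl_eq_Diff_UNIV card_Diff_subset)

text \<open>The cells avoided by \<open>m\<close> disjoint permutations form an (n - m)-regular
  bipartite graph, and its perfect matchings are exactly the permutations that can be added.\<close>

lemma card_disjoint_perms_Suc:
  assumes "m < CARD('n::finite)"
  shows "card (disjoint_perms m :: ('n \<Rightarrow> 'n) list set) *
      (fact CARD('n) * (real (CARD('n) - m) / CARD('n)) ^ CARD('n)) \<le>
    card (disjoint_perms (Suc m) :: ('n \<Rightarrow> 'n) list set)"
proof -
  let ?P = "\<lambda>ps j r. r \<notin> (\<lambda>p. p j) ` set ps" and ?n = "CARD('n)"
  let ?M = "\<lambda>ps. matchings (?P ps) UNIV UNIV :: ('n \<Rightarrow> 'n) set"
  have le: "fact ?n * (real (?n - m) / ?n) ^ ?n \<le> card (?M ps)" if ps: "ps \<in> disjoint_perms m" for ps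
  proof (rule card_matchings_ge)
    have dist: "distinct ps"
    proof -
      have "distinct (map (\<lambda>p. p undefined) ps)" using ps by (auto simp: disjoint_perms_def)
      then show ?thesis by (simp add: distinct_map)
    qed
    fix j r :: 'n
    have "{r \<in> UNIV. ?P ps j r} = - set (map (\<lambda>p. p j) ps)" by auto
    moreover have "card (set (map (\<lambda>p. p j) ps)) = m"
      using ps by (subst distinct_card) (auto simp: disjoint_perms_def)
    ultimately show "card {r \<in> UNIV. ?P ps j r} = ?n - m" by (simp add: card_Compl_finite)
    have bij: "bij p" if "p \<in> set ps" for p using ps that by (simp add: disjoint_perms_def)
    \<comment> \<open>The positions at which \<open>r\<close> is used are the
      \<open>inv p r\<close>. They are distinct, because two permutations of the list never agree at
      a point.\<close>
    have "r \<in> (\<lambda>p. p j) ` set ps \<longleftrightarrow> j \<in> (\<lambda>p. inv p r) ` set ps" for j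
      unfolding image_iff using bij bij_inv_eq_iff by metis
    then have "{j \<in> UNIV. ?P ps j r} = - ((\<lambda>p. inv p r) ` set ps)" by blast
    moreover have "card ((\<lambda>p. inv p r) ` set ps) = m"
    proof -
      have "inj_on (\<lambda>p. inv p r) (set ps)"
      proof (rule inj_onI)
        fix p q assume pq: "p \<in> set ps" "q \<in> set ps" "inv p r = inv q r"
        let ?j = "inv p r"
        have "p ?j = r" "q ?j = r" using bij pq by (metis bij_inv_eq_iff)+
        moreover have "inj_on (\<lambda>p. p ?j) (set ps)"
          using ps by (auto simp: disjoint_perms_def distinct_map)
        ultimately show "p = q" using pq(1,2) unfolding inj_on_def by metis
      qed
      then have "card ((\<lambda>p. inv p r) ` set ps) = card (set ps)" by (rule card_image)
      then show ?thesis using dist ps by (simp add: distinct_card disjoint_perms_def)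
    qed
    ultimately show "card {j \<in> UNIV. ?P ps j r} = ?n - m" by (simp add: card_Compl_finite)
  qed (use assms in auto)
  have "(\<lambda>(ps, p). p # ps) ` (SIGMA ps:disjoint_perms m. ?M ps) \<subseteq> disjoint_perms (Suc m)"
  proof (clarify)
    fix ps p assume ps: "ps \<in> disjoint_perms m" and p: "p \<in> ?M ps"
    then have "inj p" by (simp add: matchings_def)
    then have "bij p" by (simp add: bij_def finite_UNIV_inj_surj)
    with ps p show "p # ps \<in> disjoint_perms (Suc m)"
      by (auto simp: disjoint_perms_def matchings_def)
  qed
  then have "card ((\<lambda>(ps, p). p # ps) ` (SIGMA ps:disjoint_perms m. ?M ps)) \<le>
      card (disjoint_perms (Suc m) :: ('n \<Rightarrow> 'n) list set)"
    by (intro card_mono finite_disjoint_perms)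
  moreover have "card ((\<lambda>(ps, p). p # ps) ` (SIGMA ps:disjoint_perms m. ?M ps)) =
      (\<Sum>ps\<in>disjoint_perms m. card (?M ps))"
    by (subst card_image) (auto simp: inj_on_def finite_disjoint_perms)
  moreover have "card (disjoint_perms m :: ('n \<Rightarrow> 'n) list set) *
      (fact ?n * (real (?n - m) / ?n) ^ ?n) \<le> (\<Sum>ps\<in>disjoint_perms m. real (card (?M ps)))"
    using sum_mono[OF le] by simp
  ultimately show ?thesis by (simp flip: of_nat_sum)
qed

lemma card_disjoint_perms_ge:
  assumes "m \<le> CARD('n::finite)"
  shows "(\<Prod>i<m. fact CARD('n) * (real (CARD('n) - i) / CARD('n)) ^ CARD('n)) \<le>
    card (disjoint_perms m :: ('n \<Rightarrow> 'n) list set)"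
  using assms
proof (induction m)
  case 0
  have "disjoint_perms 0 = {[] :: ('n \<Rightarrow> 'n) list}" by (auto simp: disjoint_perms_def)
  then show ?case by simp
next
  case (Suc m)
  have "(\<Prod>i<Suc m. fact CARD('n) * (real (CARD('n) - i) / CARD('n)) ^ CARD('n)) \<le>
      card (disjoint_perms m :: ('n \<Rightarrow> 'n) list set) *
      (fact CARD('n) * (real (CARD('n) - m) / CARD('n)) ^ CARD('n))"
    using Suc by (simp only: prod.lessThan_Suc) (intro mult_right_mono, auto)
  also have "\<dots> \<le> card (disjoint_perms (Suc m) :: ('n \<Rightarrow> 'n) list set)"
    using Suc.prems by (intro card_disjoint_perms_Suc) simp
  finally show ?case .
qed

lemma card_latin_ge:
  "fact CARD('n) ^ (2 * CARD('n)) / real CARD('n) ^ (CARD('n)^2) \<le>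
    card (disjoint_perms CARD('n) :: ('n::finite \<Rightarrow> 'n) list set)"
proof -
  let ?n = "CARD('n)"
  have "(\<Prod>i<?n. real (?n - i)) = fact ?n"
    by (subst prod.nat_diff_reindex[symmetric]) (auto simp: fact_prod_Suc atLeast0LessThan intro!: prod.cong)
  then have "(\<Prod>i<?n. fact ?n * (real (?n - i) / ?n) ^ ?n) = fact ?n ^ ?n * (fact ?n / real ?n ^ ?n) ^ ?n"
    by (simp only: prod.distrib prod_power_distrib[symmetric] prod_dividef prod_constant card_lessThan)
  also have "\<dots> = fact ?n ^ (2 * ?n) / real ?n ^ (?n^2)"
    by (simp add: power_divide power_mult power2_eq_square mult_2 power_add)
  finally show ?thesis using card_disjoint_perms_ge[of ?n, where 'n = 'n] by simp
qed

lemma zero_one_stochastic_vertex: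
  assumes x: "x \<in> stochastic_hypercubes" "\<And>i. x $ i = 0 \<or> x $ (i :: 'd::finite \<Rightarrow> 'n::finite) = 1"
  shows "x \<in> polytope_vertices stochastic_hypercubes"
proof (rule unique_support_vertex[OF x(1)])
  fix a assume a: "a \<in> stochastic_hypercubes" and zero: "\<And>i. x $ i = 0 \<Longrightarrow> a $ i = 0"
  have "a $ i = x $ i" for i
  proof (cases "x $ i = 0")
    case False
    \<comment> \<open>Any axis serves: on a line of \<open>x\<close> through an entry 1 all other
      entries vanish, so those of \<open>a\<close> vanish too and leave
      \<open>a $ i = 1\<close>.\<close>
    let ?k = "undefined :: 'd"
    have line: "(\<Sum>j\<in>UNIV. y $ (i(?k := j))) = y $ i + (\<Sum>j\<in>UNIV - {i ?k}. y $ (i(?k := j)))" for y :: "real ^ ('d \<Rightarrow> 'n)"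
      by (subst sum.remove[of _ "i ?k"]) auto
    have sums: "(\<Sum>j\<in>UNIV. x $ (i(?k := j))) = 1" "(\<Sum>j\<in>UNIV. a $ (i(?k := j))) = 1"
      using x(1) a by (auto simp: stochastic_hypercubes_def line_sums_eq_def)
    have xi: "x $ i = 1" using False x(2)[of i] by simp
    then have "(\<Sum>j\<in>UNIV - {i ?k}. x $ (i(?k := j))) = 0" using sums(1) unfolding line by simp
    then have "\<forall>j\<in>UNIV - {i ?k}. x $ (i(?k := j)) = 0"
      using x(1) by (subst (asm) sum_nonneg_eq_0_iff) (auto simp: stochastic_hypercubes_def)
    then have "(\<Sum>j\<in>UNIV - {i ?k}. a $ (i(?k := j))) = 0" using zero by (intro sum.neutral) blast
    then show ?thesis using sums(2) xi unfolding line by simp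
  qed (simp add: zero)
  then show "a = x" by (simp add: vec_eq_iff)
qed

text \<open>Since \<open>card\<close> is 0 on infinite sets, finiteness is what makes a lower bound
  on the number of vertices obtainable from a subset.\<close>

lemma finite_vertices_stochastic:
  "finite (polytope_vertices (stochastic_hypercubes :: (real ^ ('d::finite \<Rightarrow> 'n::finite)) set))"
proof -
  let ?e = "\<lambda>i. axis i 1 :: real ^ ('d \<Rightarrow> 'n)"
  let ?l = "\<lambda>(k, i). \<Sum>j\<in>UNIV. ?e (i(k := j))"
  have l: "?l (k, i) \<bullet> x = (\<Sum>j\<in>UNIV. x $ (i(k := j)))" for k i x
    by (simp add: inner_sum_left inner_axis')
  have "stochastic_hypercubes = (\<Inter>i. {x. ?e i \<bullet> x \<ge> 0}) \<inter> (\<Inter>p. {x. ?l p \<bullet> x = 1})"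
    unfolding stochastic_hypercubes_def line_sums_eq_def
    by (auto simp: l[unfolded prod.case] inner_axis')
  moreover have "polyhedron \<dots>"
    by (intro polyhedron_Int polyhedron_Inter) (auto intro: polyhedron_halfspace_ge polyhedron_hyperplane)
  ultimately show ?thesis unfolding polytope_vertices_def by (metis finite_polyhedron_extreme_points)
qed

text \<open>\<open>h\<close> numbers the layers, so that each is assigned a permutation of the list;
  the entries are the 0/1 indicator of its graph.\<close>

definition latin_array :: "('n \<Rightarrow> nat) \<Rightarrow> ('n \<Rightarrow> 'n) list \<Rightarrow> real ^ (3 \<Rightarrow> 'n::finite)"
  where "latin_array h ps = (\<chi> i. of_bool ((ps ! h (i 2)) (i 0) = i 1))"

lemma sum_of_bool_ex1:
  assumes "\<exists>!j. Q (j :: 'n::finite)"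
  shows "(\<Sum>j\<in>UNIV. of_bool (Q j)) = (1 :: real)"
proof -
  from assms obtain j0 where "\<And>j. Q j \<longleftrightarrow> j = j0" by auto
  then show ?thesis by simp
qed

lemma latin_array_vertex:
  assumes ps: "ps \<in> disjoint_perms CARD('n::finite)" and h: "bij_betw h (UNIV :: 'n set) {..<CARD('n)}"
  shows "latin_array h ps \<in> polytope_vertices (stochastic_hypercubes :: (real ^ (3 \<Rightarrow> 'n)) set)"
proof (rule zero_one_stochastic_vertex)
  have len: "length ps = CARD('n)" using ps by (simp add: disjoint_perms_def)
  have bij: "bij (ps ! h k)" for k
    using ps len bij_betwE[OF h] by (auto simp: disjoint_perms_def)
  have "(\<Sum>j\<in>UNIV. latin_array h ps $ (i(k := j))) = 1" for k and i :: "3 \<Rightarrow> 'n"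
  proof -
    \<comment> \<open>This settles the lines across the layers: disjoint permutations take distinct
      values at \<open>i 0\<close>, so every value occurs in exactly one layer.\<close>
    have bl: "bij (\<lambda>k. (ps ! h k) (i 0))"
    proof -
      have "inj (\<lambda>k. (ps ! h k) (i 0))"
      proof (rule injI)
        fix k l assume e: "(ps ! h k) (i 0) = (ps ! h l) (i 0)"
        have d: "distinct (map (\<lambda>p. p (i 0)) ps)" using ps by (simp add: disjoint_perms_def)
        have "h k < length ps" "h l < length ps" using bij_betwE[OF h] len by auto
        with e have "h k = h l" using nth_eq_iff_index_eq[OF d, of "h k" "h l"] by simp
        then show "k = l" using h by (auto simp: bij_betw_def dest: injD)
      qed
      then show ?thesis by (simp add: bij_def finite_UNIV_inj_surj)
    qed
    consider "k = 0" | "k = 1" | "k = 2" using exhaust_3_zero by blast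
    then have "\<exists>!j. (ps ! h ((i(k := j)) 2)) ((i(k := j)) 0) = (i(k := j)) 1"
      using bij bl by cases (auto simp: bij_iff)
    then show ?thesis unfolding latin_array_def by (simp only: vec_lambda_beta sum_of_bool_ex1)
  qed
  then show "latin_array h ps \<in> stochastic_hypercubes"
    by (simp add: stochastic_hypercubes_def line_sums_eq_def, simp add: latin_array_def)
qed (simp add: latin_array_def)

lemma card_vertices_stochastic_ge:
  "fact CARD('n) ^ (2 * CARD('n)) / real CARD('n) ^ (CARD('n)^2) \<le>
    card (polytope_vertices (stochastic_hypercubes :: (real ^ (3 \<Rightarrow> 'n::finite)) set))"
proof -
  obtain h where h: "bij_betw h (UNIV :: 'n set) {..<CARD('n)}"
    using ex_bij_betw_finite_nat[of "UNIV :: 'n set"] by (auto simp: atLeast0LessThan)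
  have "inj_on (latin_array h) (disjoint_perms CARD('n))"
  proof (rule inj_onI)
    fix ps qs :: "('n \<Rightarrow> 'n) list"
    assume ps: "ps \<in> disjoint_perms CARD('n)" "qs \<in> disjoint_perms CARD('n)"
      and e: "latin_array h ps = latin_array h qs"
    show "ps = qs"
    proof (rule nth_equalityI)
      show "length ps = length qs" using ps by (simp add: disjoint_perms_def)
      fix m assume "m < length ps"
      then have "m \<in> h ` UNIV" using h ps by (simp add: bij_betw_def disjoint_perms_def)
      then obtain k where k: "m = h k" by auto
      show "ps ! m = qs ! m"
      proof
        fix a
        define i :: "3 \<Rightarrow> 'n" where "i d = (if d = 0 then a else if d = 1 then (ps ! m) a else k)" for d
        have "latin_array h ps $ i = latin_array h qs $ i" using e by simp
        then show "(ps ! m) a = (qs ! m) a"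
          by (simp add: latin_array_def i_def k split: if_splits)
      qed
    qed
  qed
  then have "card (disjoint_perms CARD('n) :: ('n \<Rightarrow> 'n) list set) =
      card (latin_array h ` disjoint_perms CARD('n))" by (simp add: card_image)
  also have "\<dots> \<le> card (polytope_vertices (stochastic_hypercubes :: (real ^ (3 \<Rightarrow> 'n)) set))"
    using latin_array_vertex[OF _ h] by (intro card_mono finite_vertices_stochastic) auto
  finally show ?thesis using card_latin_ge[where 'n = 'n] by linarith
qed

theorem theorem0p1:
  fixes F :: "real fps"
  defines "F \<equiv> Abs_fps (\<lambda>s. real (SH TYPE(3) TYPE(3) s))"
  shows
    "F = (fps_X^8 + 5 * fps_X^7 + 67 * fps_X^6 + 130 * fps_X^5 + 242 * fps_X^4
            + 130 * fps_X^3 + 67 * fps_X^2 + 5 * fps_X + 1)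
         / ((1 - fps_X)^9 * (1 + fps_X)^2)
     \<and> fps_cutoff 8 F =
         1 + 12 * fps_X + 132 * fps_X^2 + 847 * fps_X^3 + 3921 * fps_X^4
           + 14286 * fps_X^5 + 43687 * fps_X^6 + 116757 * fps_X^7
     \<and> (\<forall>s. real (SH TYPE(3) TYPE(3) s) =
           (if even s then
              9/2240 * real s^8 + 27/560 * real s^7 + 87/320 * real s^6 + 297/320 * real s^5
              + 1341/640 * real s^4 + 513/160 * real s^3 + 3653/1120 * real s^2
              + 627/280 * real s + 1
            else
              9/2240 * real s^8 + 27/560 * real s^7 + 87/320 * real s^6 + 297/320 * real s^5
              + 1341/640 * real s^4 + 513/160 * real s^3 + 3653/1120 * real s^2
              + 4071/2240 * real s + 47/128))
     \<and> real (card (polytope_vertices (stochastic_hypercubes :: (real ^ (3 \<Rightarrow> 'n::finite)) set)))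
         \<ge> fact CARD('n) ^ (2 * CARD('n)) / real CARD('n) ^ (CARD('n)^2)
     \<and> \<not> integral_polytope (stochastic_hypercubes :: (real ^ (3 \<Rightarrow> 3)) set)
     \<and> \<not> integral_polytope (stochastic_hypercubes :: (real ^ (4 \<Rightarrow> 3)) set)"
  unfolding F_def
proof (intro conjI)
  show "\<forall>s. real (SH TYPE(3) TYPE(3) s) =
      (if even s then
         9/2240 * real s^8 + 27/560 * real s^7 + 87/320 * real s^6 + 297/320 * real s^5
         + 1341/640 * real s^4 + 513/160 * real s^3 + 3653/1120 * real s^2
         + 627/280 * real s + 1
       else
         9/2240 * real s^8 + 27/560 * real s^7 + 87/320 * real s^6 + 297/320 * real s^5
         + 1341/640 * real s^4 + 513/160 * real s^3 + 3653/1120 * real s^2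
         + 4071/2240 * real s + 47/128)"
    using SH_closed_form unfolding SH_even_def SH_odd_def by blast
qed (rule SH_fps_div SH_fps_cutoff card_vertices_stochastic_ge not_integral_3 not_integral_4)+

end
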